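(* (i) We have $$\left\{3\bar p_5(w)+\bar p_5(x)+\bar p_5(y)+\bar p_5(z):\ w,x,y,z\in\mathbb{N}\right\}=\mathbb{N}\setminus\{1,3,5,18,31\}.$$ (ii) Any integer $n>1$ can be written as $$3\,\frac{w(5w+1)}2+\frac{x(5x+1)}2+\frac{y(5y+1)}2+\frac{z(5z+1)}2$$ with $w,x,y,z\in\mathbb{Z}$. Moreover, each integer $n>151$ can be written as $$3\,\frac{w(5w-1)}2+\frac{x(5x-1)}2+\frac{y(5y-1)}2+\frac{z(5z-1)}2$$ with $w,x,y,z\in\mathbb{N}$, and any integer $n>682$ can be written as $$3\,\frac{w(5w+1)}2+\frac{x(5x+1)}2+\frac{y(5y+1)}2+\frac{z(5z+1)}2$$ with $w,x,y,z\in\mathbb{N}$. (iii) $1,2,5,14$ are the only natural numbers not of the form $$3\,\frac{w(7w+1)}2+\frac{x(7x+1)}2+\frac{y(7y+1)}2+\frac{z(7z+1)}2\quad (w,x,y,z\in\mathbb{Z}),$$ and $1,3,14$ are the only natural numbers not of the form $$3\,\frac{w(7w+3)}2+\frac{x(7x+3)}2+\frac{y(7y+3)}2+\frac{z(7z+3)}2\quad (w,x,y,z\in\mathbb{Z}).$$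
   Context: $\mathbb{N}=\{0,1,2,\ldots\}$ is the set of natural numbers. For $n\in\mathbb{N}$, $\bar p_5(n)=\frac{n(3n+1)}2$ (the second pentagonal numbers). *)

theory Defs
  imports Main
begin

definition second_pentagonal :: "nat \<Rightarrow> nat" where
  "second_pentagonal n = n * (3 * n + 1) div 2"

text \<open>All quotients by 2 are exact, so integer division agrees with the rational quotient.\<close>

lemma two_times_second_pentagonal: "2 * second_pentagonal n = n * (3 * n + 1)"
  unfolding second_pentagonal_def by simp

lemma two_times_half_quadratic:
  fixes a b w :: int
  assumes "odd a" and "odd b"
  shows "2 * (w * (a * w + b) div 2) = w * (a * w + b)"
    and "2 * (w * (a * w - b) div 2) = w * (a * w - b)"
  using assms by simp_all

end

theory Submission
  imports Defs "HOL-Number_Theory.Number_Theory" "HOL-Computational_Algebra.Squarefree"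
begin

text \<open>If \<open>a = 3w\<^sup>2 + x\<^sup>2 + y\<^sup>2 + z\<^sup>2\<close> and \<open>b = 3w + x + y + z\<close>, then the sum of the four values of
  \<open>u(mu + c)/2\<close> with weights \<open>3, 1, 1, 1\<close> is \<open>(ma + cb)/2\<close>. As in Cauchy's proof of the polygonal number
  theorem, a pair \<open>a, b\<close> of odd numbers arises in this way if \<open>6a - b\<^sup>2\<close> is represented by
  \<open>t\<^sup>2 + 4(p\<^sup>2 + pq + q\<^sup>2)\<close>, and \<open>w, x, y, z\<close> are nonnegative if moreover \<open>(b + 1)\<^sup>2 > 5(a - 1)\<close>. The
  ternary form represents \<open>6a - b\<^sup>2\<close> if \<open>3\<close> does not divide \<open>b\<close> or \<open>6a - b\<^sup>2 \<equiv> 3 (mod 9)\<close>: a rational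
  representation by \<open>x\<^sup>2 + y\<^sup>2 + 3z\<^sup>2\<close> comes from Legendre's theorem and an auxiliary prime
  \<open>p \<equiv> 1 (mod 4)\<close> with prescribed quadratic residue symbols, and a Davenport--Cassels descent on the
  form \<open>x\<^sup>2 + y\<^sup>2 + yz + z\<^sup>2\<close> makes it integral. The prime exists by the real-character case of
  Dirichlet's theorem, proved by Mertens' method; \<open>L(1, \<chi>) \<noteq> 0\<close> is shown by Monsky's argument with
  Lambert series. For large \<open>n\<close> a suitable \<open>b\<close> lies in the admissible interval; the remaining \<open>n\<close> are
  settled by computation.\<close>

section \<open>Mean values of the von Mangoldt function\<close>

text \<open>Legendre's theorem concerns equations with three terms, whereas
  \<open>n * t\<^sup>2 = x\<^sup>2 + y\<^sup>2 + 3 * z\<^sup>2\<close> has four. Restricting x^2 +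
  y^2 to p k^2 for a prime p removes one term; the price is that a suitable p must exist. Its
  conditions involve real characters only and a single prime is enough, so neither complex
  characters nor densities enter.

  The clause modulo 9 reflects the prime 3: a value of x^2 + y^2 + 3 z^2 divisible by 3 has 3 | x
  and 3 | y, hence is 0 or 3 modulo 9, never 6. For m = 5 and m = 7 the equation 2 n = m a + c b
  leaves b free modulo 3, so multiples of 3 can be avoided. For m = 3 it forces b modulo 3, and if 3
  | n the residue of b modulo 9 has to be chosen instead.

  Nonnegativity confines b^2 to the range from about 10 n / m to 12 n / m, whose square roots differ
  by less than ten percent. A full set of residue classes fits only for n in the thousands; hence
  the size of the computations.\<close>

lemma abel_summation:
  fixes f g :: "nat \<Rightarrow> real"
  assumes "a \<le> b"
  shows "(\<Sum>k\<in>{a..<b}. f k * g k) =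
    (\<Sum>k\<in>{a..<b}. f k) * g b + (\<Sum>k\<in>{a..<b}. (\<Sum>j\<in>{a..<Suc k}. f j) * (g k - g (Suc k)))"
  using assms
proof (induction b rule: dec_induct)
  case (step n)
  then show ?case by (simp add: algebra_simps)
qed simp

text \<open>Dirichlet's test with an explicit constant: after summation by parts the differences of
  the decreasing weights telescope, and only the first weight survives. Monotonicity is asked from
  \<open>a\<close> on only, since \<open>ln k / k\<close> decreases only from 3 on.\<close>

lemma abel_bound:
  fixes f g :: "nat \<Rightarrow> real"
  assumes B: "\<And>a b. \<bar>\<Sum>k\<in>{a..<b}. f k\<bar> \<le> B"
    and g: "\<And>k. k \<ge> a \<Longrightarrow> 0 \<le> g k" "\<And>k. k \<ge> a \<Longrightarrow> g (Suc k) \<le> g k"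
  shows "\<bar>\<Sum>k\<in>{a..<b}. f k * g k\<bar> \<le> B * g a"
proof (cases "a \<le> b")
  case True
  have B0: "B \<ge> 0" using B[of 0 0] by simp
  have "\<bar>\<Sum>k\<in>{a..<b}. f k * g k\<bar> \<le> \<bar>(\<Sum>k\<in>{a..<b}. f k) * g b\<bar> +
      \<bar>\<Sum>k\<in>{a..<b}. (\<Sum>j\<in>{a..<Suc k}. f j) * (g k - g (Suc k))\<bar>"
    by (subst abel_summation[OF True]) (rule abs_triangle_ineq)
  also have "\<dots> \<le> B * g b + (\<Sum>k\<in>{a..<b}. B * (g k - g (Suc k)))"
  proof (rule add_mono)
    show "\<bar>(\<Sum>k\<in>{a..<b}. f k) * g b\<bar> \<le> B * g b"
      using g(1)[OF True] B[of a b] by (simp add: abs_mult mult_right_mono)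
    show "\<bar>\<Sum>k\<in>{a..<b}. (\<Sum>j\<in>{a..<Suc k}. f j) * (g k - g (Suc k))\<bar> \<le> (\<Sum>k\<in>{a..<b}. B * (g k - g (Suc k)))"
    proof (rule order_trans[OF sum_abs sum_mono])
      fix k assume "k \<in> {a..<b}"
      hence "g k - g (Suc k) \<ge> 0" using g(2)[of k] by simp
      then show "\<bar>(\<Sum>j\<in>{a..<Suc k}. f j) * (g k - g (Suc k))\<bar> \<le> B * (g k - g (Suc k))"
        using B[of a "Suc k"] by (simp only: abs_mult abs_of_nonneg mult_right_mono)
    qed
  qed
  also have "\<dots> = B * g a"
  proof -
    have "(\<Sum>k\<in>{a..<b}. g k - g (Suc k)) = g a - g b"
      using sum_Suc_diff'[OF True, of "\<lambda>k. - g k"] by simp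
    then show ?thesis by (simp only: sum_distrib_left[symmetric]) (simp add: algebra_simps)
  qed
  finally show ?thesis .
next
  case False
  then show ?thesis using g(1)[of a] B[of 0 0] by simp
qed

text \<open>Pairs \<open>(k, d)\<close> with \<open>d dvd k\<close> correspond to pairs
  \<open>(d, e)\<close> with \<open>d * e \<le> n\<close>. All Dirichlet convolutions below are
  summed through this exchange.\<close>

lemma sum_over_divisors_swap:
  fixes F :: "nat \<Rightarrow> nat \<Rightarrow> 'a::comm_monoid_add"
  shows "(\<Sum>k\<in>{1..n}. \<Sum>d | d dvd k. F d (k div d)) = (\<Sum>d\<in>{1..n}. \<Sum>e\<in>{1..n div d}. F d e)"
proof -
  have pos: "0 < b \<and> b \<le> n" if "b dvd a" "0 < a" "a \<le> n" for a b
    using that dvd_imp_le[of b a] dvd_pos_nat[of a b] by auto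
  have "(\<Sum>k\<in>{1..n}. \<Sum>d | d dvd k. F d (k div d)) = (\<Sum>(k,d)\<in>(SIGMA k:{1..n}. {d. d dvd k}). F d (k div d))"
    by (subst sum.Sigma) auto
  also have "\<dots> = (\<Sum>(d,e)\<in>(SIGMA d:{1..n}. {1..n div d}). F d e)"
    by (rule sum.reindex_bij_witness[of _ "\<lambda>(d,e). (d*e,d)" "\<lambda>(k,d). (d, k div d)"])
      (use pos in \<open>auto intro: div_le_mono simp: Suc_le_eq dvd_div_eq_0_iff div_greater_zero_iff less_eq_div_iff_mult_less_eq mult.commute\<close>)
  also have "\<dots> = (\<Sum>d\<in>{1..n}. \<Sum>e\<in>{1..n div d}. F d e)"
    by (subst sum.Sigma) auto
  finally show ?thesis .
qed

section \<open>Bounds of Chebyshev and Mertens type\<close>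

lemma ln_fact_eq_sum_mangoldt:
  "ln (fact n) = (\<Sum>d\<in>{1..n}. mangoldt d * real (n div d))"
proof -
  have "ln (fact n) = (\<Sum>k\<in>{1..n}. ln (real k))"
    by (induction n) (auto simp: ln_mult)
  also have "\<dots> = (\<Sum>k\<in>{1..n}. \<Sum>d | d dvd k. mangoldt d)"
    by (intro sum.cong refl) (subst mangoldt_sum, auto)
  also have "\<dots> = (\<Sum>d\<in>{1..n}. mangoldt d * real (n div d))"
    by (subst sum_over_divisors_swap) (simp add: mult.commute)
  finally show ?thesis .
qed

lemma ln_fact_lower: "n > 0 \<Longrightarrow> real n * ln n - n \<le> ln (fact n)"
proof (induction n rule: nat_induct_non_zero)
  case (Suc n)
  have "ln (1 + 1 / real n) \<le> 1 / real n" by (rule ln_add_one_self_le_self) simp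
  then have "real n * ln (1 + 1 / real n) \<le> 1"
    using Suc.hyps by (simp add: field_simps)
  moreover have "ln (1 + 1 / real n) = ln (real n + 1) - ln n"
    using Suc.hyps ln_div[of "real n + 1" "real n"] by (simp add: add_divide_distrib)
  ultimately have "real n * (ln (real n + 1) - ln n) \<le> 1"
    by simp
  moreover have "ln (fact (Suc n)) = ln (real n + 1) + ln (fact n)"
    by (simp add: ln_mult add.commute)
  ultimately show ?case using Suc by (simp add: algebra_simps)
qed simp

text \<open>Replacing \<open>n div d\<close> by the real quotient only enlarges Chebyshev's sum for
  \<open>ln (fact n)\<close>, so this half of Mertens' theorem follows from a weak Stirling bound.
  It supplies the divergence that produces primes.\<close>

lemma sum_mangoldt_over_lower: 
  assumes "n > 0" shows "ln (real n) - 1 \<le> (\<Sum>d\<in>{1..n}. mangoldt d / real d)"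
proof -
  have "real n * ln n - n \<le> (\<Sum>d\<in>{1..n}. mangoldt d * real (n div d))"
    using ln_fact_lower[OF assms] ln_fact_eq_sum_mangoldt[of n] by simp
  also have "\<dots> \<le> (\<Sum>d\<in>{1..n}. mangoldt d * (real n / real d))"
    by (intro sum_mono mult_left_mono mangoldt_nonneg) (rule of_nat_div_le_of_nat)
  also have "\<dots> = real n * (\<Sum>d\<in>{1..n}. mangoldt d / real d)"
    by (simp add: sum_distrib_left mult_ac)
  finally have "real n * (ln n - 1) \<le> real n * (\<Sum>d\<in>{1..n}. mangoldt d / real d)"
    by (simp add: right_diff_distrib)
  then show ?thesis using assms by simp
qed

text \<open>The weight \<open>(2 * n) div d - 2 * (n div d)\<close> is never negative and is at
  least 1 for \<open>n < d \<le> 2 * n\<close>; the weighted sum is the logarithm of the central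
  binomial coefficient.\<close>

lemma sum_mangoldt_dyadic: "(\<Sum>d\<in>{n<..2*n}. mangoldt d) \<le> 2 * real n"
proof -
  have "(\<Sum>d\<in>{n<..2*n}. mangoldt d) \<le> (\<Sum>d\<in>{n<..2*n}. mangoldt d * (real ((2*n) div d) - 2 * real (n div d)))"
  proof (rule sum_mono)
    fix d assume d: "d \<in> {n<..2*n}"
    then have "n div d = 0" "2 * n div d \<ge> 1" by (auto simp: Suc_le_eq div_greater_zero_iff)
    then show "mangoldt d \<le> mangoldt d * (real (2*n div d) - 2 * real (n div d))"
      using mangoldt_nonneg[of d] by (simp add: mult_le_cancel_left1)
  qed
  also have "\<dots> \<le> (\<Sum>d\<in>{1..2*n}. mangoldt d * (real ((2*n) div d) - 2 * real (n div d)))"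
  proof (rule sum_mono2)
    fix d assume "d \<in> {1..2*n} - {n<..2*n}"
    have "2 * (n div d) \<le> (2*n) div d"
      by (cases "d = 0") (simp_all add: less_eq_div_iff_mult_less_eq mult.assoc)
    then have "real (2 * (n div d)) \<le> real ((2*n) div d)" by (simp only: of_nat_le_iff)
    then show "0 \<le> mangoldt d * (real (2*n div d) - 2 * real (n div d))"
      by (intro mult_nonneg_nonneg mangoldt_nonneg) simp
  qed auto
  also have "\<dots> = (\<Sum>d\<in>{1..2*n}. mangoldt d * real ((2*n) div d)) - 2 * (\<Sum>d\<in>{1..2*n}. mangoldt d * real (n div d))"
    by (simp add: algebra_simps sum_subtractf sum_distrib_left)
  also have "(\<Sum>d\<in>{1..2*n}. mangoldt d * real (n div d)) = (\<Sum>d\<in>{1..n}. mangoldt d * real (n div d))"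
    by (rule sum.mono_neutral_right) auto
  also have "(\<Sum>d\<in>{1..2*n}. mangoldt d * real ((2*n) div d)) - 2 * (\<Sum>d\<in>{1..n}. mangoldt d * real (n div d))
     = ln (fact (2*n)) - 2 * ln (fact n)"
    by (simp only: ln_fact_eq_sum_mangoldt)
  also have "\<dots> = ln (real ((2*n) choose n))"
  proof -
    have "real ((2*n) choose n) = fact (2*n) / (fact n * fact n)"
      by (subst binomial_fact) auto
    then show ?thesis by (simp add: ln_div ln_mult)
  qed
  also have "\<dots> \<le> ln (2 ^ (2*n))"
  proof -
    have "(2*n) choose n \<le> 2 ^ (2*n)" by (rule binomial_le_pow2)
    then have "real ((2*n) choose n) \<le> 2 ^ (2*n)" by (metis of_nat_le_iff of_nat_numeral of_nat_power)
    moreover have "(2*n) choose n > 0" by simp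
    ultimately show ?thesis by (subst ln_le_cancel_iff) auto
  qed
  also have "\<dots> = 2 * real n * ln 2" by (simp add: ln_realpow)
  also have "\<dots> \<le> 2 * real n" using ln_2_less_1 by (simp add: mult_le_cancel_left2)
  finally show ?thesis .
qed

lemma sum_mangoldt_le: "(\<Sum>d\<in>{1..n}. mangoldt d) \<le> 4 * real n"
proof (induction n rule: less_induct)
  case (less n)
  have step: "(\<Sum>d\<in>{1..2*k}. mangoldt d) \<le> 6 * real k" if "k < n" for k
  proof -
    have "{1..2*k} = {1..k} \<union> {k<..2*k}" by auto
    then have "(\<Sum>d\<in>{1..2*k}. mangoldt d) = (\<Sum>d\<in>{1..k}. mangoldt d) + (\<Sum>d\<in>{k<..2*k}. mangoldt d::real)"
      by (simp only:) (subst sum.union_disjoint, auto)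
    then show ?thesis using less.IH[OF that] sum_mangoldt_dyadic[of k] by simp
  qed
  consider "n = 0" | "n = 1" | k where "n = 2 * k" "k < n" | k where "n = 2 * k + 1" "k \<ge> 1"
  proof (cases "even n")
    case True
    then obtain k where "n = 2 * k" by (rule evenE)
    then show ?thesis using that(1) that(3)[of k] by (cases "k = 0") auto
  next
    case False
    then obtain k where "n = 2 * k + 1" by (rule oddE)
    then show ?thesis using that(2) that(4)[of k] by (cases "k = 0") auto
  qed
  then show ?case
  proof cases
    case 3 then show ?thesis using step[of k] by simp
  next
    case 4
    have "(\<Sum>d\<in>{1..n}. mangoldt d :: real) \<le> (\<Sum>d\<in>{1..2*(k+1)}. mangoldt d)"
      using 4 by (intro sum_mono2) (auto simp: mangoldt_nonneg)
    also have "\<dots> \<le> 6 * real (k+1)" using 4 by (intro step) simp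
    finally show ?thesis using 4 by simp
  qed auto
qed

section \<open>Real characters\<close>

text \<open>\<open>m\<close> is a period, not necessarily the conductor, so that products of
  characters of different conductors can share one modulus.\<close>

locale real_character =
  fixes \<chi> :: "nat \<Rightarrow> real" and m :: nat
  assumes mult: "\<chi> (a * b) = \<chi> a * \<chi> b"
    and one: "\<chi> 1 = 1"
    and range: "\<chi> n \<in> {-1, 0, 1}"
    and periodic: "\<chi> (n + m) = \<chi> n"
    and modulus_pos: "m > 0"
    and nonprincipal: "\<exists>c. coprime c m \<and> \<chi> c = -1"
begin

lemma power: "\<chi> (a ^ k) = \<chi> a ^ k"
  using one by (induction k) (simp_all add: mult)

lemma abs_le_1: "\<bar>\<chi> n\<bar> \<le> 1"
  using range[of n] by auto

lemma mod_modulus: "\<chi> (n mod m) = \<chi> n"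
proof -
  have "\<chi> (r + q * m) = \<chi> r" for r q
    by (induction q) (simp_all add: periodic add.commute[of m] add.assoc[symmetric])
  from this[of "n mod m" "n div m"] show ?thesis by simp
qed

text \<open>Multiplication by the element \<open>c\<close> of value -1 permutes the residues and
  reverses the sign of the sum.\<close>

lemma sum_period: "(\<Sum>k<m. \<chi> k) = 0"
proof -
  from nonprincipal obtain c where c: "coprime c m" "\<chi> c = -1" by blast
  have inj: "inj_on (\<lambda>k. c * k mod m) {..<m}"
  proof (rule inj_onI)
    fix x y assume xy: "x \<in> {..<m}" "y \<in> {..<m}" "c * x mod m = c * y mod m"
    then have "[x = y] (mod m)"
      using cong_mult_lcancel_nat[of c m x y] c(1) by (simp add: cong_def)
    then show "x = y" using xy(1,2) by (simp add: cong_def)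
  qed
  moreover have "(\<lambda>k. c * k mod m) ` {..<m} \<subseteq> {..<m}"
    using modulus_pos by auto
  ultimately have im: "(\<lambda>k. c * k mod m) ` {..<m} = {..<m}"
    by (intro card_subset_eq) (auto simp: card_image)
  have "(\<Sum>k<m. \<chi> k) = (\<Sum>k\<in>(\<lambda>k. c * k mod m) ` {..<m}. \<chi> k)"
    by (simp only: im)
  also have "\<dots> = (\<Sum>k<m. \<chi> (c * k mod m))"
    by (subst sum.reindex[OF inj]) simp
  also have "\<dots> = - (\<Sum>k<m. \<chi> k)"
    by (simp add: mod_modulus mult c sum_negf)
  finally show ?thesis by simp
qed

lemma sum_bound: "\<bar>\<Sum>k\<in>{a..<b}. \<chi> k\<bar> \<le> 2 * real m"
proof -
  have shift: "(\<Sum>k<n + m. \<chi> k) = (\<Sum>k<n. \<chi> k)" for n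
    by (induction n) (simp_all add: sum_period periodic)
  have "(\<Sum>k<r + q * m. \<chi> k) = (\<Sum>k<r. \<chi> k)" for q r
  proof (induction q)
    case (Suc q)
    then show ?case using shift[of "r + q * m"] by (simp add: algebra_simps)
  qed simp
  from this[of "n mod m" "n div m" for n] have red: "(\<Sum>k<n. \<chi> k) = (\<Sum>k<n mod m. \<chi> k)" for n
    by simp
  have bd: "\<bar>\<Sum>k<n. \<chi> k\<bar> \<le> real m" for n
  proof -
    have "\<bar>\<Sum>k<n mod m. \<chi> k\<bar> \<le> (\<Sum>k<n mod m. 1)"
      by (rule order_trans[OF sum_abs sum_mono]) (rule abs_le_1)
    also have "\<dots> \<le> real m" using modulus_pos by (simp add: less_imp_le)
    finally show ?thesis by (simp only: red[of n])
  qed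
  show ?thesis
  proof (cases "a \<le> b")
    case True
    have "(\<Sum>k\<in>{a..<b}. \<chi> k) = (\<Sum>k<b. \<chi> k) - (\<Sum>k<a. \<chi> k)"
      using sum_diff_nat_ivl[of 0 a b \<chi>] True by (simp add: atLeast0LessThan)
    then show ?thesis using bd[of a] bd[of b] by simp
  qed auto
qed

lemmas weighted_sum_bound = abel_bound[OF sum_bound]

definition L1 :: real where "L1 = lim (\<lambda>n. \<Sum>k\<in>{1..<n}. \<chi> k * (1 / real k))"

lemma L1_tail: "\<bar>L1 - (\<Sum>k\<in>{1..n}. \<chi> k * (1 / real k))\<bar> \<le> 2 * real m / real (Suc n)"
proof -
  define P where "P = (\<lambda>n. \<Sum>k\<in>{1..<n}. \<chi> k * (1 / real k))"
  have diff: "\<bar>P b - P a\<bar> \<le> 2 * real m / real a" if "a > 0" "a \<le> b" for a b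
  proof -
    have "P b - P a = (\<Sum>k\<in>{a..<b}. \<chi> k * (1 / real k))"
      unfolding P_def using that by (intro sum_diff_nat_ivl) auto
    also have "\<bar>\<dots>\<bar> \<le> 2 * real m * (1 / real a)"
      using that by (intro weighted_sum_bound) (auto simp: field_simps)
    finally show ?thesis by simp
  qed
  have "Cauchy P"
  proof (rule CauchyI')
    fix e :: real assume "e > 0"
    obtain M :: nat where M: "2 * real m / e < real M" using reals_Archimedean2 by blast
    have "2 * real m / e \<ge> 0" using \<open>e > 0\<close> by simp
    with M have "M > 0" by linarith
    show "\<exists>M. \<forall>a\<ge>M. \<forall>b>a. dist (P a) (P b) < e"
    proof (intro exI[of _ M] allI impI)
      fix a b assume ab: "a \<ge> M" "b > a"
      have "dist (P a) (P b) \<le> 2 * real m / real a"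
        using diff[of a b] ab \<open>M > 0\<close> by (simp add: dist_real_def abs_minus_commute)
      also have "\<dots> \<le> 2 * real m / real M"
        using ab \<open>M > 0\<close> by (intro divide_left_mono) auto
      also have "\<dots> < e" using M \<open>e > 0\<close> \<open>M > 0\<close> by (simp add: field_simps)
      finally show "dist (P a) (P b) < e" .
    qed
  qed
  then have lim: "P \<longlonglongrightarrow> L1"
    unfolding L1_def P_def[symmetric] by (simp add: Cauchy_convergent_iff convergent_LIMSEQ_iff)
  have "(\<lambda>b. \<bar>P b - P (Suc n)\<bar>) \<longlonglongrightarrow> \<bar>L1 - P (Suc n)\<bar>"
    by (intro tendsto_intros lim)
  moreover have "\<forall>b\<ge>Suc n. \<bar>P b - P (Suc n)\<bar> \<le> 2 * real m / real (Suc n)"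
    by (auto intro!: diff simp del: of_nat_Suc)
  ultimately have "\<bar>L1 - P (Suc n)\<bar> \<le> 2 * real m / real (Suc n)"
    by (intro LIMSEQ_le_const2) blast+
  then show ?thesis by (simp add: P_def atLeastLessThanSuc_atLeastAtMost)
qed

section \<open>Divisor sums of a real character\<close>

definition conv_one :: "nat \<Rightarrow> real" where "conv_one n = (\<Sum>d | d dvd n. \<chi> d)"

text \<open>A divisor of \<open>p ^ Suc k * n\<close> either is prime to \<open>p\<close>, hence
  divides \<open>n\<close>, or is \<open>p\<close> times a divisor of \<open>p ^ k * n\<close>.
  Iteration yields the Euler factor \<open>1 + \<chi> p + ... + \<chi> p ^ k\<close>, which is
  nonnegative, and at least 1 for even \<open>k\<close>.\<close>

lemma conv_one_prime_step:
  assumes "prime p" "\<not> p dvd n" "n > 0"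
  shows "conv_one (p ^ Suc k * n) = conv_one n + \<chi> p * conv_one (p ^ k * n)"
proof -
  have p0: "p > 0" using assms prime_gt_0_nat by blast
  have pos: "p ^ j * n > 0" for j using p0 assms by simp
  have eq: "{d. d dvd p ^ Suc k * n} = {d. d dvd n} \<union> (\<lambda>d. p * d) ` {d. d dvd p ^ k * n}"
  proof (intro equalityI subsetI)
    fix d assume "d \<in> {d. d dvd p ^ Suc k * n}"
    then have d: "d dvd p ^ Suc k * n" by simp
    show "d \<in> {d. d dvd n} \<union> (\<lambda>d. p * d) ` {d. d dvd p ^ k * n}"
    proof (cases "p dvd d")
      case True
      then obtain e where "d = p * e" by (rule dvdE)
      with d p0 show ?thesis by (auto simp: mult.assoc)
    next
      case False
      then have "coprime d (p ^ Suc k)" 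
        using assms(1) by (metis coprime_commute coprime_power_right_iff prime_imp_coprime)
      with d show ?thesis by (simp add: coprime_dvd_mult_right_iff)
    qed
  qed (auto simp: mult.assoc intro: dvd_mult)
  have "conv_one (p ^ Suc k * n) = (\<Sum>d | d dvd n. \<chi> d) + (\<Sum>d\<in>(\<lambda>d. p * d) ` {d. d dvd p ^ k * n}. \<chi> d)"
    unfolding conv_one_def eq using assms pos[of k] by (intro sum.union_disjoint) auto
  also have "(\<Sum>d\<in>(\<lambda>d. p * d) ` {d. d dvd p ^ k * n}. \<chi> d) = \<chi> p * conv_one (p ^ k * n)"
    using p0 by (subst sum.reindex) (auto simp: inj_on_def conv_one_def mult sum_distrib_left)
  finally show ?thesis by (simp add: conv_one_def)
qed

lemma conv_one_prime_power:
  assumes "prime p" "\<not> p dvd n" "n > 0"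
  shows "conv_one (p ^ k * n) = conv_one n * (\<Sum>i\<le>k. \<chi> p ^ i)"
proof (induction k)
  case (Suc k)
  have "(\<Sum>i\<le>Suc k. \<chi> p ^ i) = 1 + \<chi> p * (\<Sum>i\<le>k. \<chi> p ^ i)"
    by (subst sum.atMost_Suc_shift) (simp add: sum_distrib_left)
  then show ?case
    unfolding conv_one_prime_step[OF assms] Suc by (simp only:) (simp add: algebra_simps)
qed simp

lemma geometric_nonneg: "(\<Sum>i\<le>k. \<chi> p ^ i) \<ge> 0"
  and geometric_even: "even k \<Longrightarrow> (\<Sum>i\<le>k. \<chi> p ^ i) \<ge> 1"
proof -
  have "(\<Sum>i\<le>k. x ^ i) \<ge> (if even k then 1 else 0)" if "x \<in> {-1, 0, 1}" for x :: real and k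
  proof -
    have "(\<Sum>i\<le>k. (-1::real) ^ i) = (if even k then 1 else 0)" by (induction k) auto
    moreover have "(\<Sum>i\<le>k. (0::real) ^ i) = 1" by (induction k) auto
    ultimately show ?thesis using that by auto
  qed
  from this[OF range, of k p] show "(\<Sum>i\<le>k. \<chi> p ^ i) \<ge> 0" "even k \<Longrightarrow> (\<Sum>i\<le>k. \<chi> p ^ i) \<ge> 1"
    by (auto split: if_splits)
qed

lemma conv_one_nonneg: "n > 0 \<Longrightarrow> conv_one n \<ge> 0"
proof (induction n rule: less_induct)
  case (less n)
  show ?case
  proof (cases "n = 1")
    case False
    then obtain p where p: "prime p" "p dvd n" using prime_factor_nat by blast
    obtain n' where n': "n = p ^ multiplicity p n * n'" "\<not> p dvd n'"
      using multiplicity_decompose'[of n p] prime_gt_1_nat[OF p(1)] less.prems by auto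
    have "multiplicity p n > 0" using p less.prems by (simp add: prime_multiplicity_gt_zero_iff)
    then have "1 < p ^ multiplicity p n" using p(1) prime_gt_1_nat one_less_power by blast
    moreover have "n' > 0" using n' less.prems by (metis mult_0_right neq0_conv)
    ultimately have "n' < n" by (subst n'(1)) simp
    then show ?thesis 
      using less.IH[of n'] \<open>n' > 0\<close> conv_one_prime_power[OF p(1) n'(2), of "multiplicity p n"] geometric_nonneg n'(1)
      by (metis mult_nonneg_nonneg)
  qed (simp add: conv_one_def one[simplified])
qed

text \<open>In a square every prime has an even exponent, so each Euler factor is at least 1. The
  supply of squares is what makes the Lambert series of \<open>conv_one\<close> too large for
  \<open>L1 = 0\<close>.\<close>

lemma conv_one_square: "s > 0 \<Longrightarrow> conv_one (s\<^sup>2) \<ge> 1"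
proof (induction s rule: less_induct)
  case (less s)
  show ?case
  proof (cases "s = 1")
    case False
    then obtain p where p: "prime p" "p dvd s" using prime_factor_nat by blast
    define k where "k = multiplicity p s"
    obtain s' where s': "s = p ^ k * s'" "\<not> p dvd s'"
      using multiplicity_decompose'[of s p] prime_gt_1_nat[OF p(1)] less.prems by (auto simp: k_def)
    have "k > 0" using p less.prems by (simp add: prime_multiplicity_gt_zero_iff k_def)
    then have "1 < p ^ k" using p(1) prime_gt_1_nat one_less_power by blast
    moreover have "s' > 0" using s' less.prems by (metis mult_0_right neq0_conv)
    ultimately have "s' < s" by (subst s'(1)) simp
    then have "conv_one (s'\<^sup>2) \<ge> 1" using less.IH[of s'] \<open>s' > 0\<close> by simp
    moreover have "\<not> p dvd s'\<^sup>2" using p(1) s'(2) prime_dvd_power by blast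
    moreover have "s\<^sup>2 = p ^ (2 * k) * s'\<^sup>2" by (subst s'(1)) (simp add: power_mult_distrib power_mult mult.commute flip: power_mult)
    ultimately show ?thesis 
      using conv_one_prime_power[OF p(1), of "s'\<^sup>2" "2 * k"] geometric_even[of "2*k" p] \<open>s' > 0\<close>
      by (metis dvd_triv_left mult_mono' mult_1 zero_le_one zero_less_power)
  qed (simp add: conv_one_def one[simplified])
qed

end

text \<open>Pair the exponents \<open>i\<close> and \<open>n - 1 - i\<close>: by the inequality of
  the means each pair is at least \<open>2 * u ^ (n - 1)\<close>. The base is written as a square so
  that the mean exponent needs no roots.\<close>

lemma geometric_sum_ge:
  fixes u :: real
  assumes "u \<ge> 0"
  shows "real n * u ^ (n - 1) \<le> (\<Sum>i<n. (u\<^sup>2) ^ i)"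
proof -
  have "2 * (real n * u ^ (n - 1)) = (\<Sum>i<n. 2 * u ^ (n - 1))" by simp
  also have "\<dots> \<le> (\<Sum>i<n. (u\<^sup>2) ^ i + (u\<^sup>2) ^ (n - Suc i))"
  proof (rule sum_mono)
    fix i assume "i \<in> {..<n}"
    then have "n - 1 = i + (n - Suc i)" by auto
    then have "u ^ (n - 1) = u ^ i * u ^ (n - Suc i)" by (simp only: power_add)
    then show "2 * u ^ (n - 1) \<le> (u\<^sup>2) ^ i + (u\<^sup>2) ^ (n - Suc i)"
      using sum_squares_bound[of "u ^ i" "u ^ (n - Suc i)"]
      by (simp add: power_mult[symmetric] mult_ac)
  qed
  also have "\<dots> = 2 * (\<Sum>i<n. (u\<^sup>2) ^ i)"
    by (simp add: sum.distrib sum.nat_diff_reindex)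
  finally show ?thesis by simp
qed

section \<open>Nonvanishing of L(1) and the twisted Mertens bound\<close>

context real_character
begin

text \<open>Monsky's argument, truncated at \<open>M\<close>. The Lambert series with terms
  \<open>\<chi> d * t ^ d / (1 - t ^ d)\<close> has the coefficients \<open>conv_one n\<close>.
  Multiplied by \<open>1 - t\<close>, its terms are close to \<open>\<chi> d / d\<close>; if
  \<open>L1 = 0\<close>, what remains is of size \<open>1 - t\<close>, while the squares alone
  contribute the left-hand side. The terms with \<open>M\<close> pay for the truncation.\<close>

lemma conv_one_partial_sum:
  fixes u :: real
  assumes u: "0 < u" "u < 1" and L: "L1 = 0" and K: "K\<^sup>2 \<le> M"
  defines "t \<equiv> u\<^sup>2"
  shows "(1 - t) * (\<Sum>s\<in>{1..K}. t ^ s\<^sup>2) \<le> 2 * real m / real (Suc M) + 2 * real m * (1 - t) + real M * t ^ M"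
proof -
  have t: "0 < t" "t < 1" using u unfolding t_def by (auto simp: power_less_one_iff)
  define G where "G = (\<lambda>n. \<Sum>i<n. t ^ i)"
  have G1: "G d \<ge> 1" if "d > 0" for d
  proof -
    have "(\<Sum>i\<in>{0}. t ^ i) \<le> G d"
      unfolding G_def using that t by (intro sum_mono2) auto
    then show ?thesis by simp
  qed
  have Gp: "(1 - t) * G d = 1 - t ^ d" for d
    unfolding G_def by (rule sum_gp_basic[of t, folded lessThan_Suc_atMost, THEN sym, of "d - 1", simplified] one_diff_power_eq[symmetric])
  \<comment> \<open>\<open>t ^ n / G n\<close> is \<open>(1 - t) * t ^ n / (1 - t ^ n)\<close>, and
    \<open>c\<close> is its defect from \<open>1 / n\<close>. It decreases and starts at
    \<open>1 - t\<close>, so the character sum weighted by it is at most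
    \<open>2 * m * (1 - t)\<close>.\<close>
  define c where "c = (\<lambda>n. 1 / real n - t ^ n / G n)"
  have c_nonneg: "c n \<ge> 0" if "n \<ge> 1" for n
  proof -
    have "real n * t ^ n = (\<Sum>i<n. t ^ n)" by simp
    also have "\<dots> \<le> G n" unfolding G_def using t by (intro sum_mono power_decreasing) auto
    finally show ?thesis using that G1[of n] by (simp add: c_def field_simps)
  qed
  have c_dec: "c (Suc n) \<le> c n" if "n \<ge> 1" for n
  proof -
    have pos: "G n > 0" "G (Suc n) > 0" using G1[of n] G1[of "Suc n"] that by auto
    have "real n * real (Suc n) * t ^ n \<le> (real n * u ^ (n - 1)) * (real (Suc n) * u ^ n)"
    proof -
      have "t ^ n = u ^ (2 * n)" by (simp add: t_def power_mult)
      also have "\<dots> \<le> u ^ (2 * n - 1)" using u by (intro power_decreasing) auto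
      also have "2 * n - 1 = (n - 1) + n" using that by auto
      finally have "t ^ n \<le> u ^ (n - 1) * u ^ n" by (simp add: power_add)
      from mult_left_mono[OF this, of "real n * real (Suc n)"] show ?thesis by (simp add: mult_ac)
    qed
    also have "\<dots> \<le> G n * G (Suc n)"
      using geometric_sum_ge[of u n] geometric_sum_ge[of u "Suc n"] u
      unfolding G_def t_def by (intro mult_mono) (auto intro!: sum_nonneg)
    finally have key: "real n * real (Suc n) * t ^ n \<le> G n * G (Suc n)" .
    have "t ^ n * G (Suc n) - t ^ Suc n * G n = t ^ n * (G (Suc n) - t * G n)"
      by (simp add: algebra_simps)
    also have "G (Suc n) - t * G n = 1"
      using Gp[of n] by (simp add: G_def algebra_simps)
    finally have step: "t ^ n * G (Suc n) - t ^ Suc n * G n = t ^ n" by simp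
    have "t ^ n / G n - t ^ Suc n / G (Suc n) = t ^ n / (G n * G (Suc n))"
      using pos step by (simp add: field_simps)
    also have "\<dots> \<le> 1 / (real n * real (Suc n))"
      using key pos that by (simp add: divide_simps mult_ac del: of_nat_Suc)
    also have "\<dots> = 1 / real n - 1 / real (Suc n)"
      using that by (simp add: field_simps)
    finally show ?thesis by (simp add: c_def)
  qed
  have c1: "c 1 = 1 - t" by (simp add: c_def G_def)
  have A: "\<bar>\<Sum>d\<in>{1..M}. \<chi> d * (t ^ d / G d)\<bar> \<le> 2 * real m / real (Suc M) + 2 * real m * (1 - t)"
  proof -
    have "\<bar>\<Sum>d\<in>{1..<Suc M}. \<chi> d * c d\<bar> \<le> 2 * real m * c 1"
      by (rule weighted_sum_bound) (auto simp: c_nonneg c_dec)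
    moreover have "\<bar>\<Sum>d\<in>{1..M}. \<chi> d * (1 / real d)\<bar> \<le> 2 * real m / real (Suc M)"
      using L1_tail[of M] L by simp
    moreover have "(\<Sum>d\<in>{1..M}. \<chi> d * (t ^ d / G d)) = (\<Sum>d\<in>{1..M}. \<chi> d * (1 / real d)) - (\<Sum>d\<in>{1..<Suc M}. \<chi> d * c d)"
      by (simp add: c_def sum_subtractf[symmetric] atLeastLessThanSuc_atLeastAtMost right_diff_distrib)
    ultimately show ?thesis unfolding c1 by linarith
  qed
  \<comment> \<open>Only products \<open>d * e \<le> M\<close> occur, so each geometric series is
    cut off. The remainder has an exponent of at least \<open>M\<close> and is therefore at most
    \<open>t ^ M\<close>.\<close>
  have inner: "(1 - t) * (\<Sum>e\<in>{1..M div d}. t ^ (d * e)) = t ^ d / G d - t ^ (d * Suc (M div d)) / G d" if "d > 0" for d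
  proof -
    have "(1 - t ^ d) * (\<Sum>e\<in>{1..q}. t ^ (d * e)) = t ^ d - t ^ (d * Suc q)" for q
    proof (induction q)
      case (Suc q)
      define S where "S = (\<Sum>e\<in>{1..q}. t ^ (d * e))"
      define X where "X = t ^ (d * Suc q)"
      have "(1 - t ^ d) * (S + X) = (1 - t ^ d) * S + X - t ^ d * X"
        by (simp add: algebra_simps)
      also have "\<dots> = t ^ d - t ^ d * X" using Suc by (simp add: S_def X_def)
      also have "t ^ d * X = t ^ (d * Suc (Suc q))" by (simp add: X_def power_add)
      finally show ?case by (simp add: S_def X_def)
    qed simp
    then have "(1 - t) * G d * (\<Sum>e\<in>{1..M div d}. t ^ (d * e)) = t ^ d - t ^ (d * Suc (M div d))"
      by (simp add: Gp)
    then show ?thesis using G1[OF that] by (simp add: field_simps)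
  qed
  have "(\<Sum>n\<in>{1..M}. conv_one n * t ^ n) = (\<Sum>n\<in>{1..M}. \<Sum>d | d dvd n. \<chi> d * t ^ (d * (n div d)))"
    by (auto simp: conv_one_def sum_distrib_right intro!: sum.cong)
  also have "\<dots> = (\<Sum>d\<in>{1..M}. \<chi> d * (\<Sum>e\<in>{1..M div d}. t ^ (d * e)))"
    by (subst sum_over_divisors_swap) (simp add: sum_distrib_left)
  finally have "(1 - t) * (\<Sum>n\<in>{1..M}. conv_one n * t ^ n) =
      (\<Sum>d\<in>{1..M}. \<chi> d * ((1 - t) * (\<Sum>e\<in>{1..M div d}. t ^ (d * e))))"
    by (simp add: sum_distrib_left mult_ac)
  also have "\<dots> = (\<Sum>d\<in>{1..M}. \<chi> d * (t ^ d / G d)) - (\<Sum>d\<in>{1..M}. \<chi> d * (t ^ (d * Suc (M div d)) / G d))"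
    unfolding sum_subtractf[symmetric] by (intro sum.cong refl) (subst inner, auto simp: right_diff_distrib)
  also have "\<dots> \<le> 2 * real m / real (Suc M) + 2 * real m * (1 - t) + real M * t ^ M"
  proof -
    have "\<bar>\<Sum>d\<in>{1..M}. \<chi> d * (t ^ (d * Suc (M div d)) / G d)\<bar> \<le> (\<Sum>d\<in>{1..M}. t ^ M)"
    proof (rule order_trans[OF sum_abs sum_mono])
      fix d assume d: "d \<in> {1..M}"
      have "M \<le> d * Suc (M div d)" using dividend_less_times_div[of d M] d by simp
      then have "t ^ (d * Suc (M div d)) \<le> t ^ M" using t by (intro power_decreasing) auto
      then have "t ^ (d * Suc (M div d)) / G d \<le> t ^ M / 1" using G1[of d] d t
        by (intro frac_le) auto
      then have "\<bar>\<chi> d\<bar> * \<bar>t ^ (d * Suc (M div d)) / G d\<bar> \<le> 1 * t ^ M"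
        using G1[of d] d t by (intro mult_mono abs_le_1) auto
      then show "\<bar>\<chi> d * (t ^ (d * Suc (M div d)) / G d)\<bar> \<le> t ^ M" by (simp add: abs_mult)
    qed
    then show ?thesis using A by simp
  qed
  finally have upper: "(1 - t) * (\<Sum>n\<in>{1..M}. conv_one n * t ^ n) \<le> \<dots>" .
  have "(\<Sum>s\<in>{1..K}. t ^ s\<^sup>2) = (\<Sum>n\<in>(\<lambda>s. s\<^sup>2) ` {1..K}. t ^ n)"
    by (subst sum.reindex) (auto simp: inj_on_def)
  also have "\<dots> \<le> (\<Sum>n\<in>(\<lambda>s. s\<^sup>2) ` {1..K}. conv_one n * t ^ n)"
    using t conv_one_square by (intro sum_mono) (auto simp: mult_le_cancel_right1)
  also have "\<dots> \<le> (\<Sum>n\<in>{1..M}. conv_one n * t ^ n)"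
  proof (rule sum_mono2)
    show "(\<lambda>s. s\<^sup>2) ` {1..K} \<subseteq> {1..M}"
    proof safe
      fix s assume "s \<in> {1..K}"
      then have "s\<^sup>2 \<le> K\<^sup>2" "s\<^sup>2 > 0" by (auto intro: power_mono)
      then show "s\<^sup>2 \<in> {1..M}" using order_trans[OF _ K] by (simp add: Suc_le_eq)
    qed
  qed (use t conv_one_nonneg in auto)
  finally have "(1 - t) * (\<Sum>s\<in>{1..K}. t ^ s\<^sup>2) \<le> (1 - t) * (\<Sum>n\<in>{1..M}. conv_one n * t ^ n)"
    using t by (intro mult_left_mono) auto
  then show ?thesis using upper by linarith
qed

text \<open>If \<open>L1 = 0\<close>, letting \<open>M\<close> grow and cancelling
  \<open>1 - t\<close> bounds the sum of \<open>t ^ s\<^sup>2\<close> over \<open>s \<le> K\<close>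
  by \<open>2 * m\<close>, uniformly in \<open>t < 1\<close>; letting \<open>t\<close> tend to 1
  gives \<open>K \<le> 2 * m\<close> for every \<open>K\<close>.\<close>

theorem L1_nonzero: "L1 \<noteq> 0"
proof
  assume L: "L1 = 0"
  have bound: "(\<Sum>s\<in>{1..K}. (u\<^sup>2) ^ s\<^sup>2) \<le> 2 * real m" if u: "0 < u" "u < 1" for u :: real and K
  proof -
    define t where "t = u\<^sup>2"
    have t: "0 < t" "t < 1" using u unfolding t_def by (auto simp: power_less_one_iff)
    have "(\<lambda>M. 2 * real m * inverse (real (Suc M)) + 2 * real m * (1 - t) + real M * t ^ M)
        \<longlonglongrightarrow> 2 * real m * 0 + 2 * real m * (1 - t) + 0"
      using t by (intro tendsto_intros LIMSEQ_inverse_real_of_nat powser_times_n_limit_0) auto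
    moreover have "\<forall>M\<ge>K\<^sup>2. (1 - t) * (\<Sum>s\<in>{1..K}. t ^ s\<^sup>2)
        \<le> 2 * real m * inverse (real (Suc M)) + 2 * real m * (1 - t) + real M * t ^ M"
      using conv_one_partial_sum[OF u L] unfolding t_def by (auto simp: divide_inverse)
    ultimately have "(1 - t) * (\<Sum>s\<in>{1..K}. t ^ s\<^sup>2) \<le> 2 * real m * 0 + 2 * real m * (1 - t) + 0"
      by (intro LIMSEQ_le_const) blast+
    then have "(1 - t) * (\<Sum>s\<in>{1..K}. t ^ s\<^sup>2) \<le> (1 - t) * (2 * real m)"
      by (simp add: mult.commute[of "1 - t"])
    then show ?thesis using t by (simp add: t_def[symmetric])
  qed
  have "real K \<le> 2 * real m" for K
  proof -
    define v :: "nat \<Rightarrow> real" where "v = (\<lambda>n. 1 + - inverse (real (Suc n)))"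
    have "(\<lambda>n. \<Sum>s\<in>{1..K}. ((v n)\<^sup>2) ^ s\<^sup>2) \<longlonglongrightarrow> (\<Sum>s\<in>{1..K}. (1\<^sup>2) ^ s\<^sup>2)"
      unfolding v_def by (intro tendsto_intros LIMSEQ_inverse_real_of_nat_add_minus)
    moreover have "\<forall>n\<ge>1. (\<Sum>s\<in>{1..K}. ((v n)\<^sup>2) ^ s\<^sup>2) \<le> 2 * real m"
      by (intro allI impI bound) (auto simp: v_def field_simps)
    ultimately have "(\<Sum>s\<in>{1..K}. (1\<^sup>2) ^ s\<^sup>2) \<le> 2 * real m"
      by (intro LIMSEQ_le_const2) blast+
    then show ?thesis by simp
  qed
  from this[of "2 * m + 1"] show False by simp
qed

text \<open>The divisor-sum identity for \<open>ln k\<close>, times \<open>\<chi> k / k\<close>,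
  expresses the bounded sum of \<open>\<chi> k * ln k / k\<close> through
  \<open>\<chi> d * mangoldt d / d\<close> and partial sums of the series for \<open>L1\<close>.
  Replacing these by \<open>L1\<close> costs at most \<open>2 * m * mangoldt d / n\<close> for each
  \<open>d\<close>, in total \<open>8 * m\<close> by Chebyshev's bound; it remains to divide by
  \<open>L1\<close>.\<close>

lemma sum_mangoldt_over_bounded: "\<exists>C. \<forall>n. \<bar>\<Sum>d\<in>{1..n}. \<chi> d * mangoldt d / real d\<bar> \<le> C"
proof -
  define g where "g = (\<lambda>k. ln (real k) / real k)"
  have g_dec: "g (Suc k) \<le> g k" if "k \<ge> 3" for k
  proof -
    have "exp 1 \<le> real k" using exp_le that by linarith
    then have "1 \<le> ln (real k)" using that by (subst ln_ge_iff) auto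
    moreover have "real k * ln (1 + 1 / real k) \<le> 1"
      using ln_add_one_self_le_self[of "1 / real k"] that by (simp add: field_simps)
    moreover have "ln (1 + 1 / real k) = ln (real k + 1) - ln k"
      using that ln_div[of "real k + 1" "real k"] by (simp add: add_divide_distrib)
    ultimately have "real k * (ln (real k + 1) - ln k) \<le> ln k" by simp
    then show ?thesis using that by (simp add: g_def field_simps)
  qed
  have g_nonneg: "g k \<ge> 0" if "k \<ge> 1" for k using that by (simp add: g_def)
  define D where "D = (\<Sum>k\<in>{1..<3}. g k) + 2 * real m * g 3"
  have D: "\<bar>\<Sum>k\<in>{1..n}. \<chi> k * g k\<bar> \<le> D" for n
  proof -
    have small: "\<bar>\<Sum>k\<in>{1..<j}. \<chi> k * g k\<bar> \<le> (\<Sum>k\<in>{1..<3}. g k)" if "j \<le> 3" for j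
    proof -
      have "\<bar>\<Sum>k\<in>{1..<j}. \<chi> k * g k\<bar> \<le> (\<Sum>k\<in>{1..<j}. g k)"
      proof (rule order_trans[OF sum_abs sum_mono])
        fix k assume "k \<in> {1..<j}"
        then show "\<bar>\<chi> k * g k\<bar> \<le> g k"
          using abs_le_1[of k] g_nonneg[of k] by (simp add: abs_mult mult_left_le_one_le)
      qed
      also have "\<dots> \<le> (\<Sum>k\<in>{1..<3}. g k)"
        using that g_nonneg by (intro sum_mono2) auto
      finally show ?thesis .
    qed
    show ?thesis
    proof (cases "Suc n \<le> 3")
      case True
      then show ?thesis using small[of "Suc n"] g_nonneg[of 3] 
        by (simp add: D_def atLeastLessThanSuc_atLeastAtMost add_increasing2)
    next
      case False
      have "(\<Sum>k\<in>{1..n}. \<chi> k * g k) = (\<Sum>k\<in>{1..<3}. \<chi> k * g k) + (\<Sum>k\<in>{3..<Suc n}. \<chi> k * g k)"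
        using False sum.atLeastLessThan_concat[of 1 3 "Suc n" "\<lambda>k. \<chi> k * g k"]
        by (simp add: atLeastLessThanSuc_atLeastAtMost)
      moreover have "\<bar>\<Sum>k\<in>{3..<Suc n}. \<chi> k * g k\<bar> \<le> 2 * real m * g 3"
        by (intro weighted_sum_bound) (auto simp: g_nonneg g_dec)
      ultimately show ?thesis using small[of 3] unfolding D_def by linarith
    qed
  qed
  define P where "P = (\<lambda>n. \<Sum>e\<in>{1..n}. \<chi> e * (1 / real e))"
  have "\<bar>\<Sum>d\<in>{1..n}. \<chi> d * mangoldt d / real d\<bar> \<le> (D + 8 * real m) / \<bar>L1\<bar>" for n
  proof -
    have "(\<Sum>k\<in>{1..n}. \<chi> k * g k) = (\<Sum>k\<in>{1..n}. \<Sum>d | d dvd k. (\<chi> d * mangoldt d / real d) * (\<chi> (k div d) * (1 / real (k div d))))"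
    proof (rule sum.cong[OF refl])
      fix k assume k: "k \<in> {1..n}"
      have "\<chi> k * g k = (\<Sum>d | d dvd k. \<chi> k * mangoldt d / real k)"
        using k mangoldt_sum[of k, where ?'a = real] 
        by (simp add: g_def sum_divide_distrib[symmetric] sum_distrib_left[symmetric])
      also have "\<dots> = (\<Sum>d | d dvd k. (\<chi> d * mangoldt d / real d) * (\<chi> (k div d) * (1 / real (k div d))))"
      proof (rule sum.cong[OF refl])
        fix d assume "d \<in> {d. d dvd k}"
        then have "k = d * (k div d)" by simp
        then have "\<chi> k = \<chi> d * \<chi> (k div d)" "real k = real d * real (k div d)"
          by (metis mult, metis of_nat_mult)
        then show "\<chi> k * mangoldt d / real k = (\<chi> d * mangoldt d / real d) * (\<chi> (k div d) * (1 / real (k div d)))"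
          by simp
      qed
      finally show "\<chi> k * g k = \<dots>" .
    qed
    also have "\<dots> = (\<Sum>d\<in>{1..n}. (\<chi> d * mangoldt d / real d) * P (n div d))"
      by (subst sum_over_divisors_swap) (simp add: sum_distrib_left P_def)
    also have "\<dots> = L1 * (\<Sum>d\<in>{1..n}. \<chi> d * mangoldt d / real d) - (\<Sum>d\<in>{1..n}. (\<chi> d * mangoldt d / real d) * (L1 - P (n div d)))"
      unfolding sum_distrib_left sum_subtractf[symmetric]
      by (intro sum.cong refl) (simp add: right_diff_distrib diff_divide_distrib mult_ac)
    finally have eq: "L1 * (\<Sum>d\<in>{1..n}. \<chi> d * mangoldt d / real d) =
        (\<Sum>k\<in>{1..n}. \<chi> k * g k) + (\<Sum>d\<in>{1..n}. (\<chi> d * mangoldt d / real d) * (L1 - P (n div d)))"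
      by simp
    have "\<bar>\<Sum>d\<in>{1..n}. (\<chi> d * mangoldt d / real d) * (L1 - P (n div d))\<bar> \<le> (\<Sum>d\<in>{1..n}. mangoldt d * (2 * real m / real n))"
    proof (rule order_trans[OF sum_abs sum_mono])
      fix d assume d: "d \<in> {1..n}"
      have "\<bar>L1 - P (n div d)\<bar> \<le> 2 * real m / real (Suc (n div d))"
        unfolding P_def by (rule L1_tail)
      also have "\<dots> \<le> 2 * real m / (real n / real d)"
      proof (intro divide_left_mono)
        have "n \<le> d * Suc (n div d)" using dividend_less_times_div[of d n] d by simp
        then have "real n \<le> real d * real (Suc (n div d))" by (metis of_nat_le_iff of_nat_mult)
        then show "real n / real d \<le> real (Suc (n div d))" using d by (simp add: field_simps)
      qed (use d in auto)
      finally have "\<bar>\<chi> d\<bar> * (mangoldt d / real d) * \<bar>L1 - P (n div d)\<bar> \<le> 1 * (mangoldt d / real d) * (2 * real m / (real n / real d))"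
        by (intro mult_mono abs_le_1) (auto simp: mangoldt_nonneg)
      then show "\<bar>(\<chi> d * mangoldt d / real d) * (L1 - P (n div d))\<bar> \<le> mangoldt d * (2 * real m / real n)"
        using d by (simp add: abs_mult)
    qed
    also have "\<dots> = (\<Sum>d\<in>{1..n}. mangoldt d) * (2 * real m / real n)"
      by (rule sum_distrib_right[symmetric])
    also have "\<dots> \<le> (4 * real n) * (2 * real m / real n)"
      by (intro mult_right_mono sum_mangoldt_le) auto
    also have "\<dots> \<le> 8 * real m" by simp
    finally have "\<bar>L1 * (\<Sum>d\<in>{1..n}. \<chi> d * mangoldt d / real d)\<bar> \<le> D + 8 * real m"
      using D[of n] unfolding eq by linarith
    then show ?thesis using L1_nonzero by (simp add: abs_mult field_simps)
  qed
  then show ?thesis by blast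
qed

end

section \<open>Primes with prescribed character values\<close>

lemma mangoldt_square: "(mangoldt (r\<^sup>2) :: real) = mangoldt r"
proof (cases "primepow r")
  case True
  then obtain p k where "prime p" "k > 0" "r = p ^ k" by (auto simp: primepow_def)
  then show ?thesis by (simp flip: power_mult)
next
  case False
  then have "\<not> primepow (r\<^sup>2)"
    by (cases "r = 0") (auto simp: primepow_power_iff_nat)
  with False show ?thesis by (simp add: mangoldt_def)
qed

text \<open>Even prime powers carry no sign of a character, so their contribution has to be
  negligible. From \<open>ln r \<le> 2 * sqrt r\<close> each term is at most
  \<open>2 / (r * sqrt r)\<close>, which is compared with differences of
  \<open>2 / sqrt r\<close>.\<close>

lemma sum_mangoldt_squares_bounded: "\<exists>C. \<forall>n. (\<Sum>r\<in>{1..n}. mangoldt (r\<^sup>2) / real (r\<^sup>2)) \<le> C"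
proof -
  have tele: "(\<Sum>r\<in>{1..n}. 1 / (real r * sqrt (real r))) \<le> 3 - 2 / sqrt (real n)" if "n > 0" for n
    using that
  proof (induction n rule: nat_induct_non_zero)
    case (Suc n)
    define a b where "a = sqrt (real n)" and "b = sqrt (real (Suc n))"
    have ab: "0 < a" "a \<le> b" "b * b = real (Suc n)" "b * b = a * a + 1"
      using Suc.hyps by (auto simp: a_def b_def)
    have "1 / (b * b * b) \<le> 2 / a - 2 / b"
    proof -
      have "(b - a) * (b + a) = 1" using ab by (simp add: algebra_simps)
      then have "b - a = 1 / (b + a)" using ab by (simp add: field_simps)
      also have "\<dots> \<ge> 1 / (2 * b)" using ab by (intro divide_left_mono) auto
      finally have "1 / (2 * b) \<le> b - a" .
      then have "1 \<le> 2 * b * (b - a)" using ab by (simp add: field_simps)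
      then have "a * 1 \<le> b * (2 * b * (b - a))" using ab by (intro mult_mono) auto
      then have "a \<le> 2 * (b - a) * (b * b)" by (simp add: mult_ac)
      then have "a / (a * (b * b * b)) \<le> 2 * (b - a) * (b * b) / (a * (b * b * b))"
        by (rule divide_right_mono) (use ab(1,2) in simp)
      moreover have "a / (a * (b * b * b)) = 1 / (b * b * b)" using ab by simp
      moreover have "2 * (b - a) * (b * b) / (a * (b * b * b)) = 2 / a - 2 / b"
        using ab(1,2) by (simp add: field_simps)
      ultimately show ?thesis by simp
    qed
    then have "1 / (real (Suc n) * sqrt (real (Suc n))) \<le> 2 / sqrt (real n) - 2 / sqrt (real (Suc n))"
      using ab(3) by (simp only: a_def b_def)
    with Suc.IH show ?case by (simp del: of_nat_Suc)
  qed simp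
  have "(\<Sum>r\<in>{1..n}. mangoldt (r\<^sup>2) / real (r\<^sup>2)) \<le> 6" for n
  proof (cases "n = 0")
    case False
    have "(\<Sum>r\<in>{1..n}. mangoldt (r\<^sup>2) / real (r\<^sup>2)) \<le> (\<Sum>r\<in>{1..n}. 2 * (1 / (real r * sqrt (real r))))"
    proof (rule sum_mono)
      fix r assume r: "r \<in> {1..n}"
      define s where "s = sqrt (real r)"
      have s: "s > 0" "real r = s * s" using r by (auto simp: s_def)
      have "mangoldt (r\<^sup>2) \<le> ln (real r)" 
        unfolding mangoldt_square using r by (intro mangoldt_le) auto
      also have "\<dots> = 2 * ln s" using s by (simp add: ln_mult)
      also have "\<dots> \<le> 2 * s" using ln_le_minus_one[of s] s by linarith
      finally have "mangoldt (r\<^sup>2) / real (r\<^sup>2) \<le> 2 * s / real (r\<^sup>2)" by (intro divide_right_mono) auto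
      also have "\<dots> = 2 * (1 / (real r * s))" using s by (simp add: power2_eq_square field_simps)
      finally show "mangoldt (r\<^sup>2) / real (r\<^sup>2) \<le> 2 * (1 / (real r * sqrt (real r)))" by (simp add: s_def)
    qed
    also have "\<dots> \<le> 2 * (3 - 2 / sqrt (real n))"
      using tele[of n] False by (simp only: sum_distrib_left[symmetric]) simp
    also have "\<dots> \<le> 6" by simp
    finally show ?thesis .
  qed simp
  then show ?thesis by blast
qed

lemma sum_mangoldt_prime_powers_le:
  assumes "prime q"
  shows "(\<Sum>n\<in>{n\<in>{1..N}. \<exists>k>0. n = q ^ k}. mangoldt n / real n) \<le> 2 * ln (real q)"
proof -
  have q: "q \<ge> 2" using assms prime_ge_2_nat by blast
  have "{n\<in>{1..N}. \<exists>k>0. n = q ^ k} \<subseteq> (\<lambda>k. q ^ Suc k) ` {..<N}"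
  proof safe
    fix k assume "k > 0" "q ^ k \<in> {1..N}"
    moreover have "k < q ^ k" using q by (intro power_gt_expt) auto
    ultimately show "q ^ k \<in> (\<lambda>k. q ^ Suc k) ` {..<N}"
      by (intro image_eqI[of _ _ "k - 1"]) auto
  qed
  then have "(\<Sum>n\<in>{n\<in>{1..N}. \<exists>k>0. n = q ^ k}. mangoldt n / real n) \<le> (\<Sum>n\<in>(\<lambda>k. q ^ Suc k) ` {..<N}. mangoldt n / real n)"
    by (intro sum_mono2) (auto simp: mangoldt_nonneg)
  also have "\<dots> = (\<Sum>k<N. mangoldt (q ^ Suc k) / real (q ^ Suc k))"
    using q by (subst sum.reindex) (auto simp: inj_on_def simp del: power_Suc)
  also have "\<dots> \<le> (\<Sum>k<N. ln (real q) * (1 / 2) ^ k)"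
  proof (rule sum_mono)
    fix k
    have "(2::real) ^ k \<le> real q ^ Suc k"
      using q by (intro order_trans[OF power_mono power_increasing]) auto
    then have "ln (real q) / real q ^ Suc k \<le> ln (real q) / 2 ^ k"
      using q by (intro divide_left_mono) auto
    then show "mangoldt (q ^ Suc k) / real (q ^ Suc k) \<le> ln (real q) * (1 / 2) ^ k"
      using assms by (simp only: mangoldt_primepow' zero_less_Suc of_real_eq_id id_apply of_nat_power) (simp add: power_divide)
  qed
  also have "\<dots> = ln (real q) * (2 * (1 - (1/2) ^ N))"
    by (simp add: sum_distrib_left[symmetric] sum_gp_strict)
  also have "\<dots> \<le> ln (real q) * 2"
    using q by (intro mult_left_mono) auto
  finally show ?thesis by simp
qed

lemma sum_UN_le:
  fixes g :: "'a \<Rightarrow> real"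
  assumes "finite I" "\<And>i. i \<in> I \<Longrightarrow> finite (A i)" "\<And>x. g x \<ge> 0"
  shows "sum g (\<Union>i\<in>I. A i) \<le> (\<Sum>i\<in>I. sum g (A i))"
  using assms(1,2)
proof (induction I rule: finite_induct)
  case (insert i I)
  have "sum g (A i \<union> (\<Union>j\<in>I. A j)) \<le> sum g (A i) + sum g (\<Union>j\<in>I. A j)"
    using insert sum_nonneg[of "A i \<inter> (\<Union>j\<in>I. A j)" g] assms(3) by (subst sum_Un) auto
  with insert show ?case by simp
qed simp

text \<open>The weight \<open>F\<close> vanishes as soon as some \<open>f i n\<close> is
  \<open>- \<epsilon> i\<close>. Expanded over subsets of \<open>I\<close>, the empty set
  contributes at least \<open>ln N - 1\<close>, and every other subset gives a nonprincipal
  character with bounded sum; so the sum of \<open>F n * mangoldt n / n\<close> diverges. Were there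
  no such prime, only squares and powers of primes dividing \<open>m\<close> could contribute, and
  these give a bounded sum.\<close>

theorem prime_with_prescribed_characters:
  fixes f :: "'i \<Rightarrow> nat \<Rightarrow> real" and \<epsilon> :: "'i \<Rightarrow> real"
  assumes fin: "finite I"
    and char: "\<And>S. S \<subseteq> I \<Longrightarrow> S \<noteq> {} \<Longrightarrow> real_character (\<lambda>n. \<Prod>i\<in>S. f i n) m"
    and sign: "\<And>i. i \<in> I \<Longrightarrow> \<epsilon> i \<in> {-1, 1}"
    and nonzero: "\<And>i p. i \<in> I \<Longrightarrow> prime p \<Longrightarrow> \<not> p dvd m \<Longrightarrow> f i p \<noteq> 0"
  shows "\<exists>p. prime p \<and> (\<forall>i\<in>I. f i p = \<epsilon> i)"
proof (rule ccontr)
  assume no: "\<not> ?thesis"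
  have single: "real_character (f i) m" if "i \<in> I" for i
    using char[of "{i}"] that by simp
  define F where "F = (\<lambda>n. \<Prod>i\<in>I. 1 + \<epsilon> i * f i n)"
  have F_range: "0 \<le> F n" "F n \<le> 2 ^ card I" for n
  proof -
    have *: "0 \<le> 1 + \<epsilon> i * f i n \<and> 1 + \<epsilon> i * f i n \<le> 2" if "i \<in> I" for i
      using sign[OF that] real_character.range[OF single[OF that], of n] by auto
    show "0 \<le> F n" unfolding F_def using * by (intro prod_nonneg) auto
    have "F n \<le> (\<Prod>i\<in>I. 2)" unfolding F_def using * by (intro prod_mono) auto
    then show "F n \<le> 2 ^ card I" by simp
  qed
  have F_expand: "F n = (\<Sum>S\<in>Pow I. (\<Prod>i\<in>S. \<epsilon> i) * (\<Prod>i\<in>S. f i n))" for n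
    unfolding F_def using fin prod_add[OF fin, of "\<lambda>i. \<epsilon> i * f i n" "\<lambda>_. 1"]
    by (simp add: add.commute prod.distrib)
  have m0: "m > 0" if "I \<noteq> {}"
    using char[of I] that real_character.modulus_pos by blast
  show False
  proof (cases "I = {}")
    case True
    then show False using no two_is_prime_nat by auto
  next
    case False
    define W where "W = (\<lambda>S N. \<Sum>n\<in>{1..N}. (\<Prod>i\<in>S. f i n) * mangoldt n / real n)"
    have "\<forall>S\<in>Pow I - {{}}. \<exists>C. \<forall>N. \<bar>W S N\<bar> \<le> C"
      using real_character.sum_mangoldt_over_bounded[OF char] unfolding W_def by blast
    then obtain C where C: "\<And>S N. S \<in> Pow I - {{}} \<Longrightarrow> \<bar>W S N\<bar> \<le> C S" by metis
    define Q where "Q = prime_factors m"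
    obtain D where D: "\<And>N. (\<Sum>r\<in>{1..N}. mangoldt (r\<^sup>2) / real (r\<^sup>2)) \<le> D"
      using sum_mangoldt_squares_bounded by blast
    define E where "E = 2 ^ card I * (D + (\<Sum>q\<in>Q. 2 * ln (real q)))"
    have lower: "ln (real N) - 1 - (\<Sum>S\<in>Pow I - {{}}. C S) \<le> (\<Sum>n\<in>{1..N}. F n * (mangoldt n / real n))" if "N > 0" for N
    proof -
      have "(\<Sum>n\<in>{1..N}. F n * (mangoldt n / real n)) = (\<Sum>S\<in>Pow I. (\<Prod>i\<in>S. \<epsilon> i) * W S N)"
        unfolding F_expand W_def sum_distrib_left sum_distrib_right
        by (subst sum.swap) (simp add: mult_ac)
      also have "\<dots> = W {} N + (\<Sum>S\<in>Pow I - {{}}. (\<Prod>i\<in>S. \<epsilon> i) * W S N)"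
        using fin by (subst sum.remove[of _ "{}"]) auto
      finally have eq: "(\<Sum>n\<in>{1..N}. F n * (mangoldt n / real n)) = \<dots>" .
      have "\<bar>\<Sum>S\<in>Pow I - {{}}. (\<Prod>i\<in>S. \<epsilon> i) * W S N\<bar> \<le> (\<Sum>S\<in>Pow I - {{}}. C S)"
      proof (rule order_trans[OF sum_abs sum_mono])
        fix S assume S: "S \<in> Pow I - {{}}"
        have "\<bar>\<Prod>i\<in>S. \<epsilon> i\<bar> = 1"
          unfolding abs_prod using S sign by (intro prod.neutral) fastforce
        then show "\<bar>(\<Prod>i\<in>S. \<epsilon> i) * W S N\<bar> \<le> C S" using C[OF S] by (simp add: abs_mult)
      qed
      moreover have "ln (real N) - 1 \<le> W {} N"
        using sum_mangoldt_over_lower[OF that] by (simp add: W_def)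
      ultimately show ?thesis unfolding eq by linarith
    qed
    have upper: "(\<Sum>n\<in>{1..N}. F n * (mangoldt n / real n)) \<le> E" for N
    proof -
      define A where "A = (\<lambda>r. r\<^sup>2) ` {1..N}"
      define B where "B = (\<lambda>q. {n\<in>{1..N}. \<exists>k>0. n = q ^ k})"
      have support: "n \<in> A \<union> (\<Union>q\<in>Q. B q)" if n: "n \<in> {1..N}" "F n * (mangoldt n / real n) \<noteq> 0" for n
      proof -
        have "primepow n" "F n \<noteq> 0" using n(2) by (auto simp: mangoldt_def split: if_splits)
        then obtain p k where pk: "prime p" "k > 0" "n = p ^ k" by (auto simp: primepow_def)
        show ?thesis
        proof (cases "p dvd m")
          case True
          then have "p \<in> Q" using pk m0 False by (auto simp: Q_def prime_factors_dvd)
          then show ?thesis using pk n(1) by (auto simp: B_def)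
        next
          case pm: False
          \<comment> \<open>An odd power of \<open>p\<close> has the same values \<open>f i\<close>
            as \<open>p\<close>; nonzero factors of \<open>F n\<close> then force
            \<open>f i p = \<epsilon> i\<close> for all \<open>i\<close>.\<close>
          have "even k"
          proof (rule ccontr)
            assume "odd k"
            have "f i p = \<epsilon> i" if i: "i \<in> I" for i
            proof -
              interpret real_character "f i" m by (rule single[OF i])
              have "f i p \<in> {-1, 1}" using nonzero[OF i pk(1) pm] range[of p] by auto
              then have "f i n = f i p" using \<open>odd k\<close> by (auto simp: pk(3) power)
              moreover have "1 + \<epsilon> i * f i n \<noteq> 0" using \<open>F n \<noteq> 0\<close> i fin by (auto simp: F_def)
              ultimately show ?thesis using \<open>f i p \<in> {-1, 1}\<close> sign[OF i] by auto
            qed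
            then show False using no pk(1) by blast
          qed
          then obtain j where "k = 2 * j" by (rule evenE)
          then have nj: "n = (p ^ j)\<^sup>2" by (simp add: pk(3) power_mult mult.commute flip: power_mult)
          have "p ^ j \<le> n" "p ^ j \<ge> 1" unfolding nj using pk(1) by (auto simp: power2_eq_square prime_gt_0_nat Suc_le_eq)
          then show ?thesis using n(1) nj by (auto simp: A_def)
        qed
      qed
      have AB: "finite A" "finite (\<Union>q\<in>Q. B q)" by (auto simp: A_def B_def Q_def)
      have "(\<Sum>n\<in>{1..N}. F n * (mangoldt n / real n)) \<le> (\<Sum>n\<in>A \<union> (\<Union>q\<in>Q. B q). F n * (mangoldt n / real n))"
      proof -
        have "(\<Sum>n\<in>{1..N}. F n * (mangoldt n / real n)) = (\<Sum>n\<in>{1..N} \<inter> (A \<union> (\<Union>q\<in>Q. B q)). F n * (mangoldt n / real n))"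
        proof (rule sum.mono_neutral_right)
          show "\<forall>n\<in>{1..N} - {1..N} \<inter> (A \<union> (\<Union>q\<in>Q. B q)). F n * (mangoldt n / real n) = 0"
            using support by blast
        qed auto
        also have "\<dots> \<le> (\<Sum>n\<in>A \<union> (\<Union>q\<in>Q. B q). F n * (mangoldt n / real n))"
          using AB F_range(1) by (intro sum_mono2) (auto simp: mangoldt_nonneg)
        finally show ?thesis .
      qed
      also have "\<dots> \<le> (\<Sum>n\<in>A \<union> (\<Union>q\<in>Q. B q). 2 ^ card I * (mangoldt n / real n))"
        using F_range(2) by (intro sum_mono mult_right_mono) (auto simp: mangoldt_nonneg)
      also have "\<dots> = 2 ^ card I * (\<Sum>n\<in>A \<union> (\<Union>q\<in>Q. B q). mangoldt n / real n)"
        by (simp add: sum_distrib_left)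
      also have "\<dots> \<le> 2 ^ card I * ((\<Sum>n\<in>A. mangoldt n / real n) + (\<Sum>n\<in>(\<Union>q\<in>Q. B q). mangoldt n / real n))"
      proof (rule mult_left_mono)
        have "0 \<le> (\<Sum>n\<in>A \<inter> (\<Union>q\<in>Q. B q). mangoldt n / real n)"
          by (intro sum_nonneg divide_nonneg_nonneg mangoldt_nonneg) auto
        then show "(\<Sum>n\<in>A \<union> (\<Union>q\<in>Q. B q). mangoldt n / real n) \<le>
            (\<Sum>n\<in>A. mangoldt n / real n) + (\<Sum>n\<in>(\<Union>q\<in>Q. B q). mangoldt n / real n)"
          by (subst sum_Un[OF AB]) simp
      qed simp
      also have "\<dots> \<le> E"
      proof -
        have "(\<Sum>n\<in>A. mangoldt n / real n) = (\<Sum>r\<in>{1..N}. mangoldt (r\<^sup>2) / real (r\<^sup>2))"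
          unfolding A_def by (subst sum.reindex) (auto simp: inj_on_def)
        moreover have "(\<Sum>n\<in>(\<Union>q\<in>Q. B q). mangoldt n / real n) \<le> (\<Sum>q\<in>Q. \<Sum>n\<in>B q. mangoldt n / real n)"
          by (rule sum_UN_le) (auto simp: mangoldt_nonneg B_def Q_def)
        moreover have "\<dots> \<le> (\<Sum>q\<in>Q. 2 * ln (real q))"
          unfolding B_def by (intro sum_mono sum_mangoldt_prime_powers_le) (auto simp: Q_def)
        ultimately show ?thesis unfolding E_def using D[of N] by (intro mult_left_mono) auto
      qed
      finally show ?thesis .
    qed
    define T where "T = E + 2 + (\<Sum>S\<in>Pow I - {{}}. C S)"
    obtain N :: nat where N: "exp T < real N" using reals_Archimedean2 by blast
    have "N > 0" using N exp_gt_zero[of T] by (metis of_nat_0 gr0I not_less_iff_gr_or_eq order_less_trans)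
    have "T < ln (real N)" using N \<open>N > 0\<close> by (subst exp_less_cancel_iff[symmetric]) simp
    then show False using lower[OF \<open>N > 0\<close>] upper[of N] by (simp add: T_def)
  qed
qed

section \<open>Legendre's equation and descent\<close>

lemma ceiling_sqrt_exists:
  fixes n :: int
  assumes "n > 0"
  obtains k where "k > 0" "n \<le> k\<^sup>2" "(k - 1)\<^sup>2 < n"
proof -
  define P where "P = (\<lambda>k::nat. n \<le> (int k)\<^sup>2)"
  have "P (nat n)" using assms by (simp add: P_def power2_eq_square mult_le_cancel_left1)
  then have L: "P (LEAST k. P k)" by (rule LeastI)
  have least: "\<not> P j" if "j < (LEAST k. P k)" for j using that by (rule not_less_Least)
  define l where "l = (LEAST k. P k)"
  have "l > 0" using L assms by (cases l) (auto simp: l_def P_def)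
  moreover have "\<not> P (l - 1)" using least[of "l - 1"] \<open>l > 0\<close> by (simp add: l_def)
  ultimately show thesis using that[of "int l"] L by (simp add: P_def l_def of_nat_diff)
qed

lemma square_less_of_abs_less:
  fixes x k n :: int
  assumes "\<bar>x\<bar> < k" "(k - 1)\<^sup>2 < n"
  shows "x\<^sup>2 < n"
proof -
  have "\<bar>x\<bar>\<^sup>2 \<le> (k - 1)\<^sup>2" using assms(1) by (intro power_mono) auto
  then show ?thesis using assms(2) by simp
qed

text \<open>The box has more than \<^term>\<open>a * b * c\<close> points, so two of them agree modulo the lattice on
  which the form vanishes modulo \<^term>\<open>a * b * c\<close>; their difference has value \<open>0\<close> or
  \<^term>\<open>a * b * c\<close>, and the latter case is turned into the former by multiplicativity of
  the norm \<open>z\<^sup>2 + ab\<close>.\<close>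

theorem legendre_equation_solvable:
  fixes a b c r1 r2 r3 :: int
  assumes pos: "a > 0" "b > 0" "c > 0"
    and cop: "coprime a b" "coprime a c" "coprime b c"
    and r: "a dvd b * r1\<^sup>2 - c" "b dvd a * r2\<^sup>2 - c" "c dvd a * r3\<^sup>2 + b"
    and nonsquare: "\<And>k. a * c \<noteq> k\<^sup>2"
  shows "\<exists>x y z. z \<noteq> 0 \<and> a * x\<^sup>2 + b * y\<^sup>2 = c * z\<^sup>2"
proof -
  obtain X where X: "X > 0" "b * c \<le> X\<^sup>2" "(X - 1)\<^sup>2 < b * c"
    using ceiling_sqrt_exists[of "b * c"] pos by auto
  obtain Y where Y: "Y > 0" "a * c \<le> Y\<^sup>2" "(Y - 1)\<^sup>2 < a * c"
    using ceiling_sqrt_exists[of "a * c"] pos by auto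
  obtain Z where Z: "Z > 0" "a * b \<le> Z\<^sup>2" "(Z - 1)\<^sup>2 < a * b"
    using ceiling_sqrt_exists[of "a * b"] pos by auto
  define D where "D = {0..<X} \<times> {0..<Y} \<times> {0..<Z}"
  define R where "R = {0..<a} \<times> {0..<b} \<times> {0..<c}"
  define \<phi> where "\<phi> = (\<lambda>(x, y, z). ((y - r1 * z) mod a, (x - r2 * z) mod b, (x - r3 * y) mod c))"
  have "a * b * c < X * Y * Z"
  proof -
    \<comment> \<open>Each side of the box is at least the root of a pairwise product;
      \<open>nonsquare\<close> makes one inequality strict, so the box has more points than there
      are residue triples.\<close>
    have "a * c < Y\<^sup>2" using Y(2) nonsquare[of Y] by simp
    then have "(b * c) * (a * c) < X\<^sup>2 * Y\<^sup>2"
      using X(2) pos by (intro mult_le_less_imp_less) auto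
    then have "((b * c) * (a * c)) * (a * b) < (X\<^sup>2 * Y\<^sup>2) * (a * b)"
      using pos by (intro mult_strict_right_mono) auto
    also have "\<dots> \<le> (X\<^sup>2 * Y\<^sup>2) * Z\<^sup>2"
      using Z(2) by (intro mult_left_mono) auto
    finally have "((b * c) * (a * c)) * (a * b) < (X\<^sup>2 * Y\<^sup>2) * Z\<^sup>2" .
    then have "(a * b * c)\<^sup>2 < (X * Y * Z)\<^sup>2"
      by (simp add: power2_eq_square mult_ac)
    then show ?thesis using X Y Z by (intro power_less_imp_less_base[of _ 2 "X * Y * Z"]) auto
  qed
  then have "card R < card D"
    using pos X(1) Y(1) Z(1) by (simp add: R_def D_def card_cartesian_product nat_mult_distrib[symmetric] mult.assoc)
  moreover have "\<phi> ` D \<subseteq> R" using pos by (auto simp: \<phi>_def R_def)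
  moreover have "finite R" by (simp add: R_def)
  ultimately have "\<not> inj_on \<phi> D"
    using card_inj_on_le[of \<phi> D R] by auto
  then obtain x1 y1 z1 x2 y2 z2 where
    D: "(x1, y1, z1) \<in> D" "(x2, y2, z2) \<in> D" "(x1, y1, z1) \<noteq> (x2, y2, z2)"
      "\<phi> (x1, y1, z1) = \<phi> (x2, y2, z2)"
    unfolding inj_on_def by fast
  define x y z where "x = x1 - x2" and "y = y1 - y2" and "z = z1 - z2"
  have nz: "x \<noteq> 0 \<or> y \<noteq> 0 \<or> z \<noteq> 0" using D(3) by (auto simp: x_def y_def z_def)
  have small: "x\<^sup>2 < b * c" "y\<^sup>2 < a * c" "z\<^sup>2 < a * b"
    by (rule square_less_of_abs_less[OF _ X(3)] square_less_of_abs_less[OF _ Y(3)] square_less_of_abs_less[OF _ Z(3)],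
        use D(1,2) in \<open>auto simp: D_def x_def y_def z_def\<close>)+
  have "a dvd (y1 - r1 * z1) - (y2 - r1 * z2)" "b dvd (x1 - r2 * z1) - (x2 - r2 * z2)"
    "c dvd (x1 - r3 * y1) - (x2 - r3 * y2)"
    using D(4) by (auto simp: \<phi>_def mod_eq_dvd_iff)
  moreover have "(y1 - r1 * z1) - (y2 - r1 * z2) = y - r1 * z" "(x1 - r2 * z1) - (x2 - r2 * z2) = x - r2 * z"
    "(x1 - r3 * y1) - (x2 - r3 * y2) = x - r3 * y"
    by (simp_all add: x_def y_def z_def algebra_simps)
  ultimately have cong: "a dvd y - r1 * z" "b dvd x - r2 * z" "c dvd x - r3 * y" by simp_all
  define v where "v = a * x\<^sup>2 + b * y\<^sup>2 - c * z\<^sup>2"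
  have "v = a * x\<^sup>2 + (y - r1 * z) * (b * (y + r1 * z)) + (b * r1\<^sup>2 - c) * z\<^sup>2"
    "v = b * y\<^sup>2 + (x - r2 * z) * (a * (x + r2 * z)) + (a * r2\<^sup>2 - c) * z\<^sup>2"
    "v = (x - r3 * y) * (a * (x + r3 * y)) + (a * r3\<^sup>2 + b) * y\<^sup>2 - c * z\<^sup>2"
    by (simp_all add: v_def power2_eq_square algebra_simps)
  then have "a dvd v" "b dvd v" "c dvd v"
    using cong r by (metis dvd_add dvd_triv_left dvd_mult2, metis dvd_add dvd_triv_left dvd_mult2, metis dvd_add dvd_diff dvd_triv_left dvd_mult2)
  then have "a * b * c dvd v"
    using cop by (intro divides_mult) auto
  then obtain k where k: "v = a * b * c * k" by (rule dvdE)
  have "a * x\<^sup>2 < a * (b * c)" "b * y\<^sup>2 < b * (a * c)" "c * z\<^sup>2 < c * (a * b)"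
    using small pos by simp_all
  moreover have "a * x\<^sup>2 \<ge> 0" "b * y\<^sup>2 \<ge> 0" "c * z\<^sup>2 \<ge> 0" using pos by simp_all
  ultimately have "a * b * c * (-1) < v" "v < a * b * c * 2" by (simp_all add: v_def mult_ac)
  then have "-1 < k" "k < 2" using pos unfolding k by (simp_all only: mult_less_cancel_left_pos mult_pos_pos)
  then consider "k = 0" | "k = 1" by linarith
  then show ?thesis
  proof cases
    case 1
    then have eq: "a * x\<^sup>2 + b * y\<^sup>2 = c * z\<^sup>2" using k by (simp add: v_def)
    have "z \<noteq> 0"
    proof
      assume "z = 0"
      then have "a * x\<^sup>2 = 0" "b * y\<^sup>2 = 0"
        using eq \<open>a * x\<^sup>2 \<ge> 0\<close> \<open>b * y\<^sup>2 \<ge> 0\<close> by (simp_all add: add_nonneg_eq_0_iff)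
      then show False using nz pos \<open>z = 0\<close> by simp
    qed
    with eq show ?thesis by blast
  next
    case 2
    then have "a * x\<^sup>2 + b * y\<^sup>2 = c * (z\<^sup>2 + a * b)" using k by (simp add: v_def algebra_simps)
    moreover have "a * (x * z + b * y)\<^sup>2 + b * (y * z - a * x)\<^sup>2 = (a * x\<^sup>2 + b * y\<^sup>2) * (z\<^sup>2 + a * b)"
      by (simp add: power2_eq_square algebra_simps)
    ultimately have "a * (x * z + b * y)\<^sup>2 + b * (y * z - a * x)\<^sup>2 = c * (z\<^sup>2 + a * b)\<^sup>2"
      by (simp add: power2_eq_square)
    moreover have "z\<^sup>2 + a * b \<noteq> 0" using pos by (smt (verit) mult_pos_pos zero_le_power2)
    ultimately show ?thesis by blast
  qed
qed

section \<open>Descent from rational to integral representations\<close>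

definition hexform :: "int \<Rightarrow> int \<Rightarrow> int \<Rightarrow> int" where
  "hexform x y z = x\<^sup>2 + y\<^sup>2 + y * z + z\<^sup>2"

lemma nearest_multiple:
  fixes x t :: int
  assumes "t > 0"
  obtains k where "\<bar>2 * (x - k * t)\<bar> \<le> t"
proof -
  define k where "k = (2 * x + t) div (2 * t)"
  have "2 * x + t = k * (2 * t) + (2 * x + t) mod (2 * t)"
    unfolding k_def by (rule div_mult_mod_eq[symmetric])
  moreover have "0 \<le> (2 * x + t) mod (2 * t)" "(2 * x + t) mod (2 * t) < 2 * t" using assms by auto
  ultimately have "\<bar>2 * (x - k * t)\<bar> \<le> t" by (simp add: algebra_simps abs_if)
  then show thesis by (rule that)
qed

text \<open>Some lattice point is within norm distance 11/16. This is why the descent uses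
  \<open>hexform\<close> and not \<open>x\<^sup>2 + y\<^sup>2 + 3 * z\<^sup>2\<close>, for which the
  point (1/2, 1/2, 1/2) has distance 5/4. Completing the square in \<open>y\<close> explains why
  \<open>z'\<close> is fixed before \<open>y'\<close>.\<close>

lemma hexform_reduce:
  fixes x y z t :: int
  assumes "t > 0"
  obtains x' y' z' where "hexform (x - x' * t) (y - y' * t) (z - z' * t) < t\<^sup>2"
proof -
  obtain x' where x': "\<bar>2 * (x - x' * t)\<bar> \<le> t" using nearest_multiple[OF assms] by blast
  obtain z' where z': "\<bar>2 * (z - z' * t)\<bar> \<le> t" using nearest_multiple[OF assms] by blast
  define w where "w = z - z' * t"
  obtain y' where y': "\<bar>2 * ((2 * y + w) - y' * (2 * t))\<bar> \<le> 2 * t" using nearest_multiple[of "2 * t" "2 * y + w"] assms by auto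
  define u v where "u = x - x' * t" and "v = y - y' * t"
  have "(2 * u)\<^sup>2 \<le> t\<^sup>2" "(2 * w)\<^sup>2 \<le> t\<^sup>2" "(2 * v + w)\<^sup>2 \<le> t\<^sup>2"
    using x' y' z' assms by (auto simp: u_def v_def w_def abs_le_square_iff[symmetric] algebra_simps)
  moreover have "16 * hexform u v w = 4 * (2 * u)\<^sup>2 + 4 * (2 * v + w)\<^sup>2 + 3 * (2 * w)\<^sup>2"
    by (simp add: hexform_def power2_eq_square algebra_simps)
  moreover have "t\<^sup>2 > 0" using assms by simp
  ultimately have "hexform u v w < t\<^sup>2" by linarith
  then show thesis using that[of x' y' z'] by (simp add: u_def v_def w_def)
qed

lemma hexform_nonneg: "hexform x y z \<ge> 0"
  and hexform_zeroD: "hexform x y z = 0 \<Longrightarrow> x = 0 \<and> y = 0 \<and> z = 0"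
proof -
  have eq: "4 * hexform x y z = (2 * x)\<^sup>2 + (2 * y + z)\<^sup>2 + 3 * z\<^sup>2"
    by (simp add: hexform_def power2_eq_square algebra_simps)
  then show "hexform x y z \<ge> 0" by (smt (verit) zero_le_power2)
  show "x = 0 \<and> y = 0 \<and> z = 0" if "hexform x y z = 0"
  proof -
    have "(2 * x)\<^sup>2 = 0" "(2 * y + z)\<^sup>2 = 0" "z\<^sup>2 = 0"
      using eq that by (smt (verit) zero_le_power2)+
    then show ?thesis by simp
  qed
qed

lemma hexform_combination:
  "hexform (a * x + b * x') (a * y + b * y') (a * z + b * z') =
     a\<^sup>2 * hexform x y z + a * b * (2 * x * x' + 2 * y * y' + y * z' + z * y' + 2 * z * z') + b\<^sup>2 * hexform x' y' z'"
  by (simp add: hexform_def power2_eq_square algebra_simps)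

text \<open>Davenport--Cassels descent: with respect to this form every rational point has norm distance less than 1 from the lattice.\<close>

theorem hexform_rational_imp_integral:
  fixes n t :: int
  assumes "t \<noteq> 0" "n * t\<^sup>2 = hexform x y z"
  shows "\<exists>x y z. n = hexform x y z"
  using assms
proof (induction "nat \<bar>t\<bar>" arbitrary: t x y z rule: less_induct)
  case less
  have reduce: ?case if t: "t > 0" "n * t\<^sup>2 = hexform x y z" "nat t = nat \<bar>t0\<bar>" and
    IH: "\<And>s x y z. nat \<bar>s\<bar> < nat \<bar>t0\<bar> \<Longrightarrow> s \<noteq> 0 \<Longrightarrow> n * s\<^sup>2 = hexform x y z \<Longrightarrow> \<exists>x y z. n = hexform x y z"
    for t t0 x y z
  proof -
    obtain x' y' z' where lt: "hexform (x - x' * t) (y - y' * t) (z - z' * t) < t\<^sup>2"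
      using hexform_reduce[OF t(1)] by blast
    define h where "h = hexform (x - x' * t) (y - y' * t) (z - z' * t)"
    define B where "B = 2 * x * x' + 2 * y * y' + y * z' + z * y' + 2 * z * z'"
    \<comment> \<open>The line through \<open>(x, y, z) / t\<close> and the lattice point
      \<open>(x', y', z')\<close> meets the quadric \<open>hexform = n\<close> in a second point,
      with numerators \<open>a * x + b * x'\<close> and so on over the denominator \<open>s\<close>.
      As \<open>t * s = h < t\<^sup>2\<close>, the denominator drops.\<close>
    define b where "b = 2 * n * t - B"
    define a where "a = hexform x' y' z' - n"
    define s where "s = a * t + b"
    have ab: "B = 2 * n * t - b" "hexform x' y' z' = a + n" by (simp_all add: a_def b_def)
    have "h = n * t\<^sup>2 - t * B + t\<^sup>2 * hexform x' y' z'"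
      using hexform_combination[of 1 x "-t" x' y y' z z'] t(2)
      by (simp add: h_def B_def mult.commute[of t])
    then have s: "t * s = h"
      unfolding ab s_def by (simp add: power2_eq_square algebra_simps)
    have eq: "n * s\<^sup>2 = hexform (a * x + b * x') (a * y + b * y') (a * z + b * z')"
      unfolding hexform_combination B_def[symmetric] t(2)[symmetric] ab s_def
      by (simp add: power2_eq_square algebra_simps)
    show ?thesis
    proof (cases "h = 0")
      case True
      then have "x = x' * t" "y = y' * t" "z = z' * t"
        using hexform_zeroD[of "x - x' * t" "y - y' * t" "z - z' * t"] by (simp_all add: h_def)
      then have "n * t\<^sup>2 = hexform x' y' z' * t\<^sup>2"
        using t(2) by (simp add: hexform_def power2_eq_square algebra_simps)
      then show ?thesis using t(1) by auto
    next
      case False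
      then have "h > 0" using hexform_nonneg unfolding h_def by (metis order_le_less)
      then have "s > 0" using s t(1) by (metis zero_less_mult_pos)
      moreover have "t * s < t * t" using s lt by (simp add: h_def power2_eq_square)
      then have "s < t" using t(1) by simp
      ultimately have "nat \<bar>s\<bar> < nat \<bar>t0\<bar>" "s \<noteq> 0" using t(1,3) by auto
      then show ?thesis using IH[OF _ _ eq] by blast
    qed
  qed
  have "n * \<bar>t\<bar>\<^sup>2 = hexform x y z" using less.prems by simp
  then show ?case using reduce[of "\<bar>t\<bar>" x y z t] less by auto
qed

section \<open>Primes with prescribed Legendre symbols\<close>

lemma Legendre_range: "Legendre a p \<in> {-1, 0, 1}"
  by (simp add: Legendre_def)

lemma Legendre_cong: "[a = b] (mod p) \<Longrightarrow> Legendre a p = Legendre b p"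
  by (simp add: Legendre_def QuadRes_def cong_def)

lemma Legendre_eqI:
  assumes "[Legendre a p = x] (mod int p)" "x \<in> {-1, 0, 1}" "2 < p"
  shows "Legendre a p = x"
proof -
  have "int p dvd Legendre a p - x" using assms(1) by (simp add: cong_iff_dvd_diff)
  moreover have "\<bar>Legendre a p - x\<bar> < int p" using assms(2,3) Legendre_range[of a "int p"] by auto
  ultimately show ?thesis using dvd_imp_le_int[of "Legendre a p - x" "int p"] by fastforce
qed

lemma Legendre_mult:
  assumes "prime p" "2 < p"
  shows "Legendre (a * b) (int p) = Legendre a p * Legendre b p"
proof (rule Legendre_eqI[OF _ _ assms(2)])
  have "[Legendre a p * Legendre b p = a ^ ((p - 1) div 2) * b ^ ((p - 1) div 2)] (mod int p)"
    using assms by (intro cong_mult euler_criterion)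
  then show "[Legendre (a * b) p = Legendre a p * Legendre b p] (mod int p)"
    using euler_criterion[OF assms, of "a * b"] by (simp add: power_mult_distrib) (metis cong_sym cong_trans)
  show "Legendre a p * Legendre b p \<in> {-1, 0, 1}"
    using Legendre_range[of a p] Legendre_range[of b p] by auto
qed

lemma Legendre_1: "2 < p \<Longrightarrow> Legendre 1 (int p) = 1"
  by (auto simp: Legendre_def QuadRes_def cong_iff_dvd_diff intro!: exI[of _ 1])

lemma Legendre_prod:
  assumes "prime p" "2 < p"
  shows "Legendre (\<Prod>q\<in>A. f q) (int p) = (\<Prod>q\<in>A. Legendre (f q) p)"
  by (induction A rule: infinite_finite_induct) (simp_all add: Legendre_mult Legendre_1 assms)

lemma Legendre_eq_0_iff: "Legendre a p = 0 \<longleftrightarrow> p dvd a"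
  by (auto simp: Legendre_def cong_0_iff)

lemma Legendre_eq_1D: "Legendre a p = 1 \<Longrightarrow> \<exists>y. p dvd y\<^sup>2 - a"
  by (auto simp: Legendre_def QuadRes_def cong_iff_dvd_diff split: if_splits)

text \<open>Squaring identifies 1 and \<open>p - 1\<close>, so as a self-map of the nonzero residues
  it is not injective and therefore misses some \<open>g\<close>.\<close>

lemma nonresidue_exists:
  assumes "prime p" "2 < p"
  shows "\<exists>g::nat. Legendre (int g) (int p) = -1"
proof -
  define f where "f = (\<lambda>x::nat. x\<^sup>2 mod p)"
  have sub: "f ` {1..<p} \<subseteq> {1..<p}"
  proof safe
    fix x assume "x \<in> {1..<p}"
    then have "\<not> p dvd x\<^sup>2" using assms(1) by (auto simp: prime_dvd_power_iff dest: dvd_imp_le)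
    then show "f x \<in> {1..<p}" using assms(2) by (auto simp: f_def dvd_eq_mod_eq_0 Suc_le_eq)
  qed
  have "f 1 = f (p - 1)"
  proof -
    obtain k where "p = k + 2" using assms(2) by (metis add.commute le_Suc_ex less_imp_le)
    then have "(p - 1)\<^sup>2 = p * (p - 2) + 1" by (simp add: power2_eq_square)
    then show ?thesis using assms(2) by (simp add: f_def mod_Suc)
  qed
  moreover have "1 \<in> {1..<p}" "p - 1 \<in> {1..<p}" "1 \<noteq> p - 1" using assms(2) by auto
  ultimately have "\<not> inj_on f {1..<p}" by (metis inj_onD)
  then have "f ` {1..<p} \<noteq> {1..<p}" using eq_card_imp_inj_on[of "{1..<p}" f] by auto
  then obtain g where g: "g \<in> {1..<p}" "g \<notin> f ` {1..<p}" using sub by blast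
  have "\<not> QuadRes (int p) (int g)"
  proof
    assume "QuadRes (int p) (int g)"
    then obtain y where "[y\<^sup>2 = int g] (mod int p)" by (auto simp: QuadRes_def)
    define x where "x = nat (y mod int p)"
    have x: "int x = y mod int p" using assms(2) by (simp add: x_def)
    have "int (x\<^sup>2 mod p) = y\<^sup>2 mod int p" by (simp add: zmod_int x power_mod)
    also have "\<dots> = int g" using \<open>[y\<^sup>2 = int g] (mod int p)\<close> g(1) by (simp add: cong_def)
    finally have fx: "f x = g" by (simp add: f_def)
    moreover have "x < p" using x assms(2) by (metis of_nat_0_less_iff of_nat_less_iff order_less_trans pos_mod_bound zero_less_numeral)
    moreover have "x \<noteq> 0" using fx g(1) by (cases "x = 0") (auto simp: f_def)
    ultimately show False using g(2) by auto
  qed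
  moreover have "\<not> [int g = 0] (mod int p)" using g(1) by (auto simp: cong_0_iff dest: zdvd_imp_le)
  ultimately show ?thesis by (auto simp: Legendre_def)
qed

lemma Legendre_minus_1:
  assumes "prime p" "2 < p"
  shows "Legendre (-1) (int p) = (-1) ^ ((p - 1) div 2)"
  by (rule Legendre_eqI[OF euler_criterion[OF assms] _ assms(2)])
    (cases "even ((p - 1) div 2)", auto)

lemma Legendre_minus_3:
  assumes "prime q" "3 < q"
  shows "Legendre (-3) (int q) = Legendre (int q) 3"
proof -
  have "prime (3::nat)" by simp
  then have "Legendre 3 q * Legendre q 3 = (-1) ^ ((q - 1) div 2)"
    using Quadratic_Reciprocity[of 3 q] assms by simp
  moreover have "Legendre (-3) q = Legendre (-1) q * Legendre 3 q"
    using Legendre_mult[of q "-1" 3] assms by simp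
  ultimately have "Legendre (-3) q = (Legendre 3 q * Legendre 3 q) * Legendre q 3"
    using assms by (simp add: Legendre_minus_1)
  moreover have "\<not> q dvd 3" using assms by (auto dest: dvd_imp_le)
  then have "Legendre 3 q \<noteq> 0" unfolding Legendre_eq_0_iff by (metis int_dvd_int_iff of_nat_numeral)
  then have "Legendre 3 q * Legendre 3 q = 1" using Legendre_range[of 3 q] by auto
  ultimately show ?thesis by simp
qed

lemma Legendre_mod_3: "[a = 1] (mod 3) \<Longrightarrow> Legendre a 3 = 1" "[a = 2] (mod 3) \<Longrightarrow> Legendre a 3 = -1"
proof -
  assume "[a = 1] (mod 3)"
  then show "Legendre a 3 = 1" using Legendre_cong[of a 1 3] Legendre_1[of 3] by simp
next
  assume "[a = 2] (mod 3)"
  moreover have "\<not> QuadRes 3 2"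
  proof
    assume "QuadRes 3 2"
    then obtain y :: int where y: "y\<^sup>2 mod 3 = 2" by (auto simp: QuadRes_def cong_def)
    have "y\<^sup>2 mod 3 = (y mod 3)\<^sup>2 mod 3" by (simp add: power_mod)
    moreover have "y mod 3 \<in> {0, 1, 2}" by auto
    ultimately show False using y by auto
  qed
  then have "Legendre 2 3 = -1" by (simp add: Legendre_def cong_def)
  ultimately show "Legendre a 3 = -1" using Legendre_cong[of a 2 3] by simp
qed

lemma Legendre_reciprocity_1_mod_4:
  assumes "prime p" "p mod 4 = 1" "prime q" "2 < q" "p \<noteq> q"
  shows "Legendre (int q) (int p) = Legendre (int p) (int q)"
proof -
  have p2: "2 < p" using assms(1,2) prime_gt_1_nat[of p] by (cases "p = 2") auto
  have "even ((p - 1) div 2)" using assms(2) by presburger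
  then have "Legendre p q * Legendre q p = 1"
    using Quadratic_Reciprocity[OF assms(1) p2 assms(3,4,5)] by simp
  then show ?thesis using Legendre_range[of "int p" "int q"] Legendre_range[of "int q" "int p"] by auto
qed

section \<open>Legendre symbols as characters of a common modulus\<close>

definition chi4 :: "nat \<Rightarrow> int" where
  "chi4 n = (if n mod 4 = 1 then 1 else if n mod 4 = 3 then -1 else 0)"

lemma chi4_mult: "chi4 (a * b) = chi4 a * chi4 b"
proof -
  have "(a * b) mod 4 = ((a mod 4) * (b mod 4)) mod 4" by (simp add: mod_mult_eq)
  moreover have "a mod 4 = 0 \<or> a mod 4 = 1 \<or> a mod 4 = 2 \<or> a mod 4 = 3" by linarith
  moreover have "b mod 4 = 0 \<or> b mod 4 = 1 \<or> b mod 4 = 2 \<or> b mod 4 = 3" by linarith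
  ultimately show ?thesis by (elim disjE) (simp_all add: chi4_def)
qed

text \<open>The condition \<open>p mod 4 = 1\<close> is treated as one more prescribed sign, that of
  \<open>chi4\<close>, under the index 4. The characters are independent: by the Chinese remainder
  theorem one factor of a product can be made -1 and all the others 1.\<close>

lemma prime_with_legendre_symbols:
  fixes Q :: "nat set" and \<epsilon> :: "nat \<Rightarrow> int"
  assumes fin: "finite Q" and Q: "\<And>q. q \<in> Q \<Longrightarrow> prime q \<and> 2 < q" and sign: "\<And>q. q \<in> Q \<Longrightarrow> \<epsilon> q \<in> {-1, 1}"
  shows "\<exists>p. prime p \<and> p mod 4 = 1 \<and> (\<forall>q\<in>Q. Legendre (int p) (int q) = \<epsilon> q)"
proof -
  define I where "I = insert 4 Q"
  define g :: "nat \<Rightarrow> nat \<Rightarrow> int" where "g = (\<lambda>i n. if i = 4 then chi4 n else Legendre (int n) (int i))"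
  define m where "m = \<Prod>I"
  have not4: "q \<noteq> 4" if "q \<in> Q" for q using Q[OF that] prime_odd_nat[of q] by auto
  have finI: "finite I" using fin by (simp add: I_def)
  have cop: "coprime i j" if "i \<in> I" "j \<in> I" "i \<noteq> j" for i j
  proof -
    have c4: "coprime q 4" if "q \<in> Q" for q
    proof -
      have "odd q" using Q[OF that] prime_odd_nat by blast
      then have "coprime q (2 ^ 2)" by (subst coprime_power_right_iff) simp
      then show ?thesis by simp
    qed
    show ?thesis using that c4 Q primes_coprime[of i j] by (auto simp: I_def coprime_commute)
  qed
  have g_mult: "g i (a * b) = g i a * g i b" if "i \<in> I" for i a b
    using that Q by (auto simp: g_def I_def chi4_mult Legendre_mult)
  have g_range: "g i a \<in> {-1, 0, 1}" for i a
    using Legendre_range by (auto simp: g_def chi4_def)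
  have g_cong: "g i a = g i b" if "[a = b] (mod i)" for i a b
  proof (cases "i = 4")
    case True
    with that show ?thesis by (simp add: g_def chi4_def cong_def)
  next
    case False
    then show ?thesis using that by (auto simp: g_def cong_int_iff intro!: Legendre_cong)
  qed
  have g_1: "g i 1 = 1" if "i \<in> I" for i
    using that Q Legendre_1 by (auto simp: g_def I_def chi4_def)
  have g_minus: "\<exists>c. g i c = -1" if "i \<in> I" for i
  proof (cases "i = 4")
    case True
    then show ?thesis by (intro exI[of _ 3]) (simp add: g_def chi4_def)
  next
    case False
    then show ?thesis using that Q nonresidue_exists by (auto simp: g_def I_def)
  qed
  have g_nonzero: "coprime c i" if "i \<in> I" "g i c \<noteq> 0" for i c
  proof (cases "i = 4")
    case True
    then have "c mod 4 = 1 \<or> c mod 4 = 3" using that(2) by (auto simp: g_def chi4_def split: if_splits)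
    then have "odd c" by presburger
    then have "coprime c (2 ^ 2)" by (subst coprime_power_right_iff) simp
    then show ?thesis using True by simp
  next
    case False
    then have "\<not> i dvd c" "prime i" using that Q by (auto simp: g_def I_def Legendre_eq_0_iff)
    then show ?thesis using prime_imp_coprime coprime_commute by blast
  qed
  have i_dvd: "i dvd m" if "i \<in> I" for i using that finI by (auto simp: m_def)
  have char: "real_character (\<lambda>n. \<Prod>i\<in>S. real_of_int (g i n)) m" if S: "S \<subseteq> I" "S \<noteq> {}" for S
  proof
    fix a b n
    show "(\<Prod>i\<in>S. real_of_int (g i (a * b))) = (\<Prod>i\<in>S. real_of_int (g i a)) * (\<Prod>i\<in>S. real_of_int (g i b))"
      unfolding prod.distrib[symmetric] using S g_mult by (intro prod.cong) auto
    show "(\<Prod>i\<in>S. real_of_int (g i 1)) = 1" using S g_1 by (intro prod.neutral) fastforce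
    show "(\<Prod>i\<in>S. real_of_int (g i n)) \<in> {-1, 0, 1}"
    proof (induction S rule: infinite_finite_induct)
      case (insert i S)
      then show ?case using g_range[of i n] by auto
    qed auto
    show "(\<Prod>i\<in>S. real_of_int (g i (n + m))) = (\<Prod>i\<in>S. real_of_int (g i n))"
    proof (rule prod.cong[OF refl])
      fix i assume "i \<in> S"
      then have "[m = 0] (mod i)" using S i_dvd[of i] by (auto simp: cong_0_iff)
      then have "[n + m = n + 0] (mod i)" by (intro cong_add cong_refl)
      then show "real_of_int (g i (n + m)) = real_of_int (g i n)" using g_cong[of "n + m" n i] by simp
    qed
    show "m > 0" unfolding m_def using Q finI by (intro prod_pos) (auto simp: I_def prime_gt_0_nat)
    obtain j where j: "j \<in> S" using S by blast
    then have jI: "j \<in> I" using S by auto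
    obtain c0 where c0: "g j c0 = -1" using g_minus[OF jI] by blast
    have m: "m = j * \<Prod>(I - {j})" unfolding m_def using finI jI by (simp add: prod.remove)
    have "coprime j (\<Prod>(I - {j}))" using cop jI by (intro prod_coprime_right) auto
    then obtain c where c: "[c = c0] (mod j)" "[c = 1] (mod \<Prod>(I - {j}))"
      using binary_chinese_remainder_nat by blast
    have gj: "g j c = -1" using g_cong[OF c(1)] c0 by simp
    have gi: "g i c = 1" if "i \<in> I - {j}" for i
    proof -
      have "i dvd \<Prod>(I - {j})" using that finI by auto
      then have "[c = 1] (mod i)" using c(2) cong_dvd_modulus_nat by blast
      then show ?thesis using g_cong g_1 that by auto
    qed
    have "coprime c m" unfolding m_def
    proof (rule prod_coprime_right)
      fix i assume "i \<in> I"
      then show "coprime c i" using g_nonzero[of i c] gj gi[of i] by (cases "i = j") auto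
    qed
    moreover have "(\<Prod>i\<in>S. real_of_int (g i c)) = -1"
    proof -
      have "finite S" using S finI finite_subset by blast
      then have "(\<Prod>i\<in>S. real_of_int (g i c)) = real_of_int (g j c) * (\<Prod>i\<in>S - {j}. real_of_int (g i c))"
        using j by (simp add: prod.remove)
      also have "(\<Prod>i\<in>S - {j}. real_of_int (g i c)) = 1" using gi S by (intro prod.neutral) auto
      finally show ?thesis using gj by simp
    qed
    ultimately show "\<exists>c. coprime c m \<and> (\<Prod>i\<in>S. real_of_int (g i c)) = -1" by blast
  qed
  have "\<exists>p. prime p \<and> (\<forall>i\<in>I. real_of_int (g i p) = real_of_int (if i = 4 then 1 else \<epsilon> i))"
  proof (rule prime_with_prescribed_characters[OF finI char])
    show "real_of_int (if i = 4 then 1 else \<epsilon> i) \<in> {-1, 1}" if "i \<in> I" for i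
    proof -
      have "(if i = 4 then 1 else \<epsilon> i) \<in> {-1, 1}" using that sign by (auto simp: I_def)
      then show ?thesis by (elim insertE) simp_all
    qed
    show "real_of_int (g i p) \<noteq> 0" if "i \<in> I" "prime p" "\<not> p dvd m" for i p
    proof (cases "i = 4")
      case True
      have "p \<noteq> 2" using that(3) i_dvd[of 4] by (auto simp: I_def intro: dvd_trans)
      then have "odd p" using that(2) primes_dvd_imp_eq two_is_prime_nat by blast
      then have "p mod 4 = 1 \<or> p mod 4 = 3" by presburger
      then show ?thesis using True by (auto simp: g_def chi4_def)
    next
      case False
      then have "prime i" using that Q by (auto simp: I_def)
      then have "\<not> i dvd p" using that i_dvd[of i] primes_dvd_imp_eq by blast
      then show ?thesis using False by (simp add: g_def Legendre_eq_0_iff)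
    qed
  qed
  then obtain p where p: "prime p" "\<forall>i\<in>I. g i p = (if i = 4 then 1 else \<epsilon> i)" by auto
  have "g 4 p = 1" using p(2) by (auto simp: I_def)
  then have "p mod 4 = 1" by (auto simp: g_def chi4_def split: if_splits)
  moreover have "Legendre (int p) (int q) = \<epsilon> q" if "q \<in> Q" for q
  proof -
    have "g q p = \<epsilon> q" using p(2) that not4 by (auto simp: I_def)
    then show ?thesis using not4[OF that] by (simp add: g_def)
  qed
  ultimately show ?thesis using p(1) by blast
qed

section \<open>The ternary form and the lemma of Cauchy type\<close>

lemma quadratic_root_mod_prod:
  fixes A :: "nat set" and u v :: int
  assumes "finite A" "\<And>q. q \<in> A \<Longrightarrow> prime q" "\<And>q. q \<in> A \<Longrightarrow> \<exists>r. int q dvd u * r\<^sup>2 + v"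
  shows "\<exists>r. int (\<Prod>A) dvd u * r\<^sup>2 + v"
  using assms
proof (induction A rule: finite_induct)
  case (insert q A)
  obtain r1 where r1: "int q dvd u * r1\<^sup>2 + v" using insert.prems by blast
  obtain r2 where r2: "int (\<Prod>A) dvd u * r2\<^sup>2 + v" using insert by blast
  have "coprime q (\<Prod>A)"
    using insert by (intro prod_coprime_right primes_coprime) auto
  then have cop: "coprime (int q) (int (\<Prod>A))" by (simp only: coprime_int_iff)
  then obtain r where r: "[r = r1] (mod int q)" "[r = r2] (mod int (\<Prod>A))"
    using binary_chinese_remainder_int by blast
  have "[u * r\<^sup>2 + v = u * r1\<^sup>2 + v] (mod int q)" "[u * r\<^sup>2 + v = u * r2\<^sup>2 + v] (mod int (\<Prod>A))"
    using r by (auto intro!: cong_add cong_mult cong_pow)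
  then have "int q dvd u * r\<^sup>2 + v" "int (\<Prod>A) dvd u * r\<^sup>2 + v"
    using r1 r2 cong_dvd_iff by blast+
  then have "int q * int (\<Prod>A) dvd u * r\<^sup>2 + v"
    using cop by (rule divides_mult)
  then show ?case using insert by auto
qed simp

lemma prod_prime_factors_squarefree:
  fixes n :: nat
  assumes "squarefree n"
  shows "\<Prod>(prime_factors n) = n"
proof -
  have "n \<noteq> 0" using assms by (intro notI) simp
  then have "(\<Prod>p\<in>prime_factors n. p ^ multiplicity p n) = n"
    using prod_prime_factors[of n] by simp
  moreover have "(\<Prod>p\<in>prime_factors n. p ^ multiplicity p n) = \<Prod>(prime_factors n)"
    using assms squarefree_factorial_semiring'[OF \<open>n \<noteq> 0\<close>] by (intro prod.cong) auto
  ultimately show ?thesis by simp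
qed

lemma prime_times_not_square:
  fixes p :: nat and c k :: int
  assumes "prime p" "\<not> int p dvd c"
  shows "int p * c \<noteq> k\<^sup>2"
proof
  assume eq: "int p * c = k\<^sup>2"
  then have "int p dvd k\<^sup>2" by (metis dvd_triv_left)
  then have "int p dvd k" using assms(1) prime_dvd_power by (metis prime_nat_int_transfer)
  then obtain l where "k = int p * l" by (rule dvdE)
  then have "c = int p * l\<^sup>2" using eq assms(1) by (auto simp: power2_eq_square)
  then show False using assms(2) by simp
qed

text \<open>If \<open>s\<^sup>2 \<equiv> u v\<close> then \<open>r = s/u\<close> satisfies \<open>u r\<^sup>2 \<equiv> v\<close>.\<close>

lemma Legendre_1_imp_root:
  assumes "prime p" "Legendre (u * v) (int p) = 1" "\<not> int p dvd u"
  shows "\<exists>r. int p dvd u * r\<^sup>2 - v"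
proof -
  obtain s where s: "int p dvd s\<^sup>2 - u * v" using Legendre_eq_1D[OF assms(2)] by blast
  have "coprime u (int p)" using assms(1,3) by (metis coprime_commute prime_imp_coprime prime_nat_int_transfer)
  then obtain w where w: "[u * w = 1] (mod int p)" using cong_solve_coprime_int by blast
  then have w': "int p dvd u * w - 1" by (simp add: cong_iff_dvd_diff)
  have "u * (s * w)\<^sup>2 - v = (s\<^sup>2 - u * v) * (u * w\<^sup>2) + (u * w - 1) * (v * (u * w + 1))"
    by (simp add: power2_eq_square algebra_simps)
  then have "int p dvd u * (s * w)\<^sup>2 - v" using s w' by (metis dvd_add dvd_mult2)
  then show ?thesis by blast
qed

text \<open>Legendre's equation with \<open>a = b = 1\<close> and \<open>c = p\<close>: its only
  substantial condition is that -1 is a square modulo \<open>p\<close>. A representation up to a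
  square factor is all that the rational step asks for.\<close>

lemma prime_1_mod_4_sum_two_squares_multiple:
  assumes "prime p" "p mod 4 = 1"
  shows "\<exists>s u v :: int. s \<noteq> 0 \<and> int p * s\<^sup>2 = u\<^sup>2 + v\<^sup>2"
proof -
  have p2: "2 < p" using assms prime_gt_1_nat[of p] by (cases "p = 2") auto
  have "even ((p - 1) div 2)" using assms(2) by presburger
  then have "Legendre (-1) p = 1" using Legendre_minus_1[OF assms(1) p2] by simp
  then obtain r where "int p dvd r\<^sup>2 - (-1)" using Legendre_eq_1D by blast
  then have r: "int p dvd 1 * r\<^sup>2 + 1" by simp
  have "\<not> int p dvd 1" using p2 by auto
  then have ns: "1 * int p \<noteq> k\<^sup>2" for k using prime_times_not_square[OF assms(1), of 1] by simp
  have "\<exists>x y z. z \<noteq> 0 \<and> 1 * x\<^sup>2 + 1 * y\<^sup>2 = int p * z\<^sup>2"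
    by (rule legendre_equation_solvable[where ?r1.0 = 0 and ?r2.0 = 0, OF _ _ _ _ _ _ _ _ r ns]) (use p2 in auto)
  then show ?thesis by (metis mult_1)
qed

lemma Legendre_minus_3_squarefree:
  fixes n :: nat
  assumes "squarefree n" "odd n" "\<not> 3 dvd n"
  shows "(\<Prod>q\<in>prime_factors n. Legendre (-3) (int q)) = Legendre (int n) 3"
proof -
  have "(\<Prod>q\<in>prime_factors n. Legendre (-3) (int q)) = (\<Prod>q\<in>prime_factors n. Legendre (int q) 3)"
  proof (rule prod.cong[OF refl])
    fix q assume q: "q \<in> prime_factors n"
    then have "prime q" "q dvd n" by (auto simp: in_prime_factors_iff)
    then have "q \<noteq> 2" "q \<noteq> 3" "q \<ge> 2" using assms prime_ge_2_nat by auto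
    then show "Legendre (-3) (int q) = Legendre (int q) 3"
      using \<open>prime q\<close> by (intro Legendre_minus_3) auto
  qed
  also have "\<dots> = Legendre (\<Prod>q\<in>prime_factors n. int q) 3"
    using Legendre_prod[of 3 int "prime_factors n"] by simp
  also have "(\<Prod>q\<in>prime_factors n. int q) = int n"
    using arg_cong[OF prod_prime_factors_squarefree[OF assms(1)], of int] by simp
  finally show ?thesis .
qed

text \<open>The auxiliary prime is a sum of two squares up to a square factor, and it is chosen such that
  all local conditions of Legendre's theorem for \<open>n t\<^sup>2 = p k\<^sup>2 + 3 z\<^sup>2\<close> (or, after division
  by 3, its analogue) hold.\<close>

lemma auxiliary_prime:
  fixes n :: nat and e :: int
  assumes n: "squarefree n" "odd n" "\<not> 3 dvd n" and e: "e \<in> {-1, 1}"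
  obtains p where "prime p" "p mod 4 = 1" "Legendre (int p) 3 = e" "\<not> p dvd n" "3 < p"
    "Legendre (int n) (int p) = Legendre (int n) 3"
    "\<And>q. q \<in> prime_factors n \<Longrightarrow> Legendre (int p * (-3)) (int q) = 1 \<and> \<not> int q dvd int p \<and> \<not> int q dvd 3"
proof -
  define Q where "Q = insert 3 (prime_factors n)"
  \<comment> \<open>These values make \<open>-3 * p\<close> a square modulo every prime divisor of
    \<open>n\<close>, which is Legendre's condition modulo \<open>n\<close>.\<close>
  define \<epsilon> where "\<epsilon> = (\<lambda>q. if q = 3 then e else Legendre (-3) (int q))"
  have q: "prime q \<and> 3 < q \<and> \<not> int q dvd 3" if "q \<in> prime_factors n" for q
  proof -
    have "prime q" "q dvd n" using that by (auto simp: in_prime_factors_iff)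
    then have "q \<noteq> 2" "q \<noteq> 3" "q \<ge> 2" using n prime_ge_2_nat by auto
    then show ?thesis using \<open>prime q\<close> by (auto dest: zdvd_imp_le)
  qed
  have "\<exists>p. prime p \<and> p mod 4 = 1 \<and> (\<forall>q\<in>Q. Legendre (int p) (int q) = \<epsilon> q)"
  proof (rule prime_with_legendre_symbols)
    fix r assume r: "r \<in> Q"
    then show "prime r \<and> 2 < r" using q by (force simp: Q_def)
    have "\<not> int r dvd - 3" if "r \<noteq> 3" using r q that by (auto simp: Q_def)
    then show "\<epsilon> r \<in> {-1, 1}" using e Legendre_range[of "-3" "int r"] Legendre_eq_0_iff[of "-3" "int r"]
      by (auto simp: \<epsilon>_def)
  qed (simp add: Q_def)
  then obtain p where p: "prime p" "p mod 4 = 1" and leg: "\<And>q. q \<in> Q \<Longrightarrow> Legendre (int p) (int q) = \<epsilon> q" by blast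
  have leg3: "Legendre (int p) 3 = e" using leg[of 3] by (simp add: Q_def \<epsilon>_def)
  have legq: "Legendre (int p) (int q) = Legendre (-3) (int q)" if "q \<in> prime_factors n" for q
    using leg[of q] q[OF that] that by (auto simp: Q_def \<epsilon>_def)
  have nz: "Legendre (-3) (int q) \<noteq> 0" if "q \<in> prime_factors n" for q
    using q[OF that] by (simp add: Legendre_eq_0_iff)
  have notdvd: "\<not> int q dvd int p" if "q \<in> prime_factors n" for q
    using nz[OF that] legq[OF that] Legendre_eq_0_iff by metis
  have "3 < p"
  proof -
    have "p \<noteq> 2" "p \<noteq> 3" using p(2) by auto
    then show ?thesis using prime_ge_2_nat[OF p(1)] by linarith
  qed
  moreover have "\<not> p dvd n"
  proof
    assume "p dvd n"
    then have "p \<in> prime_factors n" using p(1) n(2) by (auto simp: in_prime_factors_iff odd_pos intro: Nat.gr0I)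
    then show False using notdvd[of p] by simp
  qed
  \<comment> \<open>This symbol is not prescribed but follows: reciprocity, free of signs for
    \<open>p mod 4 = 1\<close>, turns it into the product of the symbols of -3 at the primes
    dividing \<open>n\<close>.\<close>
  moreover have "Legendre (int n) (int p) = Legendre (int n) 3"
  proof -
    have "int n = (\<Prod>q\<in>prime_factors n. int q)"
      using arg_cong[OF prod_prime_factors_squarefree[OF n(1)], of int] by simp
    then have "Legendre (int n) (int p) = (\<Prod>q\<in>prime_factors n. Legendre (int q) (int p))"
      using Legendre_prod[of p int] p(1) \<open>3 < p\<close> by simp
    also have "\<dots> = (\<Prod>q\<in>prime_factors n. Legendre (-3) (int q))"
    proof (rule prod.cong[OF refl])
      fix r assume r: "r \<in> prime_factors n"
      then have "Legendre (int r) (int p) = Legendre (int p) (int r)"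
        using q[OF r] p notdvd[OF r] by (intro Legendre_reciprocity_1_mod_4) auto
      then show "Legendre (int r) (int p) = Legendre (-3) (int r)" using legq[OF r] by simp
    qed
    finally show ?thesis using Legendre_minus_3_squarefree[OF n] by simp
  qed
  moreover have "Legendre (int p * (-3)) (int r) = 1 \<and> \<not> int r dvd int p \<and> \<not> int r dvd 3" if "r \<in> prime_factors n" for r
  proof -
    have "Legendre (int p * (-3)) (int r) = Legendre (-3) (int r) * Legendre (-3) (int r)"
      using Legendre_mult[of r "int p" "-3"] q[OF that] legq[OF that] by simp
    also have "\<dots> = 1" using nz[OF that] Legendre_range[of "-3" "int r"] by auto
    finally show ?thesis using notdvd[OF that] q[OF that] by blast
  qed
  ultimately show thesis using that[OF p leg3] by blast
qed

text \<open>Legendre's theorem is applied to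
  \<open>p * x\<^sup>2 + 3 * y\<^sup>2 = n * z\<^sup>2\<close>. With \<open>p\<close> congruent to 2
  modulo 3, the root 1 serves modulo 3; modulo \<open>p\<close> the symbols of 3 and of
  \<open>n\<close> are both -1, so \<open>3 * n\<close> is a square.\<close>

lemma ternary_rational_2_mod_3:
  fixes n :: nat
  assumes n: "squarefree n" "odd n" "n mod 3 = 2"
  shows "\<exists>t x y z :: int. t \<noteq> 0 \<and> int n * t\<^sup>2 = x\<^sup>2 + y\<^sup>2 + 3 * z\<^sup>2"
proof -
  have n3: "\<not> 3 dvd n" using n(3) by (simp add: dvd_eq_mod_eq_0)
  obtain p where p: "prime p" "p mod 4 = 1" "Legendre (int p) 3 = -1" "\<not> p dvd n" "3 < p"
    and legp: "Legendre (int n) (int p) = Legendre (int n) 3"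
    and leg: "\<And>q. q \<in> prime_factors n \<Longrightarrow> Legendre (int p * (-3)) (int q) = 1 \<and> \<not> int q dvd int p \<and> \<not> int q dvd 3"
    using auxiliary_prime[OF n(1,2) n3, of "-1"] by blast
  have "[int n = 2] (mod 3)" using n(3) by (simp add: cong_def) presburger
  then have n3': "Legendre (int n) 3 = -1" by (rule Legendre_mod_3)
  have "[int p = 2] (mod 3)"
  proof -
    have "int p mod 3 \<noteq> 0" "int p mod 3 \<noteq> 1"
      using p(3) Legendre_eq_0_iff[of "int p" 3] Legendre_mod_3(1)[of "int p"] by (auto simp: cong_def)
    then show ?thesis unfolding cong_def by presburger
  qed
  have pnot3: "\<not> int p dvd 3" using p(5) by (auto dest: zdvd_imp_le)
  have r1: "\<exists>r. int p dvd 3 * r\<^sup>2 - int n"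
  proof (rule Legendre_1_imp_root[OF p(1) _ pnot3])
    have "Legendre 3 (int p) = Legendre (int p) 3"
      using Legendre_reciprocity_1_mod_4[of p 3] p by simp
    then show "Legendre (3 * int n) (int p) = 1"
      using p legp n3' by (simp add: Legendre_mult)
  qed
  have r2: "3 dvd int p * 1\<^sup>2 - int n"
    using \<open>[int p = 2] (mod 3)\<close> \<open>[int n = 2] (mod 3)\<close> by (simp add: cong_iff_dvd_diff[symmetric] cong_def)
  have "\<exists>r. int (\<Prod>(prime_factors n)) dvd int p * r\<^sup>2 + 3"
  proof (rule quadratic_root_mod_prod)
    fix q assume q: "q \<in> prime_factors n"
    then show "prime q" by auto
    then show "\<exists>r. int q dvd int p * r\<^sup>2 + 3"
      using Legendre_1_imp_root[of q "int p" "-3"] leg[OF q] by simp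
  qed simp
  then have r3: "\<exists>r. int n dvd int p * r\<^sup>2 + 3"
    using prod_prime_factors_squarefree[OF n(1)] by simp
  have cop: "coprime (int p) 3" "coprime (int p) (int n)" "coprime 3 (int n)"
  proof -
    have "prime (3::nat)" by simp
    then have "coprime p 3" "coprime p n" "coprime 3 n"
      using p n3 prime_imp_coprime[of p n] prime_imp_coprime[of 3 n] primes_coprime[of p 3] by auto
    then show "coprime (int p) 3" "coprime (int p) (int n)" "coprime 3 (int n)"
      by (metis coprime_int_iff of_nat_numeral)+
  qed
  have ns: "int p * int n \<noteq> k\<^sup>2" for k using prime_times_not_square[of p "int n" k] p by simp
  obtain r1' r3' where r13: "int p dvd 3 * r1'\<^sup>2 - int n" "int n dvd int p * r3'\<^sup>2 + 3" using r1 r3 by blast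
  have "0 < int p" "0 < (3::int)" "0 < int n" using p(5) odd_pos[OF n(2)] by simp_all
  then obtain x y z where xyz: "z \<noteq> 0" "int p * x\<^sup>2 + 3 * y\<^sup>2 = int n * z\<^sup>2"
    using legendre_equation_solvable[OF _ _ _ cop r13(1) r2 r13(2) ns] by blast
  obtain s u v :: int where suv: "s \<noteq> 0" "int p * s\<^sup>2 = u\<^sup>2 + v\<^sup>2"
    using prime_1_mod_4_sum_two_squares_multiple[OF p(1,2)] by blast
  have "int n * (z * s)\<^sup>2 = (int n * z\<^sup>2) * s\<^sup>2" by (simp add: power_mult_distrib)
  also have "\<dots> = (int p * s\<^sup>2) * x\<^sup>2 + 3 * (y * s)\<^sup>2" by (simp add: xyz(2)[symmetric] power_mult_distrib algebra_simps)
  also have "\<dots> = (u * x)\<^sup>2 + (v * x)\<^sup>2 + 3 * (y * s)\<^sup>2" by (simp add: suv(2) power_mult_distrib algebra_simps)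
  finally show ?thesis using xyz(1) suv(1) by (intro exI[of _ "z * s"] exI) auto
qed

text \<open>In \<open>3 * n = x\<^sup>2 + y\<^sup>2 + 3 * z\<^sup>2\<close> both \<open>x\<close>
  and \<open>y\<close> are divisible by 3; cancelling leads to
  \<open>3 * p * x\<^sup>2 + y\<^sup>2 = n * z\<^sup>2\<close>. As \<open>n\<close> is a square
  modulo 3 and modulo \<open>p\<close>, it is one modulo \<open>3 * p\<close>.\<close>

lemma ternary_rational_3_mod_9:
  fixes n :: nat
  assumes n: "squarefree n" "odd n" "n mod 3 = 1"
  shows "\<exists>t x y z :: int. t \<noteq> 0 \<and> int (3 * n) * t\<^sup>2 = x\<^sup>2 + y\<^sup>2 + 3 * z\<^sup>2"
proof -
  have n3: "\<not> 3 dvd n" using n(3) by (simp add: dvd_eq_mod_eq_0)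
  obtain p where p: "prime p" "p mod 4 = 1" "Legendre (int p) 3 = 1" "\<not> p dvd n" "3 < p"
    and legp: "Legendre (int n) (int p) = Legendre (int n) 3"
    and leg: "\<And>q. q \<in> prime_factors n \<Longrightarrow> Legendre (int p * (-3)) (int q) = 1 \<and> \<not> int q dvd int p \<and> \<not> int q dvd 3"
    using auxiliary_prime[OF n(1,2) n3, of 1] by blast
  have "[int n = 1] (mod 3)" using n(3) by (simp add: cong_def) presburger
  then have n3': "Legendre (int n) 3 = 1" by (rule Legendre_mod_3)
  have cop3: "coprime (int p) 3" "coprime (int p) (int n)" "coprime 3 (int n)"
  proof -
    have "prime (3::nat)" by simp
    then have "coprime p 3" "coprime p n" "coprime 3 n"
      using p n3 prime_imp_coprime[of p n] prime_imp_coprime[of 3 n] primes_coprime[of p 3] by auto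
    then show "coprime (int p) 3" "coprime (int p) (int n)" "coprime 3 (int n)"
      by (metis coprime_int_iff of_nat_numeral)+
  qed
  obtain s where s: "int p dvd s\<^sup>2 - int n" using legp n3' Legendre_eq_1D by metis
  obtain r where r: "[r = s] (mod int p)" "[r = 1] (mod 3)"
    using binary_chinese_remainder_int[OF cop3(1)] by blast
  have r1: "3 * int p dvd 1 * r\<^sup>2 - int n"
  proof -
    have "[r\<^sup>2 = s\<^sup>2] (mod int p)" "[r\<^sup>2 = 1\<^sup>2] (mod 3)"
      using r by (blast intro: cong_pow)+
    moreover have "[s\<^sup>2 = int n] (mod int p)" using s by (simp add: cong_iff_dvd_diff)
    ultimately have "[r\<^sup>2 = int n] (mod int p)" "[r\<^sup>2 = int n] (mod 3)"
      using \<open>[int n = 1] (mod 3)\<close> by (simp_all add: cong_def)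
    then show ?thesis using divides_mult[of 3 "r\<^sup>2 - int n" "int p"] cop3(1)
      by (simp add: cong_iff_dvd_diff coprime_commute)
  qed
  have "\<exists>r. int (\<Prod>(prime_factors n)) dvd (3 * int p) * r\<^sup>2 + 1"
  proof (rule quadratic_root_mod_prod)
    fix q assume q: "q \<in> prime_factors n"
    then have pq: "prime q" by auto
    then show "prime q" .
    have "\<not> int q dvd 3 * int p" using leg[OF q] pq by (metis prime_dvd_mult_iff prime_nat_int_transfer)
    moreover have "Legendre ((3 * int p) * (-1)) (int q) = 1" using leg[OF q] by (simp add: mult.commute)
    ultimately show "\<exists>r. int q dvd (3 * int p) * r\<^sup>2 + 1"
      using Legendre_1_imp_root[OF pq, of "3 * int p" "-1"] by simp
  qed simp
  then have r3: "\<exists>r. int n dvd (3 * int p) * r\<^sup>2 + 1"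
    using prod_prime_factors_squarefree[OF n(1)] by simp
  have cop: "coprime (3 * int p) 1" "coprime (3 * int p) (int n)" "coprime 1 (int n)"
    using cop3 by auto
  have "\<not> int p dvd 3 * int n"
    using cop3 p(5) by (metis coprime_dvd_mult_left_iff coprime_dvd_mult_right_iff int_dvd_int_iff p(4))
  then have ns: "(3 * int p) * int n \<noteq> k\<^sup>2" for k
    using prime_times_not_square[of p "3 * int n" k] p by (simp add: mult_ac)
  obtain r3' where r3': "int n dvd (3 * int p) * r3'\<^sup>2 + 1" using r3 by blast
  have "0 < 3 * int p" "0 < (1::int)" "0 < int n" using p(5) odd_pos[OF n(2)] by simp_all
  then obtain x y z where xyz: "z \<noteq> 0" "(3 * int p) * x\<^sup>2 + 1 * y\<^sup>2 = int n * z\<^sup>2"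
    using legendre_equation_solvable[OF _ _ _ cop r1 one_dvd r3' ns] by blast
  obtain s u v :: int where suv: "s \<noteq> 0" "int p * s\<^sup>2 = u\<^sup>2 + v\<^sup>2"
    using prime_1_mod_4_sum_two_squares_multiple[OF p(1,2)] by blast
  have "int (3 * n) * (z * s)\<^sup>2 = 3 * (int n * z\<^sup>2) * s\<^sup>2" by (simp add: power_mult_distrib)
  also have "\<dots> = 9 * (int p * s\<^sup>2) * x\<^sup>2 + 3 * (y * s)\<^sup>2" by (simp add: xyz(2)[symmetric] power_mult_distrib algebra_simps)
  also have "\<dots> = (3 * u * x)\<^sup>2 + (3 * v * x)\<^sup>2 + 3 * (y * s)\<^sup>2" by (simp add: suv(2) power_mult_distrib algebra_simps)
  finally show ?thesis using xyz(1) suv(1) by (intro exI[of _ "z * s"] exI) auto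
qed

text \<open>Removing the square factor \<open>s\<^sup>2\<close> keeps the class: in both cases 3
  does not divide \<open>s\<close>, so \<open>s\<^sup>2\<close> is 1 modulo 3 and the squarefree
  part is again 2 modulo 3 or 3 modulo 9.\<close>

theorem hexform_represents:
  fixes n :: nat
  assumes "odd n" "n mod 3 = 2 \<or> n mod 9 = 3"
  shows "\<exists>x y z. int n = hexform x y z"
proof -
  define m s where "m = squarefree_part n" and "s = square_part n"
  have n: "n = m * s\<^sup>2" unfolding m_def s_def by (rule squarefree_decompose)
  have sq: "squarefree m" unfolding m_def by (rule squarefree_squarefree_part)
  have odd: "odd m" using assms(1) n by simp
  have s0: "s \<noteq> 0" using assms(1) n by (intro notI) simp
  have "\<exists>t x y z :: int. t \<noteq> 0 \<and> int m * t\<^sup>2 = x\<^sup>2 + y\<^sup>2 + 3 * z\<^sup>2"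
  proof (cases "n mod 3 = 2")
    case True
    have "n mod 3 = ((m mod 3) * ((s mod 3)\<^sup>2 mod 3)) mod 3" unfolding n by (simp add: power_mod mod_mult_eq)
    moreover have "m mod 3 = 0 \<or> m mod 3 = 1 \<or> m mod 3 = 2" "s mod 3 = 0 \<or> s mod 3 = 1 \<or> s mod 3 = 2" by linarith+
    ultimately have "m mod 3 = 2" using True by (elim disjE) simp_all
    then show ?thesis using ternary_rational_2_mod_3[OF sq odd] by blast
  next
    case False
    then have n9: "n mod 9 = 3" using assms(2) by simp
    have "n mod 9 = ((m mod 9) * ((s mod 9)\<^sup>2 mod 9)) mod 9" unfolding n by (simp add: power_mod mod_mult_eq)
    moreover have "(s mod 9)\<^sup>2 mod 9 = 0 \<or> (s mod 9)\<^sup>2 mod 9 = 1 \<or> (s mod 9)\<^sup>2 mod 9 = 4 \<or> (s mod 9)\<^sup>2 mod 9 = 7"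
    proof -
      have "s mod 9 = 0 \<or> s mod 9 = 1 \<or> s mod 9 = 2 \<or> s mod 9 = 3 \<or> s mod 9 = 4 \<or> s mod 9 = 5 \<or> s mod 9 = 6 \<or> s mod 9 = 7 \<or> s mod 9 = 8" by presburger
      then show ?thesis by (elim disjE) simp_all
    qed
    moreover have "m mod 9 = 0 \<or> m mod 9 = 1 \<or> m mod 9 = 2 \<or> m mod 9 = 3 \<or> m mod 9 = 4 \<or> m mod 9 = 5 \<or> m mod 9 = 6 \<or> m mod 9 = 7 \<or> m mod 9 = 8" by presburger
    ultimately have "m mod 9 = 3" using n9 by (elim disjE) simp_all
    then have "3 dvd m" by presburger
    then obtain k where k: "m = 3 * k" by (rule dvdE)
    have "k mod 3 = 1" using \<open>m mod 9 = 3\<close> mult_mod_right[of 3 k 3] by (simp add: k)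
    then show ?thesis using ternary_rational_3_mod_9[of k] sq odd squarefree_multD(2)[of 3 k] by (simp add: k)
  qed
  then obtain t x y z :: int where t: "t \<noteq> 0" "int m * t\<^sup>2 = x\<^sup>2 + y\<^sup>2 + 3 * z\<^sup>2" by blast
  have "int n * t\<^sup>2 = int m * t\<^sup>2 * (int s)\<^sup>2" by (simp add: n)
  \<comment> \<open>\<open>x\<^sup>2 + y\<^sup>2 + 3 * z\<^sup>2\<close> is
    \<open>hexform x (y - z) (2 * z)\<close>, the restriction of \<open>hexform\<close> to a
    sublattice.\<close>
  also have "\<dots> = hexform (x * int s) ((y - z) * int s) (2 * z * int s)"
    unfolding t(2) hexform_def by (simp add: power2_eq_square algebra_simps)
  finally show ?thesis using hexform_rational_imp_integral[OF t(1)] by blast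
qed

section \<open>From the ternary form to the system in four variables\<close>

lemma hex_norm_eq_sum_square_3_square: "\<exists>u v :: int. y\<^sup>2 + y * z + z\<^sup>2 = u\<^sup>2 + 3 * v\<^sup>2"
proof -
  \<comment> \<open>The units of the Eisenstein integers permute \<open>y\<close>, \<open>z\<close>
    and \<open>y + z\<close> up to sign and preserve the norm; one of the three is even, and there
    the square can be completed over the integers.\<close>
  consider k where "y = 2 * k" | k where "z = 2 * k" | k where "y + z = 2 * k"
    by (metis evenE odd_even_add)
  then show ?thesis
  proof cases
    case 1
    then show ?thesis by (intro exI[of _ "z + k"] exI[of _ k]) (simp add: power2_eq_square algebra_simps)
  next
    case 2
    then show ?thesis by (intro exI[of _ "y + k"] exI[of _ k]) (simp add: power2_eq_square algebra_simps)
  next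
    case 3
    then have y: "y = 2 * k - z" by simp
    show ?thesis unfolding y by (intro exI[of _ "z - k"] exI[of _ k]) (simp add: power2_eq_square algebra_simps)
  qed
qed

lemma even_hex_representation:
  fixes n :: nat
  assumes "n mod 4 = 1" "n mod 3 = 2 \<or> n mod 9 = 3"
  shows "\<exists>t p q :: int. int n = t\<^sup>2 + 4 * (p\<^sup>2 + p * q + q\<^sup>2)"
proof -
  have "odd n" using assms(1) by presburger
  then obtain x y z where "int n = hexform x y z" using hexform_represents assms(2) by blast
  moreover obtain u v where "y\<^sup>2 + y * z + z\<^sup>2 = u\<^sup>2 + 3 * v\<^sup>2"
    using hex_norm_eq_sum_square_3_square by blast
  ultimately have xuv: "int n = x\<^sup>2 + u\<^sup>2 + 3 * v\<^sup>2" by (simp add: hexform_def)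
  have same_parity: "\<exists>p q :: int. u\<^sup>2 + 3 * v\<^sup>2 = 4 * (p\<^sup>2 + p * q + q\<^sup>2)" if "even u = even v" for u v :: int
  proof -
    have "even (u - v)" using that by simp
    then obtain p where "u - v = 2 * p" by (rule evenE)
    then have "u = 2 * p + v" by simp
    then show ?thesis by (intro exI[of _ p] exI[of _ v]) (simp add: power2_eq_square algebra_simps)
  qed
  have sq: "w\<^sup>2 mod 4 = (if even w then 0 else 1)" for w :: int
  proof (cases "even w")
    case True
    then show ?thesis by (auto elim!: evenE simp: power2_eq_square)
  next
    case False
    then obtain k where "w = 2 * k + 1" by (rule oddE)
    define l where "l = k\<^sup>2 + k"
    have "w\<^sup>2 = 4 * l + 1" unfolding l_def \<open>w = 2 * k + 1\<close> by (simp add: power2_eq_square algebra_simps)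
    then show ?thesis using False by simp
  qed
  have mod4: "(X mod 4 + U mod 4 + 3 * (V mod 4)) mod 4 = (X + U + 3 * V) mod 4" for X U V :: int
    unfolding cong_def[symmetric] by (intro cong_add cong_mult cong_refl) (simp_all add: cong_def)
  have "int n mod 4 = 1" using assms(1) by presburger
  then have "(x\<^sup>2 mod 4 + u\<^sup>2 mod 4 + 3 * (v\<^sup>2 mod 4)) mod 4 = 1"
    unfolding xuv using mod4[of "x\<^sup>2" "u\<^sup>2" "v\<^sup>2"] by simp
  \<comment> \<open>If \<open>x\<close> and \<open>u\<close> both had the parity opposite to
    \<open>v\<close>, the value would be 2 or 3 modulo 4. As \<open>x\<close> and \<open>u\<close>
    enter symmetrically, either may be paired with \<open>v\<close>.\<close>
  then have par: "even u = even v \<or> even x = even v" by (simp add: sq split: if_splits)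
  then show ?thesis
  proof
    assume "even u = even v"
    then obtain p q where "u\<^sup>2 + 3 * v\<^sup>2 = 4 * (p\<^sup>2 + p * q + q\<^sup>2)"
      using same_parity by blast
    then have "int n = x\<^sup>2 + 4 * (p\<^sup>2 + p * q + q\<^sup>2)" using xuv by linarith
    then show ?thesis by blast
  next
    assume "even x = even v"
    then obtain p q where "x\<^sup>2 + 3 * v\<^sup>2 = 4 * (p\<^sup>2 + p * q + q\<^sup>2)"
      using same_parity by blast
    then have "int n = u\<^sup>2 + 4 * (p\<^sup>2 + p * q + q\<^sup>2)" using xuv by linarith
    then show ?thesis by blast
  qed
qed

text \<open>Projecting \<open>(w, x, y, z)\<close> onto the orthogonal complement of \<open>(1, 1, 1, 1)\<close> with respect to
  the form \<open>3 w\<^sup>2 + x\<^sup>2 + y\<^sup>2 + z\<^sup>2\<close> gives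
  \<open>6 a - b\<^sup>2 = (6 w - b)\<^sup>2 + 4 (p\<^sup>2 + p q + q\<^sup>2)\<close> with \<open>p = x - y\<close> and \<open>q = y - z\<close>.\<close>

theorem cauchy_lemma_3111:
  fixes a b :: int
  assumes "odd a" "odd b" "6 * a - b\<^sup>2 > 0" and b: "\<not> 3 dvd b \<or> (6 * a - b\<^sup>2) mod 9 = 3"
  shows "\<exists>w x y z :: int. 3 * w\<^sup>2 + x\<^sup>2 + y\<^sup>2 + z\<^sup>2 = a \<and> 3 * w + x + y + z = b"
proof -
  have sq3: "w\<^sup>2 mod 3 = (if 3 dvd w then 0 else 1)" for w :: int
  proof -
    have "w\<^sup>2 mod 3 = (w mod 3)\<^sup>2 mod 3" by (simp add: power_mod)
    moreover have "w mod 3 = 0 \<or> w mod 3 = 1 \<or> w mod 3 = 2" by linarith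
    ultimately show ?thesis by (elim disjE) (simp_all add: dvd_eq_mod_eq_0)
  qed
  define n where "n = nat (6 * a - b\<^sup>2)"
  have n: "int n = 6 * a - b\<^sup>2" using assms(3) by (simp add: n_def)
  obtain i j where ij: "a = 2 * i + 1" "b = 2 * j + 1" using assms(1,2) by (metis oddE)
  define k where "k = 3 * i + 1 - j\<^sup>2 - j"
  have "int n = 4 * k + 1" unfolding n ij k_def by (simp add: power2_eq_square algebra_simps)
  then have n4': "int n mod 4 = 1" by simp
  have n4: "n mod 4 = 1" using n4' by (metis of_nat_1 of_nat_eq_iff of_nat_numeral zmod_int)
  have "n mod 3 = 2 \<or> n mod 9 = 3"
  proof (cases "3 dvd b")
    case True
    then have "int n mod 9 = 3" using b n by simp
    then have "n mod 9 = 3" by (metis of_nat_eq_iff of_nat_numeral zmod_int)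
    then show ?thesis ..
  next
    case False
    have "int n mod 3 = (6 * a - b\<^sup>2 mod 3) mod 3" unfolding n by (simp add: mod_simps)
    also have "\<dots> = (6 * a - 1) mod 3" using False by (simp add: sq3)
    also have "\<dots> = 2" by presburger
    finally have "n mod 3 = 2" by presburger
    then show ?thesis ..
  qed
  then obtain t p q :: int where tpq: "int n = t\<^sup>2 + 4 * (p\<^sup>2 + p * q + q\<^sup>2)"
    using even_hex_representation n4 by blast
  \<comment> \<open>Modulo 3 the squares of \<open>b\<close>, \<open>t\<close> and
    \<open>p - q\<close> add up to 0, so all three numbers or none are divisible by 3. Up to signs
    this is the integrality of \<open>w, x, y, z\<close>.\<close>
  have "6 * a = b\<^sup>2 + t\<^sup>2 + (p - q)\<^sup>2 + 3 * (p + q)\<^sup>2"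
    using tpq n by (simp add: power2_eq_square algebra_simps)
  moreover have "(B mod 3 + T mod 3 + D mod 3) mod 3 = 0" if "6 * a = B + T + D + 3 * S" for B T D S :: int
  proof -
    have "[B mod 3 + T mod 3 + D mod 3 = B + T + D] (mod 3)"
      by (intro cong_add) (simp_all add: cong_def)
    moreover have "B + T + D = 3 * (2 * a - S)" using that by simp
    ultimately show ?thesis by (simp add: cong_def)
  qed
  ultimately have "(b\<^sup>2 mod 3 + t\<^sup>2 mod 3 + (p - q)\<^sup>2 mod 3) mod 3 = 0" by blast
  then have d3: "3 dvd t \<longleftrightarrow> 3 dvd b" "3 dvd (p - q) \<longleftrightarrow> 3 dvd b"
    by (auto simp: sq3 split: if_splits)
  have "odd t"
  proof
    assume "even t"
    then obtain k where "t = 2 * k" by (rule evenE)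
    then have "int n = 4 * (k\<^sup>2 + p\<^sup>2 + p * q + q\<^sup>2)" using tpq by (simp add: power2_eq_square)
    then show False using n4' by simp
  qed
  \<comment> \<open>The signs of \<open>t\<close> and of the pair \<open>(p, q)\<close> can be
    chosen independently: the former makes \<open>w\<close> integral, the latter
    \<open>z\<close>.\<close>
  have "6 dvd t + b \<or> 6 dvd -t + b" using d3(1) \<open>odd t\<close> assms(2) by presburger
  then obtain t' where t': "t'\<^sup>2 = t\<^sup>2" "6 dvd t' + b" by (metis power2_minus)
  then obtain w where w: "t' = 6 * w - b" by (metis add_diff_cancel_right' dvdE)
  have "3 dvd b - (p - q) \<or> 3 dvd b - (-p - -q)" using d3(2) by presburger
  then obtain p' q' where pq': "p'\<^sup>2 + p' * q' + q'\<^sup>2 = p\<^sup>2 + p * q + q\<^sup>2" "3 dvd b - (p' - q')"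
    by (metis minus_mult_minus power2_minus)
  have "3 dvd b - 3 * w - p' - 2 * q'" using pq'(2) by presburger
  then obtain z where "b - 3 * w - p' - 2 * q' = 3 * z" by (rule dvdE)
  then have b_eq: "b = 3 * w + p' + 2 * q' + 3 * z" by simp
  have "6 * a = b\<^sup>2 + t'\<^sup>2 + 4 * (p'\<^sup>2 + p' * q' + q'\<^sup>2)" using tpq n t'(1) pq'(1) by simp
  also have "\<dots> = 6 * (3 * w\<^sup>2 + (z + q' + p')\<^sup>2 + (z + q')\<^sup>2 + z\<^sup>2)"
    unfolding w b_eq by (simp add: power2_eq_square algebra_simps)
  finally have "3 * w\<^sup>2 + (z + q' + p')\<^sup>2 + (z + q')\<^sup>2 + z\<^sup>2 = a" by simp
  moreover have "3 * w + (z + q' + p') + (z + q') + z = b" unfolding b_eq by simp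
  ultimately show ?thesis by blast
qed

text \<open>If a variable of weight 1 were at most -1, the other terms would add up to at least
  \<open>b + 1\<close>, while Cauchy--Schwarz with total weight 3 + 1 + 1 = 5 bounds the square of
  their sum by \<open>5 * (a - 1)\<close>. For \<open>w\<close> the remaining weight is only
  3.\<close>

lemma cauchy_lemma_nonneg:
  fixes a b w x y z :: int
  assumes "3 * w\<^sup>2 + x\<^sup>2 + y\<^sup>2 + z\<^sup>2 = a" "3 * w + x + y + z = b" "b \<ge> 0" "(b + 1)\<^sup>2 > 5 * (a - 1)"
  shows "w \<ge> 0 \<and> x \<ge> 0 \<and> y \<ge> 0 \<and> z \<ge> 0"
proof -
  have a0: "a \<ge> 0" unfolding assms(1)[symmetric] by simp
  have sq1: "u\<^sup>2 \<ge> 1" if "u < 0" for u :: int using that by (simp add: power2_eq_square mult_le_cancel_left1 mult_neg_neg zero_less_mult_iff int_one_le_iff_zero_less)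
  have aux: "x \<ge> 0" if "3 * w\<^sup>2 + x\<^sup>2 + y\<^sup>2 + z\<^sup>2 = a" "3 * w + x + y + z = b" for x y z :: int
  proof (rule ccontr)
    assume "\<not> x \<ge> 0"
    then have "(b + 1)\<^sup>2 \<le> (b - x)\<^sup>2" using assms(3) by (intro power_mono) auto
    also have "b - x = 3 * w + y + z" using that by simp
    also have "(3 * w + y + z)\<^sup>2 + (3 * (w - y)\<^sup>2 + 3 * (w - z)\<^sup>2 + (y - z)\<^sup>2) = 5 * (3 * w\<^sup>2 + y\<^sup>2 + z\<^sup>2)"
      by (simp add: power2_eq_square algebra_simps)
    then have "(3 * w + y + z)\<^sup>2 \<le> 5 * (3 * w\<^sup>2 + y\<^sup>2 + z\<^sup>2)"
      by (smt (verit) zero_le_power2)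
    also have "\<dots> \<le> 5 * (a - 1)" using that(1) sq1[of x] \<open>\<not> x \<ge> 0\<close> by simp
    finally show False using assms(4) by simp
  qed
  have "w \<ge> 0"
  proof (rule ccontr)
    assume "\<not> w \<ge> 0"
    then have "(b + 1)\<^sup>2 \<le> (b - 3 * w)\<^sup>2" using assms(3) by (intro power_mono) auto
    also have "b - 3 * w = x + y + z" using assms(2) by simp
    also have "(x + y + z)\<^sup>2 + ((x - y)\<^sup>2 + (x - z)\<^sup>2 + (y - z)\<^sup>2) = 3 * (x\<^sup>2 + y\<^sup>2 + z\<^sup>2)"
      by (simp add: power2_eq_square algebra_simps)
    then have "(x + y + z)\<^sup>2 \<le> 3 * (x\<^sup>2 + y\<^sup>2 + z\<^sup>2)"
      by (smt (verit) zero_le_power2)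
    also have "\<dots> \<le> 5 * (a - 1)" using assms(1) sq1[of w] \<open>\<not> w \<ge> 0\<close> a0 by simp
    finally show False using assms(4) by simp
  qed
  moreover have "x \<ge> 0" using aux assms(1,2) by blast
  moreover have "y \<ge> 0" using aux[of y x z] assms(1,2) by simp
  moreover have "z \<ge> 0" using aux[of z y x] assms(1,2) by simp
  ultimately show ?thesis by blast
qed

section \<open>Sumsets of quadratic progressions\<close>

fun pointwise_or :: "bool list \<Rightarrow> bool list \<Rightarrow> bool list" where
  "pointwise_or [] bs = bs"
| "pointwise_or (a # as) [] = a # as"
| "pointwise_or (a # as) (b # bs) = (a \<or> b) # pointwise_or as bs"

text \<open>Sets of natural numbers are boolean lists. \<open>progression_sumset f k g d bs as\<close> shifts \<open>bs\<close> by
  \<open>k\<close>, \<open>k + g\<close>, \<open>k + 2 g + d\<close>, \<open>\<dots>\<close> (\<open>f\<close> terms, with increments growing by \<open>d\<close>) and takes the union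
  with \<open>as\<close>, cut off at the next shift; \<open>as\<close> holds what is pending from earlier shifts.\<close>

fun progression_sumset :: "nat \<Rightarrow> nat \<Rightarrow> nat \<Rightarrow> nat \<Rightarrow> bool list \<Rightarrow> bool list \<Rightarrow> bool list" where
  "progression_sumset f (Suc k) g d bs [] = False # progression_sumset f k g d bs []"
| "progression_sumset f (Suc k) g d bs (a # as) = a # progression_sumset f k g d bs as"
| "progression_sumset 0 0 g d bs as = []"
| "progression_sumset (Suc f) 0 g d bs as = progression_sumset f g (g + d) d bs (pointwise_or bs as)"

lemma pointwise_or_nth: "i < length (pointwise_or as bs) \<Longrightarrow> pointwise_or as bs ! i \<Longrightarrow> (i < length as \<and> as ! i) \<or> (i < length bs \<and> bs ! i)"
proof (induction as bs arbitrary: i rule: pointwise_or.induct)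
  case (3 a as b bs)
  then show ?case by (cases i) auto
qed auto

text \<open>Invariant of the traversal: \<open>n\<close> is the number at the head of
  \<open>as\<close>, \<open>k\<close> the distance to the next shift \<open>p x\<close>, and
  \<open>g\<close> the increment from \<open>p x\<close> to \<open>p (Suc x)\<close>. Cutting lists
  off may lose members of the sumset but never adds one; hence the one-sided claim.\<close>

lemma progression_sumset_sound:
  assumes p: "\<And>j. p (Suc j) = p j + (g0 + d * j)"
    and base: "\<And>i j. i < length bs \<Longrightarrow> bs ! i \<Longrightarrow> S (p j + i)"
    and pend: "\<And>i. i < length as \<Longrightarrow> as ! i \<Longrightarrow> S (n + i)"
    and "n + k = p x" "g = g0 + d * x"
    and "i < length (progression_sumset f k g d bs as)" "progression_sumset f k g d bs as ! i"
  shows "S (n + i)"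
  using assms
proof (induction f k g d bs as arbitrary: n x i rule: progression_sumset.induct)
  case (1 f k g d bs)
  show ?case
  proof (cases i)
    case 0
    then show ?thesis using "1.prems"(7) by simp
  next
    case (Suc j)
    then show ?thesis using "1.IH"[of "Suc n" x j] "1.prems" by simp
  qed
next
  case (2 f k g d bs a as)
  show ?case
  proof (cases i)
    case 0
    then show ?thesis using "2.prems"(3)[of 0] "2.prems"(7) by simp
  next
    case (Suc j)
    have "S (Suc n + i)" if "i < length as" "as ! i" for i
      using "2.prems"(3)[of "Suc i"] that by simp
    then show ?thesis using "2.IH"[of "Suc n" x j] "2.prems" Suc by simp
  qed
next
  case (4 f g d bs as)
  have "S (n + j)" if "j < length (pointwise_or bs as)" "pointwise_or bs as ! j" for j
    using pointwise_or_nth[OF that] "4.prems"(2)[of j x] "4.prems"(3)[of j] "4.prems"(4) by auto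
  moreover have "n + g = p (Suc x)" using "4.prems"(4) "4.prems"(1)[of x] unfolding "4.prems"(5) by simp
  moreover have "g + d = g0 + d * Suc x" using "4.prems"(5) by simp
  moreover have "i < length (progression_sumset f g (g + d) d bs (pointwise_or bs as))" "progression_sumset f g (g + d) d bs (pointwise_or bs as) ! i"
    using "4.prems"(6,7) by simp_all
  ultimately show ?case using "4.IH"[OF "4.prems"(1,2)] by blast
qed simp


text \<open>The same traversal fused with the test that every entry is True, so that the longest
  sumset is scanned without being built. If the pending list runs out before the next shift, a
  number is uncovered.\<close>

fun progression_sumset_full :: "nat \<Rightarrow> nat \<Rightarrow> nat \<Rightarrow> nat \<Rightarrow> bool list \<Rightarrow> bool list \<Rightarrow> bool" where
  "progression_sumset_full f (Suc k) g d bs [] = False"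
| "progression_sumset_full f (Suc k) g d bs (a # as) = (a \<and> progression_sumset_full f k g d bs as)"
| "progression_sumset_full 0 0 g d bs as = True"
| "progression_sumset_full (Suc f) 0 g d bs as = progression_sumset_full f g (g + d) d bs (pointwise_or bs as)"

lemma progression_sumset_full_sound:
  assumes p: "\<And>j. p (Suc j) = p j + (g0 + d * j)"
    and base: "\<And>i j. i < length bs \<Longrightarrow> bs ! i \<Longrightarrow> S (p j + i)"
    and pend: "\<And>i. i < length as \<Longrightarrow> as ! i \<Longrightarrow> S (n + i)"
    and "n + k = p x" "g = g0 + d * x"
    and "progression_sumset_full f k g d bs as" "n \<le> i" "i < p (x + f)"
  shows "S i"
  using assms
proof (induction f k g d bs as arbitrary: n x rule: progression_sumset_full.induct)
  case (2 f k g d bs a as)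
  show ?case
  proof (cases "i = n")
    case True
    then show ?thesis using "2.prems"(3)[of 0] "2.prems"(6) by simp
  next
    case False
    have "S (Suc n + i)" if "i < length as" "as ! i" for i
      using "2.prems"(3)[of "Suc i"] that by simp
    then show ?thesis using "2.IH"[of "Suc n" x] "2.prems" False by simp
  qed
next
  case (4 f g d bs as)
  have "S (n + j)" if "j < length (pointwise_or bs as)" "pointwise_or bs as ! j" for j
    using pointwise_or_nth[OF that] "4.prems"(2)[of j x] "4.prems"(3)[of j] "4.prems"(4) by auto
  moreover have "n + g = p (Suc x)" using "4.prems"(4) "4.prems"(1)[of x] unfolding "4.prems"(5) by simp
  moreover have "g + d = g0 + d * Suc x" using "4.prems"(5) by simp
  moreover have "progression_sumset_full f g (g + d) d bs (pointwise_or bs as)" "n \<le> i" "i < p (Suc x + f)"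
    using "4.prems"(6-8) by simp_all
  ultimately show ?case using "4.IH"[OF "4.prems"(1,2)] by blast
qed auto

section \<open>Verification of an initial segment by computation\<close>

definition quad_value :: "nat \<Rightarrow> nat \<Rightarrow> nat \<Rightarrow> nat" where
  "quad_value g d n = (\<Sum>j<n. g + d * j)"

lemma quad_value_Suc: "quad_value g d (Suc j) = quad_value g d j + (g + d * j)"
  by (simp add: quad_value_def)

lemma quad_value_0: "quad_value g d 0 = 0"
  by (simp add: quad_value_def)

lemma quad_value_eq:
  assumes "m = int d" "c = 2 * int g - int d"
  shows "int (quad_value g d n) = int n * (m * int n + c) div 2"
proof -
  have "2 * int (quad_value g d n) = int n * (m * int n + c)"
    by (induction n) (simp_all add: quad_value_0 quad_value_Suc assms algebra_simps)
  then show ?thesis by linarith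
qed

text \<open>The entries \<open>replicate t True\<close> count the numbers below \<open>t\<close> as
  settled, so the scan can start at 0 in spite of the exceptions. Three summands are collected into
  a short list with caps \<open>Y\<close> and \<open>W\<close>; only the last one runs up to
  \<open>X\<close>.\<close>

lemma quaternary_check:
  fixes g d :: nat
  assumes chk: "progression_sumset_full X 0 g d (progression_sumset W 0 (3 * g) (3 * d) (progression_sumset Y 0 g d (progression_sumset Y 0 g d [True] []) []) []) (replicate t True)"
    and n: "t \<le> n" "n < quad_value g d X"
  shows "\<exists>w x y z. n = 3 * quad_value g d w + quad_value g d x + quad_value g d y + quad_value g d z"
proof -
  define p where "p = quad_value g d"
  have p: "p (Suc j) = p j + (g + d * j)" "p 0 = 0" for j by (simp_all add: p_def quad_value_0 quad_value_Suc)
  have p3: "3 * p (Suc j) = 3 * p j + (3 * g + 3 * d * j)" for j by (simp add: p)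
  define P1 where "P1 = progression_sumset Y 0 g d [True] []"
  define P2 where "P2 = progression_sumset Y 0 g d P1 []"
  define P3 where "P3 = progression_sumset W 0 (3 * g) (3 * d) P2 []"
  define S1 where "S1 = (\<lambda>i. \<exists>z. i = p z)"
  define S2 where "S2 = (\<lambda>i. \<exists>y z. i = p y + p z)"
  define S3 where "S3 = (\<lambda>i. \<exists>w y z. i = 3 * p w + p y + p z)"
  define S4 where "S4 = (\<lambda>i. i < t \<or> (\<exists>w x y z. i = 3 * p w + p x + p y + p z))"
  have base: "S1 (p j + i)" if "i < length [True]" for i j
    using that by (auto simp: S1_def)
  have P1: "S1 i" if "i < length P1" "P1 ! i" for i
    using progression_sumset_sound[where S = S1 and n = 0 and x = 0, OF p(1) base _ _ _ that[unfolded P1_def]] p(2) by simp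
  have base: "S2 (p j + i)" if "i < length P1" "P1 ! i" for i j
    using P1[OF that] by (auto simp: S1_def S2_def)
  have P2: "S2 i" if "i < length P2" "P2 ! i" for i
    using progression_sumset_sound[where S = S2 and n = 0 and x = 0, OF p(1) base _ _ _ that[unfolded P2_def]] p(2) by simp
  have base: "S3 (3 * p j + i)" if "i < length P2" "P2 ! i" for i j
    using P2[OF that] by (auto simp: S2_def S3_def) (metis add.assoc)
  have P3: "S3 i" if "i < length P3" "P3 ! i" for i
    using progression_sumset_sound[where S = S3 and n = 0 and x = 0, OF p3 base _ _ _ that[unfolded P3_def]] p(2) by simp
  have base: "S4 (p j + i)" if i: "i < length P3" "P3 ! i" for i j
  proof -
    obtain w y z where "i = 3 * p w + p y + p z" using P3[OF i] by (auto simp: S3_def)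
    then have "p j + i = 3 * p w + p j + p y + p z" by simp
    then show ?thesis unfolding S4_def by blast
  qed
  have "progression_sumset_full X 0 g d P3 (replicate t True)" using chk by (simp add: P1_def P2_def P3_def)
  then have "S4 n"
    using progression_sumset_full_sound[where S = S4 and p = p and n = 0 and k = 0 and g = g and ?g0.0 = g and d = d and x = 0 and i = n
        and f = X and bs = P3 and as = "replicate t True", OF p(1) base] n p(2)
    by (auto simp: S4_def p_def)
  then show ?thesis using n by (simp add: S4_def p_def)
qed

text \<open>The count 81 makes \<open>quad_value 2 3 81 = 9882\<close> pass the bound 9710 from
  which the argument for large \<open>n\<close> applies; 90 and 89 play this role for the other two
  progressions. The caps 14 and 23 give a list several times longer than the gaps of the last
  progression.\<close>

lemma quaternary_check_3_1:
  assumes "32 \<le> n" "n < 9882"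
  shows "\<exists>w x y z. n = 3 * quad_value 2 3 w + quad_value 2 3 x + quad_value 2 3 y + quad_value 2 3 z"
proof (rule quaternary_check)
  show "progression_sumset_full 81 0 2 3 (progression_sumset 14 0 (3 * 2) (3 * 3) (progression_sumset 23 0 2 3 (progression_sumset 23 0 2 3 [True] []) []) []) (replicate 32 True)"
    by (simp add: numeral_eq_Suc)
  have "int (quad_value 2 3 81) = 9882" by (subst quad_value_eq[OF refl refl]) simp
  then show "n < quad_value 2 3 81" using assms by linarith
qed (rule assms)

lemma quaternary_check_5_1:
  assumes "683 \<le> n" "n < 20295"
  shows "\<exists>w x y z. n = 3 * quad_value 3 5 w + quad_value 3 5 x + quad_value 3 5 y + quad_value 3 5 z"
proof (rule quaternary_check)
  show "progression_sumset_full 90 0 3 5 (progression_sumset 19 0 (3 * 3) (3 * 5) (progression_sumset 32 0 3 5 (progression_sumset 32 0 3 5 [True] []) []) []) (replicate 683 True)"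
    by (simp add: numeral_eq_Suc)
  have "int (quad_value 3 5 90) = 20295" by (subst quad_value_eq[OF refl refl]) simp
  then show "n < quad_value 3 5 90" using assms by linarith
qed (rule assms)

lemma quaternary_check_5_minus_1:
  assumes "152 \<le> n" "n < 19758"
  shows "\<exists>w x y z. n = 3 * quad_value 2 5 w + quad_value 2 5 x + quad_value 2 5 y + quad_value 2 5 z"
proof (rule quaternary_check)
  show "progression_sumset_full 89 0 2 5 (progression_sumset 18 0 (3 * 2) (3 * 5) (progression_sumset 27 0 2 5 (progression_sumset 27 0 2 5 [True] []) []) []) (replicate 152 True)"
    by (simp add: numeral_eq_Suc)
  have "int (quad_value 2 5 89) = 19758" by (subst quad_value_eq[OF refl refl]) simp
  then show "n < quad_value 2 5 89" using assms by linarith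
qed (rule assms)

section \<open>Large numbers\<close>

lemma sum_of_values:
  fixes m c a b n w x y z :: int
  assumes "odd m" "odd c" "3 * w\<^sup>2 + x\<^sup>2 + y\<^sup>2 + z\<^sup>2 = a" "3 * w + x + y + z = b" "2 * n = m * a + c * b"
  shows "n = 3 * (w * (m * w + c) div 2) + x * (m * x + c) div 2 + y * (m * y + c) div 2 + z * (m * z + c) div 2"
proof -
  have "2 * n = 3 * (w * (m * w + c)) + x * (m * x + c) + y * (m * y + c) + z * (m * z + c)"
    unfolding assms(5) assms(3,4)[symmetric] by (simp add: power2_eq_square algebra_simps)
  then show ?thesis
    using two_times_half_quadratic(1)[OF assms(1,2), of w] two_times_half_quadratic(1)[OF assms(1,2), of x]
      two_times_half_quadratic(1)[OF assms(1,2), of y] two_times_half_quadratic(1)[OF assms(1,2), of z]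
    by linarith
qed

lemma representation_of_odd_pair:
  fixes m c a b n :: int
  assumes "odd m" "odd c" "odd a" "odd b" "b\<^sup>2 < 6 * a" "\<not> 3 dvd b \<or> (6 * a - b\<^sup>2) mod 9 = 3" "2 * n = m * a + c * b"
  shows "\<exists>w x y z. n = 3 * (w * (m * w + c) div 2) + x * (m * x + c) div 2 + y * (m * y + c) div 2 + z * (m * z + c) div 2"
proof -
  have "0 < 6 * a - b\<^sup>2" using assms(5) by simp
  from cauchy_lemma_3111[OF assms(3,4) this assms(6)] obtain w x y z where
    wxyz: "3 * w\<^sup>2 + x\<^sup>2 + y\<^sup>2 + z\<^sup>2 = a" "3 * w + x + y + z = b" by blast
  show ?thesis using sum_of_values[OF assms(1,2) wxyz assms(7)] by blast
qed

lemma nonneg_representation_of_odd_pair: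
  fixes m c a b n :: int
  assumes "odd m" "odd c" "odd a" "odd b" "b\<^sup>2 < 6 * a" "\<not> 3 dvd b \<or> (6 * a - b\<^sup>2) mod 9 = 3" "2 * n = m * a + c * b"
    and "0 \<le> b" "5 * (a - 1) < (b + 1)\<^sup>2"
  shows "\<exists>w x y z. w \<ge> 0 \<and> x \<ge> 0 \<and> y \<ge> 0 \<and> z \<ge> 0 \<and>
    n = 3 * (w * (m * w + c) div 2) + x * (m * x + c) div 2 + y * (m * y + c) div 2 + z * (m * z + c) div 2"
proof -
  have "0 < 6 * a - b\<^sup>2" using assms(5) by simp
  from cauchy_lemma_3111[OF assms(3,4) this assms(6)] obtain w x y z where
    wxyz: "3 * w\<^sup>2 + x\<^sup>2 + y\<^sup>2 + z\<^sup>2 = a" "3 * w + x + y + z = b" by blast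
  show ?thesis
    using cauchy_lemma_nonneg[OF wxyz assms(8,9)] sum_of_values[OF assms(1,2) wxyz assms(7)] by blast
qed

lemma residue_in_interval:
  fixes k s l :: int
  assumes "l > 0"
  obtains b where "k \<le> b" "b < k + l" "l dvd b - s"
proof (rule that[of "k + (s - k) mod l"])
  show "l dvd k + (s - k) mod l - s"
    by (simp add: minus_mult_div_eq_mod[symmetric])
qed (use assms in auto)

lemma residue_avoiding_multiples_of_3:
  fixes k s l :: int
  assumes "l > 0" "\<not> 3 dvd l"
  obtains b where "k \<le> b" "b < k + 2 * l" "l dvd b - s" "\<not> 3 dvd b"
proof -
  obtain b where b: "k \<le> b" "b < k + l" "l dvd b - s" using residue_in_interval[OF assms(1)] by blast
  show thesis
  proof (cases "3 dvd b")
    case True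
    then have "\<not> 3 dvd b + l" using assms(2) by (simp add: dvd_add_right_iff)
    moreover have "b + l - s = (b - s) + l" by simp
    then have "l dvd b + l - s" using b(3) by (metis dvd_add dvd_refl)
    ultimately show thesis using that[of "b + l"] b assms(1) by simp
  qed (use that b assms(1) in auto)
qed

lemma first_exceeding:
  fixes f :: "int \<Rightarrow> int"
  assumes "f N > v" "f K \<le> v" "K \<le> N"
  obtains k where "K < k" "f k > v" "f (k - 1) \<le> v"
proof -
  have "\<exists>k. K < k \<and> f k > v \<and> f (k - 1) \<le> v" if "f (K + int j) > v" for j
    using that
  proof (induction j)
    case (Suc j)
    then show ?case by (cases "f (K + int j) > v") (auto intro!: exI[of _ "K + int (Suc j)"])
  qed (use assms in simp)
  from this[of "nat (N - K)"] show thesis using assms that by auto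
qed

text \<open>The admissible \<open>b\<close> for given \<open>n\<close> form an interval between \<open>\<surd>(2n)\<close> and \<open>\<surd>(12n/5)\<close>,
  up to lower order terms; it contains two consecutive members of each residue class modulo 10 as soon
  as \<open>n\<close> is large.\<close>

lemma large_5_plus:
  fixes n :: int
  assumes "n \<ge> 20200"
  shows "\<exists>w x y z. w \<ge> 0 \<and> x \<ge> 0 \<and> y \<ge> 0 \<and> z \<ge> 0 \<and>
    n = 3 * (w * (5 * w + 1) div 2) + x * (5 * x + 1) div 2 + y * (5 * y + 1) div 2 + z * (5 * z + 1) div 2"
proof -
  have "n * n \<ge> 20200 * n" using assms by (intro mult_right_mono) auto
  then have ex: "n * n + 3 * n + 6 > 2 * n" using assms by linarith
  \<comment> \<open>With \<open>5 * a = 2 * n - b\<close> the condition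
    \<open>5 * (a - 1) < (b + 1)\<^sup>2\<close> reads \<open>b * b + 3 * b + 6 > 2 * n\<close>. For
    \<open>b \<le> k + 19\<close> the bound \<open>b\<^sup>2 < 6 * a\<close> then follows from
    \<open>k * k > 190 * k + 1895\<close>, and 200 is the first positive such
    \<open>k\<close>.\<close>
  obtain k where k: "199 < k" "k * k + 3 * k + 6 > 2 * n" "(k - 1) * (k - 1) + 3 * (k - 1) + 6 \<le> 2 * n"
    by (rule first_exceeding[of "2 * n" "\<lambda>k. k * k + 3 * k + 6" n 199, OF ex _ _ that]) (use assms in simp_all)
  have kk: "k * k \<ge> 200 * k" using k(1) by (intro mult_right_mono) auto
  \<comment> \<open>Oddness of \<open>a\<close> in \<open>2 * n = 5 * a + b\<close> amounts to this
    class modulo 10.\<close>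
  obtain b where b: "k \<le> b" "b < k + 2 * 10" "10 dvd b - (2 * n + 5)" "\<not> 3 dvd b"
    by (rule residue_avoiding_multiples_of_3[of 10 k "2 * n + 5", OF _ _ that]) simp_all
  obtain l where l: "b - (2 * n + 5) = 10 * l" using b(3) by (rule dvdE)
  define a where "a = - 1 - 2 * l"
  have a: "2 * n = 5 * a + 1 * b" using l by (simp add: a_def)
  have "odd b" using l by presburger
  have lo: "k * k \<le> b * b" using b k by (intro mult_mono) auto
  have "b * b \<le> (k + 19) * (k + 19)" using b k by (intro mult_mono) auto
  then have hi: "b * b \<le> k * k + 38 * k + 361" by (simp add: algebra_simps)
  have k3: "k * k + k + 4 \<le> 2 * n" using k(3) by (simp add: algebra_simps)
  have "5 * (b * b) + 6 * b < 12 * n" using hi k3 kk b k by linarith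
  then have "b\<^sup>2 < 6 * a" using a by (simp add: power2_eq_square)
  moreover have "b * b + 3 * b + 6 > 2 * n" using lo k b by linarith
  then have "5 * (a - 1) < (b + 1)\<^sup>2" using a by (simp add: power2_eq_square algebra_simps)
  ultimately show ?thesis
    using nonneg_representation_of_odd_pair[of 5 1 a b n] a b k \<open>odd b\<close> by (simp add: a_def)
qed

lemma large_5_minus:
  fixes n :: int
  assumes "n \<ge> 19710"
  shows "\<exists>w x y z. w \<ge> 0 \<and> x \<ge> 0 \<and> y \<ge> 0 \<and> z \<ge> 0 \<and>
    n = 3 * (w * (5 * w - 1) div 2) + x * (5 * x - 1) div 2 + y * (5 * y - 1) div 2 + z * (5 * z - 1) div 2"
proof -
  have "n * n \<ge> 19710 * n" using assms by (intro mult_right_mono) auto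
  then have ex: "n * n + n + 6 > 2 * n" using assms by linarith
  obtain k where k: "198 < k" "k * k + k + 6 > 2 * n" "(k - 1) * (k - 1) + (k - 1) + 6 \<le> 2 * n"
    by (rule first_exceeding[of "2 * n" "\<lambda>k. k * k + k + 6" n 198, OF ex _ _ that]) (use assms in simp_all)
  have kk: "k * k \<ge> 199 * k" using k(1) by (intro mult_right_mono) auto
  obtain b where b: "k \<le> b" "b < k + 2 * 10" "10 dvd b - (5 - 2 * n)" "\<not> 3 dvd b"
    by (rule residue_avoiding_multiples_of_3[of 10 k "5 - 2 * n", OF _ _ that]) simp_all
  obtain l where l: "b - (5 - 2 * n) = 10 * l" using b(3) by (rule dvdE)
  define a where "a = 1 + 2 * l"
  have a: "2 * n = 5 * a + (- 1) * b" using l by (simp add: a_def)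
  have "odd b" using l by presburger
  have lo: "k * k \<le> b * b" using b k by (intro mult_mono) auto
  have "b * b \<le> (k + 19) * (k + 19)" using b k by (intro mult_mono) auto
  then have hi: "b * b \<le> k * k + 38 * k + 361" by (simp add: algebra_simps)
  have k3: "k * k - k + 6 \<le> 2 * n" using k(3) by (simp add: algebra_simps)
  have "5 * (b * b) < 12 * n + 6 * b" using hi k3 kk b k by linarith
  then have "b\<^sup>2 < 6 * a" using a by (simp add: power2_eq_square)
  moreover have "b * b + b + 6 > 2 * n" using lo k b by linarith
  then have "5 * (a - 1) < (b + 1)\<^sup>2" using a by (simp add: power2_eq_square algebra_simps)
  ultimately show ?thesis
    using nonneg_representation_of_odd_pair[of 5 "-1" a b n] a b k \<open>odd b\<close> by (simp add: a_def)
qed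

text \<open>Here \<open>2 * n = 3 * a + b\<close> fixes \<open>b\<close> modulo 3. If 3 does not
  divide \<open>n\<close>, one class modulo 6 will do; otherwise 3 divides \<open>b\<close>, and
  making \<open>6 * a - b\<^sup>2\<close> equal to 3 modulo 9 takes a class modulo 18 and a window
  of that length.\<close>

lemma large_3_plus:
  fixes n :: int
  assumes "n \<ge> 9710"
  shows "\<exists>w x y z. w \<ge> 0 \<and> x \<ge> 0 \<and> y \<ge> 0 \<and> z \<ge> 0 \<and>
    n = 3 * (w * (3 * w + 1) div 2) + x * (3 * x + 1) div 2 + y * (3 * y + 1) div 2 + z * (3 * z + 1) div 2"
proof -
  have "n * n \<ge> 9710 * n" using assms by (intro mult_right_mono) auto
  then have ex: "3 * (n * n) + 11 * n + 18 > 10 * n" using assms by linarith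
  \<comment> \<open>For \<open>b \<le> k + 17\<close> the upper bound on \<open>b\<close> follows
    from \<open>k * k > 170 * k + 1595\<close>, first true at the positive value 179.\<close>
  obtain k where k: "178 < k" "3 * (k * k) + 11 * k + 18 > 10 * n" "3 * ((k - 1) * (k - 1)) + 11 * (k - 1) + 18 \<le> 10 * n"
    by (rule first_exceeding[of "10 * n" "\<lambda>k. 3 * (k * k) + 11 * k + 18" n 178, OF ex _ _ that]) (use assms in simp_all)
  have kk: "k * k \<ge> 179 * k" using k(1) by (intro mult_right_mono) auto
  obtain a b where b: "k \<le> b" "b < k + 18" and ab: "odd a" "odd b" "2 * n = 3 * a + 1 * b"
    "\<not> 3 dvd b \<or> (6 * a - b\<^sup>2) mod 9 = 3"
  proof (cases "3 dvd n")
    case False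
    obtain b where b: "k \<le> b" "b < k + 6" "6 dvd b - (2 * n + 3)" by (rule residue_in_interval[of 6 k "2 * n + 3", OF _ that]) simp_all
    obtain l where l: "b - (2 * n + 3) = 6 * l" using b(3) by (rule dvdE)
    then have "odd b" by presburger
    moreover have "\<not> 3 dvd b" using l False by presburger
    ultimately show thesis using that[of b "- 1 - 2 * l"] b l by simp
  next
    case True
    then obtain \<nu> where \<nu>: "n = 3 * \<nu>" by (rule dvdE)
    \<comment> \<open>With \<open>b = 3 * \<beta>\<close> the condition modulo 9 says that
      \<open>\<nu> + \<beta>\<close> is 1 modulo 3, so \<open>b\<close> is \<open>3 - n\<close>
      modulo 9; \<open>21 - 10 * n\<close> is the odd class modulo 18 above it.\<close>
    obtain b where b: "k \<le> b" "b < k + 18" "18 dvd b - (21 - 10 * n)" by (rule residue_in_interval[of 18 k "21 - 10 * n", OF _ that]) simp_all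
    obtain l where l: "b - (21 - 10 * n) = 18 * l" using b(3) by (rule dvdE)
    define a where "a = 4 * n - 7 - 6 * l"
    have "6 * a - b\<^sup>2 = 9 * (8 * \<nu> - 5 - 4 * l - (7 - 10 * \<nu> + 6 * l)\<^sup>2) + 3"
    proof -
      have b3: "b = 3 * (7 - 10 * \<nu> + 6 * l)" using l \<nu> by simp
      have "b\<^sup>2 = 9 * (7 - 10 * \<nu> + 6 * l)\<^sup>2" unfolding b3 power_mult_distrib by simp
      then show ?thesis using \<nu> by (simp add: a_def)
    qed
    moreover have "(9 * X + 3) mod 9 = 3" for X :: int by simp
    ultimately have "(6 * a - b\<^sup>2) mod 9 = 3" by metis
    moreover have "odd b" "odd a" using l by (presburger, simp add: a_def)
    ultimately show thesis using that[of b a] b l by (simp add: a_def)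
  qed
  have lo: "k * k \<le> b * b" using b k by (intro mult_mono) auto
  have "b * b \<le> (k + 17) * (k + 17)" using b k by (intro mult_mono) auto
  then have hi: "b * b \<le> k * k + 34 * k + 289" by (simp add: algebra_simps)
  have k3: "3 * (k * k) + 5 * k + 10 \<le> 10 * n" using k(3) by (simp add: algebra_simps)
  have "b * b + 2 * b < 4 * n" using hi k3 kk b k by linarith
  then have "b\<^sup>2 < 6 * a" using ab(3) by (simp add: power2_eq_square)
  moreover have "3 * (b * b) + 11 * b + 18 > 10 * n" using lo k b by linarith
  then have "5 * (a - 1) < (b + 1)\<^sup>2" using ab(3) by (simp add: power2_eq_square algebra_simps)
  ultimately show ?thesis
    using nonneg_representation_of_odd_pair[of 3 1 a b n] ab b k by simp
qed

section \<open>Representations by integers of either sign\<close>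

lemma square_le_of_abs_le: "\<bar>b\<bar> \<le> k \<Longrightarrow> b\<^sup>2 \<le> k\<^sup>2" for b k :: int
  by (metis abs_ge_zero power2_abs power_mono)

text \<open>Without sign conditions there is no lower bound on \<open>b\<close>, so the window is
  placed around 0 and already moderate \<open>n\<close> satisfy
  \<open>b\<^sup>2 < 6 * a\<close>.\<close>

lemma large_5_int:
  fixes n :: int
  assumes "n \<ge> 48"
  shows "\<exists>w x y z. n = 3 * (w * (5 * w + 1) div 2) + x * (5 * x + 1) div 2 + y * (5 * y + 1) div 2 + z * (5 * z + 1) div 2"
proof -
  obtain b where b: "-10 \<le> b" "b < 10" "10 dvd b - (2 * n + 5)" "\<not> 3 dvd b"
    by (rule residue_avoiding_multiples_of_3[of 10 "-10" "2 * n + 5", OF _ _ that]) simp_all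
  obtain l where l: "b - (2 * n + 5) = 10 * l" using b(3) by (rule dvdE)
  define a where "a = - 1 - 2 * l"
  have a: "2 * n = 5 * a + 1 * b" using l by (simp add: a_def)
  have "odd b" using l by presburger
  moreover have "b\<^sup>2 \<le> 10\<^sup>2" using b by (intro square_le_of_abs_le) auto
  then have "b\<^sup>2 < 6 * a" using a b assms by simp
  ultimately show ?thesis
    using representation_of_odd_pair[of 5 1 a b n] a b by (simp add: a_def)
qed

lemma large_7_1_int:
  fixes n :: int
  assumes "n \<ge> 137"
  shows "\<exists>w x y z. n = 3 * (w * (7 * w + 1) div 2) + x * (7 * x + 1) div 2 + y * (7 * y + 1) div 2 + z * (7 * z + 1) div 2"
proof -
  obtain b where b: "-14 \<le> b" "b < 14" "14 dvd b - (2 * n + 7)" "\<not> 3 dvd b"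
    by (rule residue_avoiding_multiples_of_3[of 14 "-14" "2 * n + 7", OF _ _ that]) simp_all
  obtain l where l: "b - (2 * n + 7) = 14 * l" using b(3) by (rule dvdE)
  define a where "a = - 1 - 2 * l"
  have a: "2 * n = 7 * a + 1 * b" using l by (simp add: a_def)
  have "odd b" using l by presburger
  moreover have "b\<^sup>2 \<le> 14\<^sup>2" using b by (intro square_le_of_abs_le) auto
  then have "b\<^sup>2 < 6 * a" using a b assms by simp
  ultimately show ?thesis
    using representation_of_odd_pair[of 7 1 a b n] a b by (simp add: a_def)
qed

lemma large_7_3_int:
  fixes n :: int
  assumes "n \<ge> 137"
  shows "\<exists>w x y z. n = 3 * (w * (7 * w + 3) div 2) + x * (7 * x + 3) div 2 + y * (7 * y + 3) div 2 + z * (7 * z + 3) div 2"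
proof -
  \<comment> \<open>\<open>3 * b\<close> has to be \<open>2 * n + 7\<close> modulo 14, and 5 is the
    inverse of 3.\<close>
  obtain b where b: "-14 \<le> b" "b < 14" "14 dvd b - 5 * (2 * n + 7)" "\<not> 3 dvd b"
    by (rule residue_avoiding_multiples_of_3[of 14 "-14" "5 * (2 * n + 7)", OF _ _ that]) simp_all
  obtain l where l: "b - 5 * (2 * n + 7) = 14 * l" using b(3) by (rule dvdE)
  define a where "a = - 4 * n - 15 - 6 * l"
  have a: "2 * n = 7 * a + 3 * b" using l by (simp add: a_def)
  have "odd b" using l by presburger
  moreover have "b\<^sup>2 \<le> 14\<^sup>2" using b by (intro square_le_of_abs_le) auto
  then have "b\<^sup>2 < 6 * a" using a b assms by simp
  ultimately show ?thesis
    using representation_of_odd_pair[of 7 3 a b n] a b by (simp add: a_def)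
qed

section \<open>Small numbers and exceptions\<close>

definition quaternary_value :: "int \<Rightarrow> int \<Rightarrow> int \<times> int \<times> int \<times> int \<Rightarrow> int" where
  "quaternary_value m c = (\<lambda>(w, x, y, z). 3 * (w * (m * w + c) div 2) + x * (m * x + c) div 2
     + y * (m * y + c) div 2 + z * (m * z + c) div 2)"

lemma quaternary_witness_list:
  assumes "map (quaternary_value m c) L = filter (\<lambda>n. n \<notin> E) [i..j]" "i \<le> n" "n \<le> j" "n \<notin> E"
  shows "\<exists>w x y z. (w, x, y, z) \<in> set L \<and> n = 3 * (w * (m * w + c) div 2) + x * (m * x + c) div 2
     + y * (m * y + c) div 2 + z * (m * z + c) div 2"
proof -
  have "n \<in> set (map (quaternary_value m c) L)" unfolding assms(1) using assms by simp
  then show ?thesis by (auto simp: quaternary_value_def)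
qed

lemma small_3_plus:
  fixes n :: int
  assumes "0 \<le> n" "n \<le> 31" "n \<notin> {1, 3, 5, 18, 31}"
  shows "\<exists>w x y z. w \<ge> 0 \<and> x \<ge> 0 \<and> y \<ge> 0 \<and> z \<ge> 0 \<and>
    n = 3 * (w * (3 * w + 1) div 2) + x * (3 * x + 1) div 2 + y * (3 * y + 1) div 2 + z * (3 * z + 1) div 2"
proof -
  define L :: "(int \<times> int \<times> int \<times> int) list" where "L =
    [(0, 0, 0, 0), (0, 0, 0, 1), (0, 0, 1, 1), (1, 0, 0, 0), (0, 0, 0, 2), (1, 0, 0, 1), (0, 0, 1, 2),
     (1, 0, 1, 1), (0, 1, 1, 2), (1, 1, 1, 1), (1, 0, 0, 2), (0, 0, 2, 2), (0, 0, 0, 3), (0, 1, 2, 2),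
     (0, 0, 1, 3), (0, 1, 1, 3), (1, 0, 2, 2), (2, 0, 0, 0), (0, 0, 2, 3), (2, 0, 0, 1), (0, 1, 2, 3),
     (2, 0, 1, 1), (0, 0, 0, 4), (2, 1, 1, 1), (2, 0, 0, 2), (0, 2, 2, 3), (2, 0, 1, 2)]"
  have "map (quaternary_value 3 1) L = filter (\<lambda>n. n \<notin> {1, 3, 5, 18, 31}) [0..31]"
    unfolding L_def by code_simp
  from quaternary_witness_list[OF this assms] obtain w x y z where
    wxyz: "(w, x, y, z) \<in> set L" and n: "n = 3 * (w * (3 * w + 1) div 2) + x * (3 * x + 1) div 2
     + y * (3 * y + 1) div 2 + z * (3 * z + 1) div 2" by (elim exE conjE) (rule that)
  have "\<forall>(w, x, y, z) \<in> set L. w \<ge> 0 \<and> x \<ge> 0 \<and> y \<ge> 0 \<and> z \<ge> 0" unfolding L_def by code_simp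
  with wxyz have "w \<ge> 0 \<and> x \<ge> 0 \<and> y \<ge> 0 \<and> z \<ge> 0" by (auto dest!: bspec)
  with n show ?thesis by (intro exI conjI) auto
qed

lemma small_5_int:
  fixes n :: int
  assumes "2 \<le> n" "n \<le> 47" "n \<notin> {}"
  shows "\<exists>w x y z. n = 3 * (w * (5 * w + 1) div 2) + x * (5 * x + 1) div 2 + y * (5 * y + 1) div 2 + z * (5 * z + 1) div 2"
proof -
  define L :: "(int \<times> int \<times> int \<times> int) list" where "L =
    [(0, 0, 0, -1), (0, 0, 0, 1), (0, 0, -1, -1), (0, 0, -1, 1), (-1, 0, 0, 0), (0, -1, -1, 1), (-1, 0,
     0, -1), (1, 0, 0, 0), (-1, 0, -1, -1), (0, 0, 0, 2), (1, 0, 0, 1), (0, 0, -1, 2), (0, 0, 1, 2), (-1,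
     0, 0, -2), (0, -1, 1, 2), (-1, 0, 0, 2), (1, 0, 0, -2), (-1, 0, -1, 2), (1, 0, 0, 2), (0, 0, 0, -3),
     (0, 0, 2, 2), (0, 0, -1, -3), (0, 0, 0, 3), (0, -1, -1, -3), (0, 0, -1, 3), (-2, 0, 0, 0), (-1, 0,
     2, 2), (-2, 0, 0, -1), (-2, 0, 0, 1), (-2, 0, -1, -1), (-2, 0, -1, 1), (2, 0, 0, 0), (-2, -1, -1,
     1), (2, 0, 0, -1), (2, 0, 0, 1), (2, 0, -1, -1), (-2, 0, 0, 2), (2, 0, 1, 1), (-2, 0, -1, 2), (-2,
     0, 1, 2), (0, 0, 0, 4), (-2, -1, 1, 2), (2, 0, 0, 2), (0, 0, 1, 4), (2, 0, -1, 2), (1, 0, 0, -4)]"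
  have "map (quaternary_value 5 1) L = filter (\<lambda>n. n \<notin> {}) [2..47]"
    unfolding L_def by code_simp
  from quaternary_witness_list[OF this assms] show ?thesis by (elim exE conjE) (intro exI)
qed

lemma small_7_1_int:
  fixes n :: int
  assumes "0 \<le> n" "n \<le> 136" "n \<notin> {1, 2, 5, 14}"
  shows "\<exists>w x y z. n = 3 * (w * (7 * w + 1) div 2) + x * (7 * x + 1) div 2 + y * (7 * y + 1) div 2 + z * (7 * z + 1) div 2"
proof -
  define L :: "(int \<times> int \<times> int \<times> int) list" where "L =
    [(0, 0, 0, 0), (0, 0, 0, -1), (0, 0, 0, 1), (0, 0, -1, -1), (0, 0, -1, 1), (0, 0, 1, 1), (-1, 0, 0,
     0), (0, -1, -1, 1), (0, -1, 1, 1), (1, 0, 0, 0), (-1, 0, 0, 1), (0, 0, 0, 2), (1, 0, 0, 1), (-1, 0,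
     1, 1), (0, 0, -1, 2), (0, 0, 1, 2), (1, 0, 1, 1), (-1, 1, 1, 1), (-1, 0, 0, -2), (0, 1, 1, 2), (-1,
     0, 0, 2), (1, 0, 0, -2), (-1, 0, 1, -2), (1, 0, 0, 2), (-1, 0, 1, 2), (1, 0, 1, -2), (0, 0, 0, -3),
     (1, 0, 1, 2), (-1, 1, 1, 2), (0, 0, 0, 3), (0, 0, 1, -3), (-1, 0, -2, -2), (0, 0, -1, 3), (0, 0, 1,
     3), (0, 1, 1, -3), (-2, 0, 0, 0), (0, -1, 1, 3), (0, 1, 1, 3), (-2, 0, 0, -1), (-2, 0, 0, 1), (1, 1,
     -2, 2), (2, 0, 0, 0), (-2, 0, -1, 1), (-2, 0, 1, 1), (2, 0, 0, -1), (2, 0, 0, 1), (-2, -1, 1, 1),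
     (2, 0, -1, -1), (-2, 0, 0, -2), (2, 0, 1, 1), (-2, 0, 0, 2), (-2, 0, -1, -2), (-2, 0, 1, -2), (-2,
     0, -1, 2), (0, 0, 0, 4), (-2, -1, 1, -2), (2, 0, 0, 2), (0, 0, -1, 4), (0, 0, 1, 4), (-1, 0, 0, -4),
     (2, 0, 1, 2), (-2, 0, -2, -2), (1, 0, 0, -4), (-1, 0, 0, 4), (2, 1, 1, 2), (-2, 0, 0, -3), (1, 0, 0,
     4), (-1, 0, 1, 4), (-2, 0, 0, 3), (-2, 0, 1, -3), (1, 0, 1, 4), (2, 0, 0, -3), (-2, 0, 1, 3), (-2,
     1, 1, -3), (2, 0, 0, 3), (2, 0, 1, -3), (-2, 1, 1, 3), (2, 0, -1, 3), (2, 0, 1, 3), (1, 0, -2, 4),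
     (-2, 0, 2, -3), (0, 0, 0, -5), (2, 1, 1, 3), (-2, 0, 2, 3), (0, 0, -1, -5), (0, 0, 1, -5), (-3, 0,
     0, 0), (0, -1, -1, -5), (0, -1, 1, -5), (-3, 0, 0, -1), (-3, 0, 0, 1), (0, 1, 3, 4), (-3, 0, -1,
     -1), (-3, 0, -1, 1), (-3, 0, 1, 1), (3, 0, 0, 0), (-3, -1, -1, 1), (-3, -1, 1, 1), (3, 0, 0, -1),
     (3, 0, 0, 1), (-2, -1, 1, 4), (-3, 0, 0, 2), (3, 0, -1, 1), (3, 0, 1, 1), (-3, 0, -1, 2), (-3, 0, 1,
     2), (3, -1, 1, 1), (3, 1, 1, 1), (3, 0, 0, -2), (-3, 1, 1, 2), (3, 0, 0, 2), (3, 0, -1, -2), (3, 0,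
     1, -2), (3, 0, -1, 2), (3, 0, 1, 2), (3, -1, 1, -2), (-3, 0, 0, -3), (3, -1, 1, 2), (3, 1, 1, 2),
     (-3, 0, 0, 3), (-3, 0, 1, -3), (3, 0, -2, -2), (-3, 0, -1, 3), (-3, 0, 1, 3), (-3, 1, 1, -3), (0, 0,
     0, 6), (2, 0, 0, -5), (-3, 1, 1, 3), (3, 0, 0, 3), (0, 0, 1, 6), (2, 0, 1, -5), (1, 0, 0, -6), (3,
     0, 1, 3)]"
  have "map (quaternary_value 7 1) L = filter (\<lambda>n. n \<notin> {1, 2, 5, 14}) [0..136]"
    unfolding L_def by code_simp
  from quaternary_witness_list[OF this assms] show ?thesis by (elim exE conjE) (intro exI)
qed

lemma small_7_3_int:
  fixes n :: int
  assumes "0 \<le> n" "n \<le> 136" "n \<notin> {1, 3, 14}"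
  shows "\<exists>w x y z. n = 3 * (w * (7 * w + 3) div 2) + x * (7 * x + 3) div 2 + y * (7 * y + 3) div 2 + z * (7 * z + 3) div 2"
proof -
  define L :: "(int \<times> int \<times> int \<times> int) list" where "L =
    [(0, 0, 0, 0), (0, 0, 0, -1), (0, 0, -1, -1), (0, 0, 0, 1), (-1, 0, 0, 0), (0, 0, -1, 1), (-1, 0, 0,
     -1), (0, -1, -1, 1), (0, 0, 1, 1), (-1, 0, 0, 1), (0, -1, 1, 1), (-1, 0, -1, 1), (1, 0, 0, 0), (-1,
     0, 1, 1), (0, 0, 0, 2), (-1, -1, 1, 1), (0, 0, -1, 2), (1, 0, 0, 1), (-1, 1, 1, 1), (0, 0, 1, 2),
     (-1, 0, 0, 2), (0, -1, 1, 2), (1, 0, 1, 1), (1, 0, 0, -2), (0, 0, 0, -3), (-1, 0, 1, 2), (0, 0, -1,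
     -3), (1, 1, 1, 1), (1, 0, 1, -2), (1, 0, 0, 2), (-2, 0, 0, 0), (0, 0, 2, 2), (-2, 0, 0, -1), (0, 0,
     0, 3), (-2, 0, -1, -1), (-2, 0, 0, 1), (-2, -1, -1, -1), (-2, 0, -1, 1), (0, 0, 1, 3), (-1, 0, 0,
     3), (-2, 0, 1, 1), (-2, 0, 0, -2), (-2, -1, 1, 1), (-2, 0, -1, -2), (-1, 0, 1, 3), (-2, 1, 1, 1),
     (-2, 0, 1, -2), (-2, 0, 0, 2), (2, 0, 0, 0), (-2, 0, -1, 2), (2, 0, 0, -1), (-2, -1, -1, 2), (2, 0,
     -1, -1), (2, 0, 0, 1), (2, -1, -1, -1), (2, 0, -1, 1), (-1, 0, 2, 3), (-2, 0, 0, -3), (2, 0, 1, 1),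
     (0, 0, 0, 4), (2, -1, 1, 1), (0, 0, -1, 4), (1, 0, 0, -4), (2, 1, 1, 1), (0, 0, 1, 4), (2, 0, 0, 2),
     (-2, 0, 0, 3), (2, 0, -1, 2), (-2, 0, -1, 3), (0, 0, 3, 3), (2, 0, 1, 2), (-2, 0, 1, 3), (2, -1, 1,
     2), (-2, -1, 1, 3), (1, 0, 0, 4), (2, 0, 0, -3), (0, 0, 2, 4), (0, 0, 0, -5), (-3, 0, 0, 0), (0, 0,
     -1, -5), (-3, 0, 0, -1), (0, -1, -1, -5), (-3, 0, -1, -1), (-3, 0, 0, 1), (2, 0, 0, 3), (-3, 0, -1,
     1), (2, 0, -1, 3), (-3, -1, -1, 1), (-3, 0, 1, 1), (-3, 0, 0, -2), (-3, -1, 1, 1), (-3, 0, -1, -2),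
     (0, 0, 0, 5), (-3, 1, 1, 1), (-3, 0, 1, -2), (-3, 0, 0, 2), (-3, -1, 1, -2), (-3, 0, -1, 2), (-1, 0,
     0, 5), (-3, -1, -1, 2), (-3, 0, 1, 2), (2, 0, 2, 3), (-3, -1, 1, 2), (-1, 0, 1, 5), (0, 0, -3, -5),
     (3, 0, 0, 0), (-3, 0, -2, 2), (3, 0, 0, -1), (-3, -1, -2, 2), (3, 0, -1, -1), (3, 0, 0, 1), (3, -1,
     -1, -1), (3, 0, -1, 1), (0, 0, 3, -5), (-3, 0, 0, 3), (3, 0, 1, 1), (3, 0, 0, -2), (3, -1, 1, 1),
     (3, 0, -1, -2), (-3, 0, 1, 3), (3, 1, 1, 1), (3, 0, 1, -2), (3, 0, 0, 2), (3, -1, 1, -2), (3, 0, -1,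
     2), (-2, 0, 0, 5), (3, -1, -1, 2), (3, 0, 1, 2), (-3, 0, 0, -4), (1, 0, 0, -6), (-3, 0, -1, -4),
     (-3, 0, 2, 3), (0, 0, 0, 6), (3, 0, -2, 2)]"
  have "map (quaternary_value 7 3) L = filter (\<lambda>n. n \<notin> {1, 3, 14}) [0..136]"
    unfolding L_def by code_simp
  from quaternary_witness_list[OF this assms] show ?thesis by (elim exE conjE) (intro exI)
qed

section \<open>The exceptional numbers\<close>

lemma second_pentagonal_small: "second_pentagonal w \<in> {0, 2, 7, 15, 26} \<or> second_pentagonal w \<ge> 40"
proof -
  consider "w = 0" | "w = 1" | "w = 2" | "w = 3" | "w = 4" | "w \<ge> 5" by linarith
  then show ?thesis
  proof cases
    case 6
    then have "5 * (3 * 5 + 1) \<le> w * (3 * w + 1)" by (intro mult_mono) auto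
    then show ?thesis using two_times_second_pentagonal[of w] by simp
  qed (simp_all add: second_pentagonal_def)
qed

text \<open>Up to 31 only the values 0, 2, 7, 15, 26 can occur, and the tripled one is at most 7
  since \<open>3 * 15\<close> is too large; a finite check remains.\<close>

lemma exceptions_3_plus:
  assumes "3 * second_pentagonal w + second_pentagonal x + second_pentagonal y + second_pentagonal z = n"
  shows "n \<notin> {1, 3, 5, 18, 31}"
proof (cases "n \<le> 31")
  case True
  then have "second_pentagonal w \<in> {0, 2, 7}" "second_pentagonal x \<in> {0, 2, 7, 15, 26}"
    "second_pentagonal y \<in> {0, 2, 7, 15, 26}" "second_pentagonal z \<in> {0, 2, 7, 15, 26}"
    using assms second_pentagonal_small[of w] second_pentagonal_small[of x]
      second_pentagonal_small[of y] second_pentagonal_small[of z] by auto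
  moreover have "\<forall>A\<in>{0, 2, 7}. \<forall>X\<in>{0, 2, 7, 15, 26}. \<forall>Y\<in>{0, 2, 7, 15, 26}. \<forall>Z\<in>{0, 2, 7, 15, 26}.
      3 * A + X + Y + Z \<notin> {1, 3, 5, 18, 31 :: nat}" by simp
  ultimately show ?thesis using assms by blast
qed auto

lemma small_values_7_1:
  fixes w :: int
  shows "w * (7 * w + 1) div 2 \<in> {0, 3, 4, 13} \<or> w * (7 * w + 1) div 2 \<ge> 15"
proof -
  consider "w = 0" | "w = 1" | "w = -1" | "w = 2" | "w = -2" | "\<bar>w\<bar> \<ge> 3" by linarith
  then show ?thesis
  proof cases
    case 6
    then have "3 * 3 \<le> \<bar>w\<bar> * \<bar>w\<bar>" "3 * \<bar>w\<bar> \<le> \<bar>w\<bar> * \<bar>w\<bar>" by (intro mult_mono; simp)+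
    then have "w * (7 * w + 1) \<ge> 2 * 15" by (simp add: algebra_simps)
    then show ?thesis by linarith
  qed simp_all
qed

lemma exceptions_7_1:
  fixes n w x y z :: int
  assumes "n = 3 * (w * (7 * w + 1) div 2) + x * (7 * x + 1) div 2 + y * (7 * y + 1) div 2 + z * (7 * z + 1) div 2"
  shows "n \<notin> {1, 2, 5, 14}"
proof (cases "n \<le> 14")
  case True
  define v where "v = (\<lambda>w::int. w * (7 * w + 1) div 2)"
  have v: "v w \<in> {0, 3, 4, 13} \<or> v w \<ge> 15" for w unfolding v_def by (rule small_values_7_1)
  have v0: "v w \<ge> 0" for w using v[of w] by auto
  have n: "n = 3 * v w + v x + v y + v z" using assms by (simp add: v_def)
  have "v w \<le> 14" "v x \<le> 14" "v y \<le> 14" "v z \<le> 14"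
    using n True v0[of w] v0[of x] v0[of y] v0[of z] by linarith+
  then have "v w \<in> {0, 3, 4, 13}" "v x \<in> {0, 3, 4, 13}" "v y \<in> {0, 3, 4, 13}" "v z \<in> {0, 3, 4, 13}"
    using v[of w] v[of x] v[of y] v[of z] by linarith+
  moreover have "\<forall>A\<in>{0, 3, 4, 13}. \<forall>X\<in>{0, 3, 4, 13}. \<forall>Y\<in>{0, 3, 4, 13}. \<forall>Z\<in>{0, 3, 4, 13}.
      3 * A + X + Y + Z \<notin> ({1, 2, 5, 14} :: int set)" by simp
  ultimately show ?thesis unfolding n by blast
qed auto

lemma small_values_7_3:
  fixes w :: int
  shows "w * (7 * w + 3) div 2 \<in> {0, 2, 5, 11} \<or> w * (7 * w + 3) div 2 \<ge> 17"
proof -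
  consider "w = 0" | "w = 1" | "w = -1" | "w = 2" | "w = -2" | "\<bar>w\<bar> \<ge> 3" by linarith
  then show ?thesis
  proof cases
    case 6
    then have "3 * 3 \<le> \<bar>w\<bar> * \<bar>w\<bar>" "3 * \<bar>w\<bar> \<le> \<bar>w\<bar> * \<bar>w\<bar>" by (intro mult_mono; simp)+
    then have "w * (7 * w + 3) \<ge> 2 * 17" by (simp add: algebra_simps)
    then show ?thesis by linarith
  qed simp_all
qed

lemma exceptions_7_3:
  fixes n w x y z :: int
  assumes "n = 3 * (w * (7 * w + 3) div 2) + x * (7 * x + 3) div 2 + y * (7 * y + 3) div 2 + z * (7 * z + 3) div 2"
  shows "n \<notin> {1, 3, 14}"
proof (cases "n \<le> 14")
  case True
  define v where "v = (\<lambda>w::int. w * (7 * w + 3) div 2)"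
  have v: "v w \<in> {0, 2, 5, 11} \<or> v w \<ge> 17" for w unfolding v_def by (rule small_values_7_3)
  have v0: "v w \<ge> 0" for w using v[of w] by auto
  have n: "n = 3 * v w + v x + v y + v z" using assms by (simp add: v_def)
  have "v w \<le> 14" "v x \<le> 14" "v y \<le> 14" "v z \<le> 14"
    using n True v0[of w] v0[of x] v0[of y] v0[of z] by linarith+
  then have "v w \<in> {0, 2, 5, 11}" "v x \<in> {0, 2, 5, 11}" "v y \<in> {0, 2, 5, 11}" "v z \<in> {0, 2, 5, 11}"
    using v[of w] v[of x] v[of y] v[of z] by linarith+
  moreover have "\<forall>A\<in>{0, 2, 5, 11}. \<forall>X\<in>{0, 2, 5, 11}. \<forall>Y\<in>{0, 2, 5, 11}. \<forall>Z\<in>{0, 2, 5, 11}.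
      3 * A + X + Y + Z \<notin> ({1, 3, 14} :: int set)" by simp
  ultimately show ?thesis unfolding n by blast
qed auto

section \<open>Translation between natural and integer arguments\<close>

lemma quad_value_5_plus: "int (quad_value 3 5 w) = int w * (5 * int w + 1) div 2"
  by (rule quad_value_eq) simp_all

lemma quad_value_5_minus: "int (quad_value 2 5 w) = int w * (5 * int w - 1) div 2"
  using quad_value_eq[of 5 5 "-1" 2 w] by simp

lemma int_second_pentagonal: "int (second_pentagonal w) = int w * (3 * int w + 1) div 2"
proof -
  have "int (2 * second_pentagonal w) = int (w * (3 * w + 1))" by (simp only: two_times_second_pentagonal)
  then have "2 * int (second_pentagonal w) = int w * (3 * int w + 1)" by (simp add: algebra_simps)
  then show ?thesis by linarith
qed

lemma quad_value_3_plus: "quad_value 2 3 w = second_pentagonal w"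
proof -
  have "int (quad_value 2 3 w) = int (second_pentagonal w)"
    unfolding int_second_pentagonal by (rule quad_value_eq) simp_all
  then show ?thesis by simp
qed

lemma pentagonal_representation:
  fixes n :: nat
  assumes "n \<notin> {1, 3, 5, 18, 31}"
  shows "\<exists>w x y z. n = 3 * second_pentagonal w + second_pentagonal x + second_pentagonal y + second_pentagonal z"
proof -
  have from_int: "\<exists>w x y z. n = 3 * second_pentagonal w + second_pentagonal x + second_pentagonal y + second_pentagonal z"
    if "\<exists>w x y z. w \<ge> 0 \<and> x \<ge> 0 \<and> y \<ge> 0 \<and> z \<ge> 0 \<and> int n = 3 * (w * (3 * w + 1) div 2)
      + x * (3 * x + 1) div 2 + y * (3 * y + 1) div 2 + z * (3 * z + 1) div 2"
  proof -
    have sp: "w * (3 * w + 1) div 2 = int (second_pentagonal (nat w))" if "w \<ge> 0" for w :: int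
      using int_second_pentagonal[of "nat w"] that by simp
    from that obtain w x y z :: int where "w \<ge> 0" "x \<ge> 0" "y \<ge> 0" "z \<ge> 0" and
      "int n = 3 * (w * (3 * w + 1) div 2) + x * (3 * x + 1) div 2 + y * (3 * y + 1) div 2 + z * (3 * z + 1) div 2"
      by blast
    then have "int n = int (3 * second_pentagonal (nat w) + second_pentagonal (nat x) + second_pentagonal (nat y)
        + second_pentagonal (nat z))"
      by (simp add: sp)
    then show ?thesis unfolding of_nat_eq_iff by blast
  qed
  consider "n \<le> 31" | "32 \<le> n" "n < 9882" | "n \<ge> 9710" by linarith
  then show ?thesis
  proof cases
    case 1
    have "int n \<notin> {1, 3, 5, 18, 31}" using assms by auto
    then show ?thesis using 1 by (intro from_int small_3_plus) auto
  next
    case 2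
    then show ?thesis using quaternary_check_3_1[of n] by (simp add: quad_value_3_plus)
  next
    case 3
    then show ?thesis by (intro from_int large_3_plus) auto
  qed
qed

theorem corollary10:
  shows
    "({3 * second_pentagonal w + second_pentagonal x + second_pentagonal y + second_pentagonal z
        | w x y z :: nat. True} = (UNIV :: nat set) - {1, 3, 5, 18, 31}) \<and>
     (\<forall>n::int. n > 1 \<longrightarrow> (\<exists>w x y z :: int.
        n = 3 * (w * (5 * w + 1) div 2) + x * (5 * x + 1) div 2
          + y * (5 * y + 1) div 2 + z * (5 * z + 1) div 2)) \<and>
     (\<forall>n::int. n > 151 \<longrightarrow> (\<exists>w x y z :: int. w \<ge> 0 \<and> x \<ge> 0 \<and> y \<ge> 0 \<and> z \<ge> 0 \<and>
        n = 3 * (w * (5 * w - 1) div 2) + x * (5 * x - 1) div 2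
          + y * (5 * y - 1) div 2 + z * (5 * z - 1) div 2)) \<and>
     (\<forall>n::int. n > 682 \<longrightarrow> (\<exists>w x y z :: int. w \<ge> 0 \<and> x \<ge> 0 \<and> y \<ge> 0 \<and> z \<ge> 0 \<and>
        n = 3 * (w * (5 * w + 1) div 2) + x * (5 * x + 1) div 2
          + y * (5 * y + 1) div 2 + z * (5 * z + 1) div 2)) \<and>
     ({n :: nat. \<not> (\<exists>w x y z :: int.
        int n = 3 * (w * (7 * w + 1) div 2) + x * (7 * x + 1) div 2
          + y * (7 * y + 1) div 2 + z * (7 * z + 1) div 2)} = {1, 2, 5, 14}) \<and>
     ({n :: nat. \<not> (\<exists>w x y z :: int.
        int n = 3 * (w * (7 * w + 3) div 2) + x * (7 * x + 3) div 2
          + y * (7 * y + 3) div 2 + z * (7 * z + 3) div 2)} = {1, 3, 14})"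
proof (intro conjI allI impI)
  show "{3 * second_pentagonal w + second_pentagonal x + second_pentagonal y + second_pentagonal z
      | w x y z :: nat. True} = (UNIV :: nat set) - {1, 3, 5, 18, 31}"
  proof (intro equalityI subsetI)
    fix n
    assume "n \<in> {3 * second_pentagonal w + second_pentagonal x + second_pentagonal y + second_pentagonal z
      | w x y z :: nat. True}"
    then obtain w x y z where "3 * second_pentagonal w + second_pentagonal x + second_pentagonal y + second_pentagonal z = n"
      by blast
    from exceptions_3_plus[OF this] show "n \<in> UNIV - {1, 3, 5, 18, 31}" by blast
  next
    fix n :: nat
    assume "n \<in> UNIV - {1, 3, 5, 18, 31}"
    then show "n \<in> {3 * second_pentagonal w + second_pentagonal x + second_pentagonal y + second_pentagonal z
      | w x y z :: nat. True}" using pentagonal_representation[of n] by blast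
  qed
next
  fix n :: int
  assume "n > 1"
  then show "\<exists>w x y z :: int. n = 3 * (w * (5 * w + 1) div 2) + x * (5 * x + 1) div 2
      + y * (5 * y + 1) div 2 + z * (5 * z + 1) div 2"
    using small_5_int[of n] large_5_int[of n] by (cases "n \<le> 47") simp_all
next
  fix n :: int
  assume n: "n > 151"
  show "\<exists>w x y z :: int. w \<ge> 0 \<and> x \<ge> 0 \<and> y \<ge> 0 \<and> z \<ge> 0 \<and>
      n = 3 * (w * (5 * w - 1) div 2) + x * (5 * x - 1) div 2 + y * (5 * y - 1) div 2 + z * (5 * z - 1) div 2"
  proof (cases "n < 19758")
    case True
    then have "152 \<le> nat n" "nat n < 19758" using n by linarith+
    from quaternary_check_5_minus_1[OF this] obtain w x y z where "nat n = 3 * quad_value 2 5 w + quad_value 2 5 x + quad_value 2 5 y + quad_value 2 5 z"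
      by blast
    then have "n = int (3 * quad_value 2 5 w + quad_value 2 5 x + quad_value 2 5 y + quad_value 2 5 z)"
      using n by linarith
    then have "n = 3 * (int w * (5 * int w - 1) div 2) + int x * (5 * int x - 1) div 2
        + int y * (5 * int y - 1) div 2 + int z * (5 * int z - 1) div 2"
      by (simp add: quad_value_5_minus)
    then show ?thesis using of_nat_0_le_iff by blast
  qed (use large_5_minus in auto)
next
  fix n :: int
  assume n: "n > 682"
  show "\<exists>w x y z :: int. w \<ge> 0 \<and> x \<ge> 0 \<and> y \<ge> 0 \<and> z \<ge> 0 \<and>
      n = 3 * (w * (5 * w + 1) div 2) + x * (5 * x + 1) div 2 + y * (5 * y + 1) div 2 + z * (5 * z + 1) div 2"
  proof (cases "n < 20295")
    case True
    then have "683 \<le> nat n" "nat n < 20295" using n by linarith+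
    from quaternary_check_5_1[OF this] obtain w x y z where "nat n = 3 * quad_value 3 5 w + quad_value 3 5 x + quad_value 3 5 y + quad_value 3 5 z"
      by blast
    then have "n = int (3 * quad_value 3 5 w + quad_value 3 5 x + quad_value 3 5 y + quad_value 3 5 z)"
      using n by linarith
    then have "n = 3 * (int w * (5 * int w + 1) div 2) + int x * (5 * int x + 1) div 2
        + int y * (5 * int y + 1) div 2 + int z * (5 * int z + 1) div 2"
      by (simp add: quad_value_5_plus)
    then show ?thesis using of_nat_0_le_iff by blast
  qed (use large_5_plus in auto)
next
  have "(\<exists>w x y z :: int. int n = 3 * (w * (7 * w + 1) div 2) + x * (7 * x + 1) div 2
        + y * (7 * y + 1) div 2 + z * (7 * z + 1) div 2) \<longleftrightarrow> n \<notin> {1, 2, 5, 14}" for n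
  proof
    assume "\<exists>w x y z :: int. int n = 3 * (w * (7 * w + 1) div 2) + x * (7 * x + 1) div 2
        + y * (7 * y + 1) div 2 + z * (7 * z + 1) div 2"
    then have "int n \<notin> {1, 2, 5, 14}" using exceptions_7_1 by blast
    then show "n \<notin> {1, 2, 5, 14}" by auto
  next
    assume "n \<notin> {1, 2, 5, 14}"
    then have "int n \<notin> {1, 2, 5, 14}" by auto
    then show "\<exists>w x y z :: int. int n = 3 * (w * (7 * w + 1) div 2) + x * (7 * x + 1) div 2
        + y * (7 * y + 1) div 2 + z * (7 * z + 1) div 2"
      using small_7_1_int[of "int n"] large_7_1_int[of "int n"] by (cases "n \<le> 136") simp_all
  qed
  then show "{n :: nat. \<not> (\<exists>w x y z :: int. int n = 3 * (w * (7 * w + 1) div 2) + x * (7 * x + 1) div 2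
        + y * (7 * y + 1) div 2 + z * (7 * z + 1) div 2)} = {1, 2, 5, 14}"
    by blast
next
  have "(\<exists>w x y z :: int. int n = 3 * (w * (7 * w + 3) div 2) + x * (7 * x + 3) div 2
        + y * (7 * y + 3) div 2 + z * (7 * z + 3) div 2) \<longleftrightarrow> n \<notin> {1, 3, 14}" for n
  proof
    assume "\<exists>w x y z :: int. int n = 3 * (w * (7 * w + 3) div 2) + x * (7 * x + 3) div 2
        + y * (7 * y + 3) div 2 + z * (7 * z + 3) div 2"
    then have "int n \<notin> {1, 3, 14}" using exceptions_7_3 by blast
    then show "n \<notin> {1, 3, 14}" by auto
  next
    assume "n \<notin> {1, 3, 14}"
    then have "int n \<notin> {1, 3, 14}" by auto
    then show "\<exists>w x y z :: int. int n = 3 * (w * (7 * w + 3) div 2) + x * (7 * x + 3) div 2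
        + y * (7 * y + 3) div 2 + z * (7 * z + 3) div 2"
      using small_7_3_int[of "int n"] large_7_3_int[of "int n"] by (cases "n \<le> 136") simp_all
  qed
  then show "{n :: nat. \<not> (\<exists>w x y z :: int. int n = 3 * (w * (7 * w + 3) div 2) + x * (7 * x + 3) div 2
        + y * (7 * y + 3) div 2 + z * (7 * z + 3) div 2)} = {1, 3, 14}"
    by blast
qed

end
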